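(* Let $(a,b)\subset\mathbb{R}$ be a finite interval, let $m,r,l\ge 1$ and $n\ge 0$ be integers, and let $1\le p\le\infty$. Let $A_{0},\dots,A_{r-1}\in (W_p^{n})^{m\times m}$ be arbitrary matrix-valued functions, let $B\colon (W_p^{n+r})^m\to\mathbb{C}^l$ be an arbitrary continuous linear operator, and let $$(Ly)(t):=y^{(r)}(t)+\sum_{j=1}^{r}A_{r-j}(t)\,y^{(r-j)}(t),\qquad t\in(a,b).$$ Then the linear operator $$(L,B)\colon (W_p^{n+r})^m\to (W_p^{n})^m\times\mathbb{C}^l,\qquad y\mapsto (Ly,By),$$ is a bounded Fredholm operator with index $mr-l$.
   Context: For an integer $s\ge 1$, $W_p^{s}=W_p^{s}([a,b];\mathbb{C})$ is the complex Sobolev space $\{y\in C^{s-1}[a,b] : y^{(s-1)}\in AC[a,b],\ y^{(s)}\in L_p[a,b]\}$, and $W_p^0:=L_p$. It is a Banach space with norm $\|y\|_{s,p}=\sum_{k=0}^{s}\|y^{(k)}\|_p$, where $\|\cdot\|_p$ is the norm in $L_p([a,b];\mathbb{C})$. $(W_p^s)^m:=W_p^s([a,b];\mathbb{C}^m)$ and $(W_p^s)^{m\times m}:=W_p^s([a,b];\mathbb{C}^{m\times m})$ are the Sobolev spaces of vector-valued (column) functions and matrix-valued functions with entries in $W_p^s$, with the analogous norms. A continuous linear operator $T\colon X\to Y$ between Banach spaces is called Fredholm if its kernel and its cokernel $Y/T(X)$ are finite-dimensional; its index is $\mathrm{ind}\,T=\dim\ker T-\dim(Y/T(X))$. *)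

theory Defs
  imports "HOL-Analysis.Analysis" "HOL-Probability.Essential_Supremum"
begin

quotient_type 'b aefun = "real \<Rightarrow> 'b" / "\<lambda>f g. AE t in lebesgue. f t = g t"
  morphisms aefun_rep aefun
proof (rule equivpI)
  show "reflp (\<lambda>(f::real \<Rightarrow> 'b) g. AE t in lebesgue. f t = g t)"
    by (rule reflpI) simp
  show "symp (\<lambda>(f::real \<Rightarrow> 'b) g. AE t in lebesgue. f t = g t)"
  proof (rule sympI)
    fix f g :: "real \<Rightarrow> 'b"
    assume "AE t in lebesgue. f t = g t"
    then show "AE t in lebesgue. g t = f t" by eventually_elim simp
  qed
  show "transp (\<lambda>(f::real \<Rightarrow> 'b) g. AE t in lebesgue. f t = g t)"
  proof (rule transpI)
    fix f g h :: "real \<Rightarrow> 'b"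
    assume "AE t in lebesgue. f t = g t" "AE t in lebesgue. g t = h t"
    then show "AE t in lebesgue. f t = h t" by eventually_elim simp
  qed
qed

instantiation aefun :: (ab_group_add) ab_group_add
begin

lift_definition zero_aefun :: "'a aefun" is "\<lambda>_. 0" .

lift_definition plus_aefun :: "'a aefun \<Rightarrow> 'a aefun \<Rightarrow> 'a aefun" is "\<lambda>f g t. f t + g t"
  subgoal premises prems using prems by eventually_elim simp
  done

lift_definition uminus_aefun :: "'a aefun \<Rightarrow> 'a aefun" is "\<lambda>f t. - f t"
  subgoal premises prems using prems by eventually_elim simp
  done

lift_definition minus_aefun :: "'a aefun \<Rightarrow> 'a aefun \<Rightarrow> 'a aefun" is "\<lambda>f g t. f t - g t"
  subgoal premises prems using prems by eventually_elim simp
  done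

instance
  by standard (transfer; simp add: algebra_simps)+

end

lift_definition scale_aefun :: "complex \<Rightarrow> (complex^'m) aefun \<Rightarrow> (complex^'m) aefun"
  is "\<lambda>c f t. c *s f t"
  subgoal premises prems using prems by eventually_elim simp
  done

lemma vector_space_scale_aefun:
  "vector_space (scale_aefun :: complex \<Rightarrow> (complex^'m) aefun \<Rightarrow> (complex^'m) aefun)"
  by unfold_locales
    (transfer; simp add: vector_add_ldistrib vector_sadd_rdistrib vector_smult_assoc)+

definition abs_cont_on_interval :: "real \<Rightarrow> real \<Rightarrow> (real \<Rightarrow> 'b::real_normed_vector) \<Rightarrow> bool" where
  "abs_cont_on_interval a b f \<longleftrightarrow>
     (\<forall>\<epsilon>>0. \<exists>\<delta>>0. \<forall>I :: (real \<times> real) set.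
        finite I \<and> (\<forall>(u, v)\<in>I. a \<le> u \<and> u < v \<and> v \<le> b) \<and>
        disjoint_family_on (\<lambda>(u, v). {u<..<v}) I \<and> (\<Sum>(u, v)\<in>I. v - u) < \<delta>
        \<longrightarrow> (\<Sum>(u, v)\<in>I. norm (f v - f u)) < \<epsilon>)"

text \<open>The derivative on \<open>[a, b]\<close>, one-sided at the end points. Functions on \<open>[a, b]\<close> are
  represented throughout by functions on the real line that vanish outside \<open>[a, b]\<close>. At points of
  non-differentiability the value is unspecified, which only matters on a null set below.\<close>

definition ivl_deriv :: "real \<Rightarrow> real \<Rightarrow> (real \<Rightarrow> 'b::real_normed_vector) \<Rightarrow> real \<Rightarrow> 'b" where
  "ivl_deriv a b f t = (if t \<in> {a..b} then vector_derivative f (at t within {a..b}) else 0)"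

definition nth_deriv ::
  "real \<Rightarrow> real \<Rightarrow> nat \<Rightarrow> (real \<Rightarrow> 'b::real_normed_vector) \<Rightarrow> real \<Rightarrow> 'b" where
  "nth_deriv a b k f = (ivl_deriv a b ^^ k) f"

definition C_k_on :: "real \<Rightarrow> real \<Rightarrow> nat \<Rightarrow> (real \<Rightarrow> 'b::real_normed_vector) \<Rightarrow> bool" where
  "C_k_on a b k f \<longleftrightarrow>
     (\<forall>j<k. \<forall>t\<in>{a..b}. nth_deriv a b j f differentiable (at t within {a..b})) \<and>
     (\<forall>j\<le>k. continuous_on {a..b} (nth_deriv a b j f))"

definition Lp_fun :: "real \<Rightarrow> real \<Rightarrow> ennreal \<Rightarrow> (real \<Rightarrow> 'b::real_normed_vector) \<Rightarrow> bool" where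
  "Lp_fun a b p f \<longleftrightarrow> f \<in> borel_measurable (lebesgue_on {a..b}) \<and>
     (if p = \<infinity> then esssup (lebesgue_on {a..b}) (\<lambda>t. ennreal (norm (f t))) < \<infinity>
      else integrable (lebesgue_on {a..b}) (\<lambda>t. norm (f t) powr enn2real p))"

definition Lp_norm :: "real \<Rightarrow> real \<Rightarrow> ennreal \<Rightarrow> (real \<Rightarrow> 'b::real_normed_vector) \<Rightarrow> real" where
  "Lp_norm a b p f =
     (if p = \<infinity> then enn2real (esssup (lebesgue_on {a..b}) (\<lambda>t. ennreal (norm (f t))))
      else (\<integral>t. norm (f t) powr enn2real p \<partial>lebesgue_on {a..b}) powr (1 / enn2real p))"

text \<open>The almost everywhere differentiability clause makes explicit that the highest derivative
  \<open>y^(s)\<close> is meant in the almost everywhere sense; by Lebesgue's theorem it already follows from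
  absolute continuity of \<open>y^(s-1)\<close>.\<close>

definition sobolev_fun ::
  "real \<Rightarrow> real \<Rightarrow> ennreal \<Rightarrow> nat \<Rightarrow> (real \<Rightarrow> 'b::real_normed_vector) \<Rightarrow> bool" where
  "sobolev_fun a b p s y \<longleftrightarrow>
     (\<forall>t. t \<notin> {a..b} \<longrightarrow> y t = 0) \<and>
     (s \<ge> 1 \<longrightarrow>
        C_k_on a b (s - 1) y \<and>
        abs_cont_on_interval a b (nth_deriv a b (s - 1) y) \<and>
        (AE t in lebesgue_on {a..b}.
           nth_deriv a b (s - 1) y differentiable (at t within {a..b}))) \<and>
     Lp_fun a b p (nth_deriv a b s y)"

definition sobolev ::
  "real \<Rightarrow> real \<Rightarrow> ennreal \<Rightarrow> nat \<Rightarrow> 'b::real_normed_vector aefun set" where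
  "sobolev a b p s = aefun ` {y. sobolev_fun a b p s y}"

text \<open>For \<open>s \<ge> 1\<close> the representative is unique (by continuity); for \<open>s = 0\<close> it is an arbitrary
  member of the class.\<close>

definition sobolev_rep ::
  "real \<Rightarrow> real \<Rightarrow> ennreal \<Rightarrow> nat \<Rightarrow> 'b::real_normed_vector aefun \<Rightarrow> real \<Rightarrow> 'b" where
  "sobolev_rep a b p s u = (SOME y. sobolev_fun a b p s y \<and> aefun y = u)"

definition sobolev_norm ::
  "real \<Rightarrow> real \<Rightarrow> ennreal \<Rightarrow> nat \<Rightarrow> 'b::real_normed_vector aefun \<Rightarrow> real" where
  "sobolev_norm a b p s u = (\<Sum>k\<le>s. Lp_norm a b p (nth_deriv a b k (sobolev_rep a b p s u)))"

text \<open>The spaces are linear subspaces \<open>elems\<close> of an ambient complex vector space.\<close>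

record 'v cnspace =
  elems :: "'v set"
  cscale :: "complex \<Rightarrow> 'v \<Rightarrow> 'v"
  cnorm :: "'v \<Rightarrow> real"

definition sobolev_space ::
  "real \<Rightarrow> real \<Rightarrow> ennreal \<Rightarrow> nat \<Rightarrow> (complex^'m) aefun cnspace" where
  "sobolev_space a b p s =
     \<lparr>elems = sobolev a b p s, cscale = scale_aefun, cnorm = sobolev_norm a b p s\<rparr>"

definition coord_space :: "(complex^'l) cnspace" where
  "coord_space = \<lparr>elems = UNIV, cscale = (*s), cnorm = norm\<rparr>"

definition prod_space :: "'v cnspace \<Rightarrow> 'w cnspace \<Rightarrow> ('v \<times> 'w) cnspace" where
  "prod_space X Y =
     \<lparr>elems = elems X \<times> elems Y,
      cscale = (\<lambda>c (x, y). (cscale X c x, cscale Y c y)),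
      cnorm = (\<lambda>(x, y). cnorm X x + cnorm Y y)\<rparr>"

lemma vector_space_cscale:
  "vector_space (cscale (sobolev_space a b p s :: (complex^'m) aefun cnspace))"
  "vector_space (cscale (coord_space :: (complex^'l) cnspace))"
  by (simp_all add: sobolev_space_def coord_space_def vector_space_scale_aefun)
    (unfold_locales, simp_all add: vector_add_ldistrib vector_sadd_rdistrib vector_smult_assoc)

lemma vector_space_cscale_prod:
  fixes X :: "'v::ab_group_add cnspace" and Y :: "'w::ab_group_add cnspace"
  assumes "vector_space (cscale X)" "vector_space (cscale Y)"
  shows "vector_space (cscale (prod_space X Y))"
  using assms unfolding vector_space_def prod_space_def by auto

definition bounded_clinear_op ::
  "'v::ab_group_add cnspace \<Rightarrow> 'w::ab_group_add cnspace \<Rightarrow> ('v \<Rightarrow> 'w) \<Rightarrow> bool" where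
  "bounded_clinear_op X Y T \<longleftrightarrow>
     T ` elems X \<subseteq> elems Y \<and>
     (\<forall>x\<in>elems X. \<forall>x'\<in>elems X. T (x + x') = T x + T x') \<and>
     (\<forall>c. \<forall>x\<in>elems X. T (cscale X c x) = cscale Y c (T x)) \<and>
     (\<exists>K. \<forall>x\<in>elems X. cnorm Y (T x) \<le> K * cnorm X x)"

definition op_kernel :: "'v cnspace \<Rightarrow> ('v \<Rightarrow> 'w::zero) \<Rightarrow> 'v set" where
  "op_kernel X T = {x \<in> elems X. T x = 0}"

text \<open>\<open>quotient_basis sc V U B\<close>: the cosets \<open>v + U\<close> with \<open>v \<in> B\<close> are pairwise distinct and form a
  (Hamel) basis of \<open>V / U\<close>, for subspaces \<open>U \<subseteq> V\<close>.\<close>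

definition quotient_basis ::
  "(complex \<Rightarrow> 'v \<Rightarrow> 'v) \<Rightarrow> 'v::ab_group_add set \<Rightarrow> 'v set \<Rightarrow> 'v set \<Rightarrow> bool" where
  "quotient_basis sc V U B \<longleftrightarrow>
     B \<subseteq> V \<and>
     (\<forall>v\<in>V. \<exists>w\<in>module.span sc B. v - w \<in> U) \<and>
     (\<forall>S c. finite S \<and> S \<subseteq> B \<and> (\<Sum>v\<in>S. sc (c v) v) \<in> U \<longrightarrow> (\<forall>v\<in>S. c v = 0))"

definition quotient_findim ::
  "(complex \<Rightarrow> 'v \<Rightarrow> 'v) \<Rightarrow> 'v::ab_group_add set \<Rightarrow> 'v set \<Rightarrow> bool" where
  "quotient_findim sc V U \<longleftrightarrow> (\<exists>B. finite B \<and> quotient_basis sc V U B)"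

definition quotient_dim ::
  "(complex \<Rightarrow> 'v \<Rightarrow> 'v) \<Rightarrow> 'v::ab_group_add set \<Rightarrow> 'v set \<Rightarrow> nat" where
  "quotient_dim sc V U = card (SOME B. quotient_basis sc V U B)"

definition fredholm_op ::
  "'v::ab_group_add cnspace \<Rightarrow> 'w::ab_group_add cnspace \<Rightarrow> ('v \<Rightarrow> 'w) \<Rightarrow> bool" where
  "fredholm_op X Y T \<longleftrightarrow>
     bounded_clinear_op X Y T \<and>
     (\<exists>B. finite B \<and> module.span (cscale X) B = op_kernel X T) \<and>
     quotient_findim (cscale Y) (elems Y) (T ` elems X)"

definition fredholm_index ::
  "'v::ab_group_add cnspace \<Rightarrow> 'w::ab_group_add cnspace \<Rightarrow> ('v \<Rightarrow> 'w) \<Rightarrow> int" where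
  "fredholm_index X Y T =
     int (vector_space.dim (cscale X) (op_kernel X T)) -
     int (quotient_dim (cscale Y) (elems Y) (T ` elems X))"

text \<open>No restriction to \<open>[a, b]\<close> is needed: the representatives and their derivatives, hence also
  the resulting function, vanish outside.\<close>

definition diff_op ::
  "real \<Rightarrow> real \<Rightarrow> ennreal \<Rightarrow> nat \<Rightarrow> nat \<Rightarrow> (nat \<Rightarrow> (complex^'m^'m) aefun) \<Rightarrow>
   (complex^'m) aefun \<Rightarrow> (complex^'m) aefun" where
  "diff_op a b p n r A y =
     (let f = sobolev_rep a b p (n + r) y
      in aefun (\<lambda>t. nth_deriv a b r f t +
           (\<Sum>j = 1..r. sobolev_rep a b p n (A (r - j)) t *v nth_deriv a b (r - j) f t)))"

end

theory Submission
  imports Defs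
begin

text \<open>The operator \<open>L\<close> alone carries all the analysis: for every \<open>f\<close> in \<open>W_p^n\<close> and all initial
  values \<open>y^(k)(a)\<close>, \<open>k < r\<close>, the equation \<open>L y = f\<close> has exactly one solution in \<open>W_p^(n+r)\<close>. Hence \<open>L\<close>
  maps onto \<open>W_p^n\<close> and its kernel has dimension \<open>m r\<close>. The rest is linear algebra. The kernel of
  \<open>(L, B)\<close> is the kernel of \<open>B\<close> on \<open>ker L\<close>. Since \<open>L\<close> is onto, every class of the cokernel has a
  representative \<open>(0, z)\<close>, and \<open>(0, z)\<close> is in the range exactly when \<open>z\<close> lies in \<open>B (ker L)\<close>; so the cokernel
  is the quotient of the \<open>l\<close>-dimensional coordinate space by \<open>B (ker L)\<close>. Rank and nullity of \<open>B\<close> on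
  \<open>ker L\<close> add up to \<open>m r\<close>, and the index is \<open>m r - l\<close>, whatever \<open>B\<close> is. This is
  \<open>fredholm_from_surjective\<close>.

  Sobolev functions are handled through their \<^emph>\<open>jets\<close>, the tuples \<open>(y, y', ..., y^(s))\<close> in which
  every entry but the last is the indefinite integral of the next one and the last entry is in \<open>L_p\<close>.
  That jets and Sobolev functions are the same (\<open>jet_imp_sobolev_fun\<close>, \<open>sobolev_fun_imp_jet\<close>) is the
  content of two classical theorems, proved here with Henstock's gauges: an absolutely continuous
  function with an almost everywhere derivative is the integral of this derivative (\<open>abs_cont_FTC\<close>), and
  an indefinite integral is differentiable almost everywhere with the integrand as derivative
  (\<open>negligible_indefinite_integral_not_differentiable\<close>). Jets are stable under sums and linear maps
  because integration is linear, with no exceptional null sets to carry along.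

  For \<open>n = 0\<close> the initial value problem is a fixed point equation \<open>u = c + integral of H u\<close> for
  \<open>u = y^(r-1)\<close>, from which the lower derivatives are recovered by integration. Its Lipschitz bound is
  only integrable in time, so the contraction is taken in the sup norm weighted with \<open>exp\<close> of twice the integral of
  that bound (locale \<open>volterra\<close>). For larger \<open>n\<close> the equation
  \<open>y^(r) = f - (sum of A_(r-j) y^(r-j))\<close> raises the regularity of \<open>y\<close> one order at a time, since
  products of \<open>W_p^N\<close> functions stay in \<open>W_p^N\<close> for \<open>N \<ge> 1\<close> (\<open>product_jet\<close>). The same product
  estimates give the boundedness of \<open>L\<close>; for them a triangle inequality with a constant is enough.\<close>

section \<open>Absolute continuity and the fundamental theorem of calculus\<close>

lemma sum_interval_lengths_le_measure:
  assumes "finite I" "disjoint_family_on (\<lambda>(u, v). {u<..<v}) I"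
    and "\<And>u v. (u, v) \<in> I \<Longrightarrow> u \<le> v \<and> {u<..<v} \<subseteq> T"
    and T: "T \<in> lmeasurable"
  shows "(\<Sum>(u, v)\<in>I. v - u) \<le> measure lebesgue (T :: real set)"
proof -
  have "(\<Sum>(u, v)\<in>I. v - u) = (\<Sum>i\<in>I. measure lebesgue (case i of (u, v) \<Rightarrow> {u<..<v}))"
    using assms(3) by (intro sum.cong) auto
  also have "\<dots> = measure lebesgue (\<Union>i\<in>I. case i of (u, v) \<Rightarrow> {u<..<v})"
    using assms(1,2) by (intro measure_finite_Union [symmetric]) (auto dest!: assms(3))
  also have "\<dots> \<le> measure lebesgue T"
  proof (rule measure_mono_fmeasurable [OF _ _ T])
    show "(\<Union>i\<in>I. case i of (u, v) \<Rightarrow> {u<..<v}) \<subseteq> T" using assms(3) by (auto split: prod.splits)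
    show "(\<Union>i\<in>I. case i of (u, v) \<Rightarrow> {u<..<v}) \<in> sets lebesgue"
      using assms(1) by (intro sets.finite_UN) (auto split: prod.splits)
  qed
  finally show ?thesis .
qed

text \<open>Absolute continuity speaks of disjoint open intervals with \<open>u < v\<close>, gauge integration of tagged closed
  intervals that may be single points. Dropping the degenerate intervals, over which \<open>f\<close> has no
  increment, translates the second situation into the first.\<close>

lemma abs_cont_on_partial_division:
  fixes f :: "real \<Rightarrow> 'b::real_normed_vector"
  assumes ac: "\<And>I. \<lbrakk>finite I; \<And>u v. (u, v)\<in>I \<Longrightarrow> a \<le> u \<and> u < v \<and> v \<le> b;
         disjoint_family_on (\<lambda>(u, v). {u<..<v}) I; (\<Sum>(u, v)\<in>I. v - u) < \<delta>\<rbrakk>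
         \<Longrightarrow> (\<Sum>(u, v)\<in>I. norm (f v - f u)) < \<epsilon>"
    and p: "p tagged_partial_division_of {a..b}"
    and T: "\<And>x K. (x, K) \<in> p \<Longrightarrow> K \<subseteq> T" "T \<in> lmeasurable" "measure lebesgue T < \<delta>"
  shows "(\<Sum>(x, K)\<in>p. norm (f (Sup K) - f (Inf K))) < \<epsilon>"
proof -
  note pD = tagged_partial_division_ofD [OF p]
  define q where "q = {(x, K) \<in> p. Inf K < Sup K}"
  define \<phi> where "\<phi> = (\<lambda>(x::real, K::real set). (Inf K, Sup K))"
  have iv: "K = {Inf K..Sup K} \<and> Inf K \<le> Sup K \<and> Inf K \<in> {a..b} \<and> Sup K \<in> {a..b}" if xK: "(x, K) \<in> p" for x K
  proof -
    obtain u v where "K = {u..v}" using pD(4)[OF xK] by auto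
    with pD(2)[OF xK] pD(3)[OF xK] show ?thesis by auto
  qed
  have disj: "{Inf K<..<Sup K} \<inter> {Inf K'<..<Sup K'} = {}"
    if "(x, K) \<in> p" "(x', K') \<in> p" "(x, K) \<noteq> (x', K')" for x K x' K'
    using pD(5)[OF that] iv[OF that(1)] iv[OF that(2)] by (metis interior_atLeastAtMost_real)
  have inj: "inj_on \<phi> q"
  proof (rule inj_onI, clarify)
    fix x K x' K' assume A: "(x, K) \<in> q" "(x', K') \<in> q" "\<phi> (x, K) = \<phi> (x', K')"
    then have "{Inf K<..<Sup K} \<inter> {Inf K'<..<Sup K'} \<noteq> {}"
      by (auto simp: q_def \<phi>_def)
    with A disj show "x = x' \<and> K = K'" unfolding q_def by blast
  qed
  have fin: "finite (\<phi> ` q)" using pD(1) by (auto simp: q_def intro: finite_subset)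
  have dj: "disjoint_family_on (\<lambda>(u, v). {u<..<v}) (\<phi> ` q)"
    unfolding disjoint_family_on_def
  proof (intro ballI impI)
    fix i j assume ij: "i \<in> \<phi> ` q" "j \<in> \<phi> ` q" "i \<noteq> j"
    then obtain x K x' K' where A: "(x, K) \<in> q" "(x', K') \<in> q" "i = \<phi> (x, K)" "j = \<phi> (x', K')" by auto
    with ij have "(x, K) \<noteq> (x', K')" by metis
    with A disj have "{Inf K<..<Sup K} \<inter> {Inf K'<..<Sup K'} = {}" unfolding q_def by blast
    then show "(case i of (u, v) \<Rightarrow> {u<..<v}) \<inter> (case j of (u, v) \<Rightarrow> {u<..<v}) = {}"
      unfolding A(3,4) \<phi>_def by (simp only: prod.case)
  qed
  have ivl: "a \<le> u \<and> u < v \<and> v \<le> b" if "(u, v) \<in> \<phi> ` q" for u v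
    using that iv unfolding q_def \<phi>_def by fastforce
  have "{u<..<v} \<subseteq> T" if uv: "(u, v) \<in> \<phi> ` q" for u v
  proof -
    obtain x K where "(x, K) \<in> p" "u = Inf K" "v = Sup K" using uv unfolding q_def \<phi>_def by auto
    then show ?thesis using iv[of x K] T(1)[of x K] by (metis greaterThanLessThan_subseteq_atLeastAtMost_iff order_refl subset_trans)
  qed
  then have "(\<Sum>(u, v)\<in>\<phi> ` q. v - u) \<le> measure lebesgue T"
    using ivl by (intro sum_interval_lengths_le_measure fin dj T) (auto simp: less_imp_le)
  then have "(\<Sum>(u, v)\<in>\<phi> ` q. norm (f v - f u)) < \<epsilon>"
    using T(3) by (intro ac fin dj ivl) auto
  moreover have "(\<Sum>(u, v)\<in>\<phi> ` q. norm (f v - f u)) = (\<Sum>(x, K)\<in>q. norm (f (Sup K) - f (Inf K)))"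
    by (subst sum.reindex[OF inj]) (auto simp: \<phi>_def intro!: sum.cong)
  moreover have "\<dots> = (\<Sum>(x, K)\<in>p. norm (f (Sup K) - f (Inf K)))"
  proof (rule sum.mono_neutral_left)
    show "\<forall>i\<in>p - q. (case i of (x, K) \<Rightarrow> norm (f (Sup K) - f (Inf K))) = 0"
    proof clarify
      fix x K assume "(x, K) \<in> p" "(x, K) \<notin> q"
      then have "Inf K = Sup K" using iv[of x K] by (auto simp: q_def)
      then show "norm (f (Sup K) - f (Inf K)) = 0" by simp
    qed
  qed (auto simp: pD(1) q_def)
  ultimately show ?thesis by simp
qed

text \<open>Away from the null set \<open>N\<close> the gauge comes from differentiability, as for everywhere differentiable
  functions. At the points of \<open>N\<close> the gauge is one open set \<open>T\<close> that contains \<open>N\<close> and is so small that, by absolute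
  continuity, the increments of \<open>f\<close> over all intervals tagged in \<open>N\<close> add up to less than \<open>e / 2\<close>.\<close>

lemma abs_cont_FTC:
  fixes f :: "real \<Rightarrow> 'b::banach"
  assumes ab: "a \<le> b" and ac: "abs_cont_on_interval a b f" and N: "negligible N"
    and der: "\<And>x. x \<in> {a..b} - N \<Longrightarrow> (f has_vector_derivative f' x) (at x within {a..b})"
  shows "(f' has_integral (f b - f a)) {a..b}"
proof -
  \<comment> \<open>With the integrand set to 0 on \<open>N\<close>, only increments of \<open>f\<close> remain in the terms tagged in \<open>N\<close>.\<close>
  define g where "g x = (if x \<in> N then 0 else f' x)" for x
  have "(g has_integral (f b - f a)) (cbox a b)"
    unfolding has_integral
  proof (intro allI impI)
    fix e :: real assume e: "e > 0"
    define e1 where "e1 = e / (2 * (b - a + 1))"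
    have e1: "e1 > 0" "e1 * (b - a) < e / 2" using e ab by (auto simp: e1_def field_simps)
    from ac[unfolded abs_cont_on_interval_def, THEN spec, THEN mp, OF half_gt_zero[OF e]]
    obtain \<delta> where \<delta>: "\<delta> > 0" and *: "\<forall>I. finite I \<and> (\<forall>(u, v)\<in>I. a \<le> u \<and> u < v \<and> v \<le> b) \<and>
        disjoint_family_on (\<lambda>(u, v). {u<..<v}) I \<and> (\<Sum>(u, v)\<in>I. v - u) < \<delta>
        \<longrightarrow> (\<Sum>(u, v)\<in>I. norm (f v - f u)) < e / 2"
      by blast
    have ac': "\<And>I. \<lbrakk>finite I; \<And>u v. (u, v)\<in>I \<Longrightarrow> a \<le> u \<and> u < v \<and> v \<le> b;
         disjoint_family_on (\<lambda>(u, v). {u<..<v}) I; (\<Sum>(u, v)\<in>I. v - u) < \<delta>\<rbrakk>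
         \<Longrightarrow> (\<Sum>(u, v)\<in>I. norm (f v - f u)) < e / 2"
      by (rule *[rule_format]) auto
    obtain T where T: "open T" "N \<subseteq> T" "T \<in> lmeasurable" "measure lebesgue T < \<delta>"
    proof -
      have N': "N \<in> sets lebesgue" "measure lebesgue N = 0" "N \<in> null_sets lebesgue" 
        using N by (auto simp: negligible_iff_null_sets measure_eq_0_null_sets)
      obtain T where T: "open T" "N \<subseteq> T" "(T - N) \<in> lmeasurable" "emeasure lebesgue (T - N) < ennreal \<delta>"
        using sets_lebesgue_outer_open [OF N'(1) \<delta>] by blast
      have "emeasure lebesgue T = emeasure lebesgue (T - N)"
        using T N' by (simp add: emeasure_Diff_null_set)
      then have "T \<in> lmeasurable" "measure lebesgue T < \<delta>"
        using T \<delta> by (auto simp: fmeasurable_def measure_def enn2real_less_iff intro: le_less_trans)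
      with T that show ?thesis by blast
    qed
    have "\<forall>x\<in>{a..b} - N. \<exists>d>0. \<forall>y\<in>{a..b}. norm (y-x) < d \<longrightarrow> norm (f y - f x - (y-x) *\<^sub>R f' x) \<le> e1 * norm (y-x)"
      using der[unfolded has_vector_derivative_def has_derivative_within_alt] e1(1) by blast
    then obtain d where d: "\<And>x. x \<in> {a..b} - N \<Longrightarrow> d x > 0"
      "\<And>x y. \<lbrakk>x \<in> {a..b} - N; y \<in> {a..b}; norm (y-x) < d x\<rbrakk> \<Longrightarrow> norm (f y - f x - (y-x) *\<^sub>R f' x) \<le> e1 * norm (y-x)"
      by metis
    define \<gamma> where "\<gamma> x = (if x \<in> N then T else if x \<in> {a..b} then ball x (d x) else ball x 1)" for x
    have g: "gauge \<gamma>" using T d(1) by (auto simp: gauge_def \<gamma>_def)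
    have main: "norm ((\<Sum>(x, K)\<in>D. measure lborel K *\<^sub>R g x) - (f b - f a)) < e"
      if D: "D tagged_division_of cbox a b" "\<gamma> fine D" for D
    proof -
      note DD = tagged_division_ofD [OF D(1)]
      have iv: "K = {Inf K..Sup K} \<and> Inf K \<le> Sup K \<and> measure lborel K = Sup K - Inf K \<and> x \<in> {a..b}" if xK: "(x, K) \<in> D" for x K
      proof -
        obtain u v where "K = {u..v}" using DD(4)[OF xK] by auto
        with DD(2)[OF xK] DD(3)[OF xK] show ?thesis by auto
      qed
      let ?h = "\<lambda>(x, K). measure lborel K *\<^sub>R g x - (f (Sup K) - f (Inf K))"
      define DN where "DN = {(x, K) \<in> D. x \<in> N}"
      have DN: "DN \<subseteq> D" by (auto simp: DN_def)
      have fin: "finite D" using DD by blast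
      have "(\<Sum>(x, K)\<in>D. measure lborel K *\<^sub>R g x) - (f b - f a) = (\<Sum>i\<in>D. ?h i)"
        using additive_tagged_division_1[OF ab, of D f] D(1) by (simp add: sum_subtractf split_def)
      also have "\<dots> = (\<Sum>i\<in>D - DN. ?h i) + (\<Sum>i\<in>DN. ?h i)"
        by (rule sum.subset_diff[OF DN fin])
      finally have eq: "(\<Sum>(x, K)\<in>D. measure lborel K *\<^sub>R g x) - (f b - f a) = (\<Sum>i\<in>D - DN. ?h i) + (\<Sum>i\<in>DN. ?h i)" .
      have "norm (\<Sum>i\<in>DN. ?h i) \<le> (\<Sum>(x, K)\<in>DN. norm (f (Sup K) - f (Inf K)))"
        by (rule sum_norm_le) (auto simp: DN_def g_def norm_minus_commute)
      also have "\<dots> < e / 2"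
      proof (rule abs_cont_on_partial_division[where a = a and b = b])
        show "DN tagged_partial_division_of {a..b}"
          using tagged_division_of_def D(1) DN tagged_partial_division_subset by (metis cbox_interval)
        show "K \<subseteq> T" if "(x, K) \<in> DN" for x K
          using that D(2) unfolding DN_def fine_def \<gamma>_def by fastforce
      qed (use ac' T in auto)
      finally have 1: "norm (\<Sum>i\<in>DN. ?h i) < e / 2" .
      have "norm (\<Sum>i\<in>D - DN. ?h i) \<le> (\<Sum>(x, K)\<in>D - DN. e1 * measure lborel K)"
      proof (rule sum_norm_le, clarify)
        fix x K assume xK: "(x, K) \<in> D" "(x, K) \<notin> DN"
        define u v where "u = Inf K" and "v = Sup K"
        have K: "K = {u..v}" "u \<le> v" "measure lborel K = v - u" "x \<in> {a..b}" using iv[OF xK(1)] by (auto simp: u_def v_def)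
        have xN: "x \<in> {a..b} - N" using xK K by (auto simp: DN_def)
        have sub: "K \<subseteq> ball x (d x)" 
        proof -
          have "K \<subseteq> \<gamma> x" using D(2) xK(1) unfolding fine_def by blast
          then show ?thesis using xN by (simp add: \<gamma>_def)
        qed
        have uv: "u \<in> K" "v \<in> K" "x \<in> K" "u \<le> x" "x \<le> v" using K DD(2)[OF xK(1)] by auto
        have nv: "norm (v - x) < d x" "norm (u - x) < d x"
          using subsetD[OF sub uv(1)] subsetD[OF sub uv(2)] by (simp_all add: dist_norm norm_minus_commute)
        have uvab: "u \<in> {a..b}" "v \<in> {a..b}" using uv(1,2) DD(3)[OF xK(1)] by auto
        have "norm (f v - f x - (v-x) *\<^sub>R f' x) \<le> e1 * norm (v-x)" "norm (f u - f x - (u-x) *\<^sub>R f' x) \<le> e1 * norm (u-x)"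
          using d(2)[OF xN uvab(2) nv(1)] d(2)[OF xN uvab(1) nv(2)] by blast+
        moreover have "(v - u) *\<^sub>R f' x - (f v - f u) = (f u - f x - (u-x) *\<^sub>R f' x) - (f v - f x - (v-x) *\<^sub>R f' x)"
          by (simp add: algebra_simps)
        ultimately have "norm ((v - u) *\<^sub>R f' x - (f v - f u)) \<le> e1 * norm (u-x) + e1 * norm (v-x)"
          using norm_triangle_ineq4 by (smt (verit))
        also have "\<dots> = e1 * (v - u)" using uv by (simp add: algebra_simps)
        finally show "norm (measure lborel K *\<^sub>R g x - (f (Sup K) - f (Inf K))) \<le> e1 * measure lborel K"
          using xN K(3) by (simp add: g_def u_def v_def)
      qed
      also have "\<dots> \<le> (\<Sum>(x, K)\<in>D. e1 * measure lborel K)"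
        using fin e1 by (intro sum_mono2) auto
      also have "\<dots> = e1 * (b - a)"
        using additive_content_tagged_division[OF D(1)] ab by (simp add: sum_distrib_left[symmetric] split_def)
      finally have 2: "norm (\<Sum>i\<in>D - DN. ?h i) < e / 2" using e1 by simp
      show ?thesis unfolding eq using norm_add_less[OF 2 1] by simp
    qed
    show "\<exists>\<gamma>. gauge \<gamma> \<and> (\<forall>D. D tagged_division_of cbox a b \<and> \<gamma> fine D \<longrightarrow>
          norm ((\<Sum>(x, K)\<in>D. measure lborel K *\<^sub>R g x) - (f b - f a)) < e)"
      by (intro exI[of _ \<gamma>] conjI allI impI g main) auto
  qed
  then show ?thesis
    by (intro has_integral_spike[OF N, of _ f' g]) (auto simp: g_def)
qed

text \<open>Lebesgue's differentiation theorem. At a point of the exceptional set there are arbitrarily short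
  intervals on which the mean of \<open>f\<close> differs from the value of \<open>f\<close> by more than some \<open>k > 0\<close>. Vitali's
  theorem selects disjoint ones among them that cover the set up to a null set, and Henstock's lemma
  bounds the sum of their errors by \<open>k * e\<close>, hence their total length by \<open>e\<close>.\<close>

lemma negligible_indefinite_integral_not_differentiable:
  fixes f :: "real \<Rightarrow> 'b::euclidean_space"
  assumes f: "f integrable_on {a..b}"
  shows "negligible {t\<in>{a..b}. \<not> ((\<lambda>x. integral {a..x} f) has_vector_derivative f t) (at t within {a..b})}"
proof -
  define F where "F x = integral {a..x} f" for x
  have FI: "integral {u..v} f = F v - F u" if "a \<le> u" "u \<le> v" "v \<le> b" for u v
    using Henstock_Kurzweil_Integration.integral_combine[of a u v f] that integrable_subinterval_real[OF f, of a v]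
    by (auto simp: F_def algebra_simps)
  define E where "E k = {t\<in>{a..b}. \<forall>d>0. \<exists>s\<in>{a..b}. s \<noteq> t \<and> \<bar>s - t\<bar> < d \<and>
      norm (F s - F t - (s - t) *\<^sub>R f t) > k * \<bar>s - t\<bar>}" for k :: real
  have neg: "negligible (E k)" if k: "k > 0" for k
    unfolding negligible_outer_le
  proof (intro allI impI)
    fix e :: real assume e: "e > 0"
    obtain \<gamma> where \<gamma>: "gauge \<gamma>" 
      and Hen: "\<And>p. \<lbrakk>p tagged_partial_division_of (cbox a b); \<gamma> fine p\<rbrakk> \<Longrightarrow>
             sum (\<lambda>(x,K). norm (measure lborel K *\<^sub>R f x - integral K f)) p < k * e"
      using Henstock_lemma[of f a b "k * e"] f k e by auto
    define Q where "Q = {(t, u, v). a \<le> u \<and> u < v \<and> v \<le> b \<and> u \<le> t \<and> t \<le> v \<and> {u..v} \<subseteq> \<gamma> t \<and>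
        norm ((v - u) *\<^sub>R f t - (F v - F u)) > k * (v - u)}"
    define c r where "c = (\<lambda>(t::real, u::real, v). (u + v) / 2)" and "r = (\<lambda>(t::real, u::real, v). (v - u) / 2)"
    have cb: "cball (c (t, u, v)) (r (t, u, v)) = {u..v}" for t u v
      by (auto simp: c_def r_def cball_eq_atLeastAtMost field_simps)
    have cov: "\<exists>i. i \<in> Q \<and> t \<in> cball (c i) (r i) \<and> r i < d" if t: "t \<in> E k" and d: "d > 0" for t d
    proof -
      obtain h where h: "h > 0" "ball t h \<subseteq> \<gamma> t"
        using \<gamma> by (meson gaugeD openE)
      obtain s where s: "s \<in> {a..b}" "s \<noteq> t" "\<bar>s - t\<bar> < min h d" "norm (F s - F t - (s - t) *\<^sub>R f t) > k * \<bar>s - t\<bar>"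
        using t h d unfolding E_def by (auto dest!: spec[of _ "min h d"])
      have tab: "t \<in> {a..b}" using t by (simp add: E_def)
      define u v where "u = min s t" and "v = max s t"
      have "(v - u) *\<^sub>R f t - (F v - F u) = F s - F t - (s - t) *\<^sub>R f t \<or>
            (v - u) *\<^sub>R f t - (F v - F u) = - (F s - F t - (s - t) *\<^sub>R f t)"
        by (auto simp: u_def v_def min_def max_def algebra_simps)
      then have "norm ((v - u) *\<^sub>R f t - (F v - F u)) = norm (F s - F t - (s - t) *\<^sub>R f t)"
        by (metis norm_minus_cancel)
      moreover have vu: "v - u = \<bar>s - t\<bar>" by (auto simp: u_def v_def)
      moreover have "{u..v} \<subseteq> ball t h" using s by (auto simp: u_def v_def dist_real_def)
      moreover have "a \<le> u" "u < v" "v \<le> b" "u \<le> t" "t \<le> v"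
        using s tab by (auto simp: u_def v_def min_def max_def)
      moreover have "v - u < d" using s(3) vu by simp
      ultimately have "(t, u, v) \<in> Q" "t \<in> {u..v}" "r (t, u, v) < d"
        using s(4) h unfolding Q_def r_def by auto
      then show ?thesis using cb by metis
    qed
    have rpos: "r i > 0" if "i \<in> Q" for i using that by (auto simp: Q_def r_def)
    obtain C where C: "countable C" "C \<subseteq> Q"
       "pairwise (\<lambda>i j. disjnt (cball (c i) (r i)) (cball (c j) (r j))) C"
       "negligible (E k - (\<Union>i\<in>C. cball (c i) (r i)))"
      using Vitali_covering_theorem_cballs[of Q r "E k" c, OF rpos cov] by blast
    have bnd: "measure lebesgue (\<Union>i\<in>C'. cball (c i) (r i)) \<le> e" if C': "C' \<subseteq> C" "finite C'" for C'
    proof -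
      define \<phi> where "\<phi> = (\<lambda>(t::real, u::real, v). (t, {u..v}))"
      have inj: "inj_on \<phi> C'"
        using C'(1) C(2) by (force simp: inj_on_def \<phi>_def Q_def)
      have Qd: "u \<le> t" "t \<le> v" "a \<le> u" "u < v" "v \<le> b" "{u..v} \<subseteq> \<gamma> t" "norm ((v - u) *\<^sub>R f t - (F v - F u)) > k * (v - u)"
         if "(t, u, v) \<in> C'" for t u v using that C' C(2) by (auto simp: Q_def)
      have Kc: "snd (\<phi> i) = cball (c i) (r i)" for i
        by (cases i) (simp add: \<phi>_def cb)
      have "\<phi> ` C' tagged_partial_division_of (cbox a b)"
        unfolding tagged_partial_division_of_def
      proof (intro conjI allI impI)
        show "finite (\<phi> ` C')" using C' by simp
      next
        fix x1 K1 x2 K2 assume A: "(x1, K1) \<in> \<phi> ` C' \<and> (x2, K2) \<in> \<phi> ` C' \<and> (x1, K1) \<noteq> (x2, K2)"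
        then obtain i j where B: "i \<in> C'" "j \<in> C'" "(x1, K1) = \<phi> i" "(x2, K2) = \<phi> j" by blast
        with A have "i \<noteq> j" by auto
        then have "disjnt (cball (c i) (r i)) (cball (c j) (r j))"
          using C(3) C'(1) B(1,2) unfolding pairwise_def by blast
        then have "disjnt K1 K2" using Kc[of i] Kc[of j] B(3,4) by (metis snd_conv)
        then show "interior K1 \<inter> interior K2 = {}" unfolding disjnt_def using interior_subset by blast
      next
        fix x K assume "(x, K) \<in> \<phi> ` C'"
        then obtain u v where *: "(x, u, v) \<in> C'" "K = {u..v}" by (auto simp: \<phi>_def)
        then show "x \<in> K" "K \<subseteq> cbox a b" "\<exists>a b. K = cbox a b"
          using Qd[OF *(1)] by (auto intro: exI[of _ u] exI[of _ v])
      qed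
      moreover have "\<gamma> fine (\<phi> ` C')" using Qd by (fastforce simp: fine_def \<phi>_def)
      ultimately have "(\<Sum>(x,K)\<in>\<phi> ` C'. norm (measure lborel K *\<^sub>R f x - integral K f)) < k * e" by (rule Hen)
      moreover have "(\<Sum>(x,K)\<in>\<phi> ` C'. norm (measure lborel K *\<^sub>R f x - integral K f)) = (\<Sum>(t,u,v)\<in>C'. norm ((v - u) *\<^sub>R f t - (F v - F u)))"
      proof (subst sum.reindex[OF inj], rule sum.cong[OF refl])
        fix i assume "i \<in> C'"
        moreover obtain t u v where "i = (t, u, v)" by (cases i)
        ultimately show "((\<lambda>(x,K). norm (measure lborel K *\<^sub>R f x - integral K f)) \<circ> \<phi>) i
            = (case i of (t, u, v) \<Rightarrow> norm ((v - u) *\<^sub>R f t - (F v - F u)))"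
          using FI[of u v] Qd[of t u v] by (simp add: \<phi>_def)
      qed
      moreover have "(\<Sum>(t,u,v)\<in>C'. k * (v - u)) \<le> (\<Sum>(t,u,v)\<in>C'. norm ((v - u) *\<^sub>R f t - (F v - F u)))"
        by (rule sum_mono) (auto dest!: Qd simp: less_imp_le)
      ultimately have "k * (\<Sum>(t,u,v)\<in>C'. (v - u)) < k * e" by (simp add: sum_distrib_left split_def)
      then have "(\<Sum>(t,u,v)\<in>C'. (v - u)) \<le> e" using k by simp
      moreover have "measure lebesgue (\<Union>i\<in>C'. cball (c i) (r i)) \<le> (\<Sum>i\<in>C'. measure lebesgue (cball (c i) (r i)))"
        using C'(2) by (intro measure_UNION_le) auto
      moreover have "(\<Sum>i\<in>C'. measure lebesgue (cball (c i) (r i))) = (\<Sum>(t,u,v)\<in>C'. (v - u))"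
        by (rule sum.cong) (auto simp: cb dest: Qd)
      ultimately show ?thesis by linarith
    qed
    have U: "(\<Union>i\<in>C. cball (c i) (r i)) \<in> lmeasurable" "measure lebesgue (\<Union>i\<in>C. cball (c i) (r i)) \<le> e"
      by (rule fmeasurable_UN_bound[OF C(1) _ bnd] measure_UN_bound[OF C(1) _ bnd]; simp)+
    define Z where "Z = E k - (\<Union>i\<in>C. cball (c i) (r i))"
    have "measure lebesgue (Z \<union> (\<Union>i\<in>C. cball (c i) (r i))) \<le> 0 + e"
      using C(4) U by (smt (verit) Z_def measure_Un_le negligible_imp_measure0 negligible_imp_sets fmeasurableD)
    then show "\<exists>T. E k \<subseteq> T \<and> T \<in> lmeasurable \<and> measure lebesgue T \<le> e"
    proof (intro exI conjI)
      show "E k \<subseteq> Z \<union> (\<Union>i\<in>C. cball (c i) (r i))" by (auto simp: Z_def)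
      show "Z \<union> (\<Union>i\<in>C. cball (c i) (r i)) \<in> lmeasurable"
        using C(4) U(1) by (intro fmeasurable.Un) (auto simp: Z_def negligible_imp_measurable)
    qed simp
  qed
  have sub: "{t\<in>{a..b}. \<not> (F has_vector_derivative f t) (at t within {a..b})} \<subseteq> (\<Union>n::nat. E (1 / (Suc n)))"
  proof clarify
    fix t assume t: "t \<in> {a..b}" "\<not> (F has_vector_derivative f t) (at t within {a..b})"
    then obtain \<epsilon> where \<epsilon>: "\<epsilon> > 0" "\<And>d. d > 0 \<Longrightarrow> \<exists>y\<in>{a..b}. norm (y-t) < d \<and> \<not> norm (F y - F t - (y-t) *\<^sub>R f t) \<le> \<epsilon> * norm (y-t)"
      unfolding has_vector_derivative_def has_derivative_within_alt by (auto simp: bounded_linear_scaleR_left)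
    obtain n where n: "1 / (Suc n) < \<epsilon>" using \<epsilon>(1) nat_approx_posE by blast
    have "t \<in> E (1 / (Suc n))"
      unfolding E_def
    proof (clarsimp simp: t(1)[simplified], goal_cases)
      case (1 d)
      obtain y where y: "y\<in>{a..b}" "norm (y-t) < d" "\<not> norm (F y - F t - (y-t) *\<^sub>R f t) \<le> \<epsilon> * norm (y-t)"
        using \<epsilon>(2)[OF 1] by blast
      have "y \<noteq> t" using y(3) by auto
      moreover have "1 / (Suc n) * \<bar>y - t\<bar> \<le> \<epsilon> * \<bar>y - t\<bar>" by (intro mult_right_mono) (use n in auto)
      ultimately show ?case using y t by (intro bexI[of _ y]) auto
    qed
    then show "t \<in> (\<Union>n::nat. E (1 / (Suc n)))" by blast
  qed
  show ?thesis
    using negligible_subset[OF negligible_Union_nat sub] neg unfolding F_def by simp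
qed

text \<open>The common reason why products, multiples and compositions with Lipschitz functions stay
  absolutely continuous: increments of \<open>h\<close> are controlled by increments of \<open>f\<close> and \<open>g\<close>.\<close>

lemma abs_cont_dominated:
  fixes f :: "real \<Rightarrow> 'a::real_normed_vector" and g :: "real \<Rightarrow> 'c::real_normed_vector"
    and h :: "real \<Rightarrow> 'b::real_normed_vector"
  assumes f: "abs_cont_on_interval a b f" and g: "abs_cont_on_interval a b g"
    and le: "\<And>u v. \<lbrakk>a \<le> u; u < v; v \<le> b\<rbrakk> \<Longrightarrow> norm (h v - h u) \<le> C * (norm (f v - f u) + norm (g v - g u))"
  shows "abs_cont_on_interval a b h"
  unfolding abs_cont_on_interval_def
proof (intro allI impI)
  fix \<epsilon> :: real assume \<epsilon>: "\<epsilon> > 0"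
  define e where "e = \<epsilon> / (2 * (\<bar>C\<bar> + 1))"
  have e: "e > 0" using \<epsilon> by (simp add: e_def add_nonneg_pos)
  have eC: "(\<bar>C\<bar> + 1) * (e + e) = \<epsilon>"
  proof -
    have *: "c * (\<epsilon> / (2 * c) + \<epsilon> / (2 * c)) = \<epsilon>" if "c > 0" for c :: real using that by (simp add: field_simps)
    show ?thesis unfolding e_def by (rule *) (simp add: add_nonneg_pos)
  qed
  from f e obtain \<delta>1 where \<delta>1: "\<delta>1 > 0" "\<And>I. finite I \<and> (\<forall>(u, v)\<in>I. a \<le> u \<and> u < v \<and> v \<le> b) \<and>
        disjoint_family_on (\<lambda>(u, v). {u<..<v}) I \<and> (\<Sum>(u, v)\<in>I. v - u) < \<delta>1
        \<Longrightarrow> (\<Sum>(u, v)\<in>I. norm (f v - f u)) < e"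
    unfolding abs_cont_on_interval_def by blast
  from g e obtain \<delta>2 where \<delta>2: "\<delta>2 > 0" "\<And>I. finite I \<and> (\<forall>(u, v)\<in>I. a \<le> u \<and> u < v \<and> v \<le> b) \<and>
        disjoint_family_on (\<lambda>(u, v). {u<..<v}) I \<and> (\<Sum>(u, v)\<in>I. v - u) < \<delta>2
        \<Longrightarrow> (\<Sum>(u, v)\<in>I. norm (g v - g u)) < e"
    unfolding abs_cont_on_interval_def by blast
  show "\<exists>\<delta>>0. \<forall>I. finite I \<and> (\<forall>(u, v)\<in>I. a \<le> u \<and> u < v \<and> v \<le> b) \<and>
        disjoint_family_on (\<lambda>(u, v). {u<..<v}) I \<and> (\<Sum>(u, v)\<in>I. v - u) < \<delta>
        \<longrightarrow> (\<Sum>(u, v)\<in>I. norm (h v - h u)) < \<epsilon>"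
  proof (intro exI[of _ "min \<delta>1 \<delta>2"] conjI allI impI)
    fix I :: "(real \<times> real) set"
    assume I: "finite I \<and> (\<forall>(u, v)\<in>I. a \<le> u \<and> u < v \<and> v \<le> b) \<and>
        disjoint_family_on (\<lambda>(u, v). {u<..<v}) I \<and> (\<Sum>(u, v)\<in>I. v - u) < min \<delta>1 \<delta>2"
    have "(\<Sum>(u, v)\<in>I. norm (h v - h u)) \<le> (\<Sum>(u, v)\<in>I. (\<bar>C\<bar> + 1) * (norm (f v - f u) + norm (g v - g u)))"
    proof (rule sum_mono, clarify)
      fix u v assume "(u, v) \<in> I"
      with I have "norm (h v - h u) \<le> C * (norm (f v - f u) + norm (g v - g u))" by (intro le) auto
      also have "\<dots> \<le> (\<bar>C\<bar> + 1) * (norm (f v - f u) + norm (g v - g u))"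
        by (intro mult_right_mono) auto
      finally show "norm (h v - h u) \<le> (\<bar>C\<bar> + 1) * (norm (f v - f u) + norm (g v - g u))" .
    qed
    also have "\<dots> = (\<bar>C\<bar> + 1) * ((\<Sum>(u, v)\<in>I. norm (f v - f u)) + (\<Sum>(u, v)\<in>I. norm (g v - g u)))"
      by (simp add: sum_distrib_left[symmetric] sum.distrib split_def)
    also have "\<dots> < (\<bar>C\<bar> + 1) * (e + e)"
      using \<delta>1(2)[of I] \<delta>2(2)[of I] I by (intro mult_strict_left_mono add_strict_mono) auto
    finally show "(\<Sum>(u, v)\<in>I. norm (h v - h u)) < \<epsilon>" using eC by simp
  qed (use \<delta>1 \<delta>2 in auto)
qed

lemma abs_cont_subinterval:
  assumes f: "abs_cont_on_interval a b f" and "c \<le> b"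
  shows "abs_cont_on_interval a c f"
  unfolding abs_cont_on_interval_def
proof (intro allI impI)
  fix \<epsilon> :: real assume "\<epsilon> > 0"
  with f obtain \<delta> where \<delta>: "\<delta> > 0" "\<And>I. finite I \<and> (\<forall>(u, v)\<in>I. a \<le> u \<and> u < v \<and> v \<le> b) \<and>
        disjoint_family_on (\<lambda>(u, v). {u<..<v}) I \<and> (\<Sum>(u, v)\<in>I. v - u) < \<delta>
        \<Longrightarrow> (\<Sum>(u, v)\<in>I. norm (f v - f u)) < \<epsilon>"
    unfolding abs_cont_on_interval_def by blast
  show "\<exists>\<delta>>0. \<forall>I. finite I \<and> (\<forall>(u, v)\<in>I. a \<le> u \<and> u < v \<and> v \<le> c) \<and>
        disjoint_family_on (\<lambda>(u, v). {u<..<v}) I \<and> (\<Sum>(u, v)\<in>I. v - u) < \<delta>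
        \<longrightarrow> (\<Sum>(u, v)\<in>I. norm (f v - f u)) < \<epsilon>"
  proof (intro exI[of _ \<delta>] conjI allI impI \<delta>)
    fix I :: "(real \<times> real) set"
    assume I: "finite I \<and> (\<forall>(u, v)\<in>I. a \<le> u \<and> u < v \<and> v \<le> c) \<and>
        disjoint_family_on (\<lambda>(u, v). {u<..<v}) I \<and> (\<Sum>(u, v)\<in>I. v - u) < \<delta>"
    have "\<forall>(u, v)\<in>I. a \<le> u \<and> u < v \<and> v \<le> b" using I \<open>c \<le> b\<close> by fastforce
    with I show "finite I" "\<forall>(u, v)\<in>I. a \<le> u \<and> u < v \<and> v \<le> b" "disjoint_family_on (\<lambda>(u, v). {u<..<v}) I"
      "(\<Sum>(u, v)\<in>I. v - u) < \<delta>" by blast+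
  qed
qed

lemma abs_cont_imp_continuous:
  assumes "abs_cont_on_interval a b f"
  shows "continuous_on {a..b} f"
  unfolding continuous_on_iff
proof (intro ballI allI impI)
  fix t \<epsilon> :: real assume t: "t \<in> {a..b}" and \<epsilon>: "\<epsilon> > 0"
  with assms obtain \<delta> where \<delta>: "\<delta> > 0" "\<And>I. finite I \<and> (\<forall>(u, v)\<in>I. a \<le> u \<and> u < v \<and> v \<le> b) \<and>
        disjoint_family_on (\<lambda>(u, v). {u<..<v}) I \<and> (\<Sum>(u, v)\<in>I. v - u) < \<delta>
        \<Longrightarrow> (\<Sum>(u, v)\<in>I. norm (f v - f u)) < \<epsilon>"
    unfolding abs_cont_on_interval_def by blast
  have *: "norm (f v - f u) < \<epsilon>" if "a \<le> u" "u < v" "v \<le> b" "v - u < \<delta>" for u v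
    using \<delta>(2)[of "{(u, v)}"] that by (simp add: disjoint_family_on_def)
  show "\<exists>d>0. \<forall>x'\<in>{a..b}. dist x' t < d \<longrightarrow> dist (f x') (f t) < \<epsilon>"
  proof (intro exI[of _ \<delta>] conjI ballI impI \<delta>)
    fix s assume s: "s \<in> {a..b}" "dist s t < \<delta>"
    consider "s < t" | "s = t" | "t < s" by linarith
    then show "dist (f s) (f t) < \<epsilon>"
      using *[of s t] *[of t s] s t \<epsilon> by cases (auto simp: dist_norm norm_minus_commute)
  qed
qed

lemma abs_cont_bilinear:
  assumes bl: "bounded_bilinear mul"
    and f: "abs_cont_on_interval a b f" and g: "abs_cont_on_interval a b g"
  shows "abs_cont_on_interval a b (\<lambda>t. mul (f t) (g t))"
proof -
  interpret bounded_bilinear mul by fact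
  obtain K where K: "K > 0" "\<And>x y. norm (mul x y) \<le> norm x * norm y * K"
    using pos_bounded by blast
  have "bounded (f ` {a..b})" "bounded (g ` {a..b})"
    using abs_cont_imp_continuous[OF f] abs_cont_imp_continuous[OF g]
    by (auto intro!: compact_imp_bounded compact_continuous_image)
  then obtain F G where "\<forall>x\<in>f ` {a..b}. norm x \<le> F" "\<forall>x\<in>g ` {a..b}. norm x \<le> G"
    unfolding bounded_iff by blast
  then have F: "\<And>t. t \<in> {a..b} \<Longrightarrow> norm (f t) \<le> F" and G: "\<And>t. t \<in> {a..b} \<Longrightarrow> norm (g t) \<le> G"
    by auto
  show ?thesis
  proof (rule abs_cont_dominated[OF f g, where C = "K * (\<bar>F\<bar> + \<bar>G\<bar>)"])
    fix u v assume uv: "a \<le> u" "u < v" "v \<le> b"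
    have "mul (f v) (g v) - mul (f u) (g u) = mul (f v) (g v - g u) + mul (f v - f u) (g u)"
      by (simp add: diff_left diff_right)
    also have "norm \<dots> \<le> norm (f v) * norm (g v - g u) * K + norm (f v - f u) * norm (g u) * K"
      by (rule order.trans[OF norm_triangle_ineq]) (intro add_mono K)
    also have "\<dots> \<le> (\<bar>F\<bar> + \<bar>G\<bar>) * norm (g v - g u) * K + norm (f v - f u) * (\<bar>F\<bar> + \<bar>G\<bar>) * K"
      using F[of v] G[of u] uv K(1) by (intro add_mono mult_right_mono mult_left_mono) auto
    also have "\<dots> = K * (\<bar>F\<bar> + \<bar>G\<bar>) * (norm (f v - f u) + norm (g v - g u))"
      by (simp add: algebra_simps)
    finally show "norm (mul (f v) (g v) - mul (f u) (g u)) \<le> K * (\<bar>F\<bar> + \<bar>G\<bar>) * (norm (f v - f u) + norm (g v - g u))" .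
  qed
qed

lemma integral_diff_subinterval:
  fixes f :: "real \<Rightarrow> 'b::euclidean_space"
  assumes "f integrable_on {a..b}" "a \<le> u" "u \<le> v" "v \<le> b"
  shows "integral {a..v} f - integral {a..u} f = integral {u..v} f"
  using Henstock_Kurzweil_Integration.integral_combine[of a u v f] assms integrable_subinterval_real[OF assms(1), of a v]
  by (auto simp: algebra_simps)

text \<open>Split \<open>norm f\<close> at a height \<open>n\<close>: the part below contributes at most \<open>n\<close> times the total length of the
  intervals, and the excess \<open>h n\<close> has small integral over all of \<open>{a..b}\<close> once \<open>n\<close> is large.\<close>

lemma abs_cont_indefinite_integral:
  fixes f :: "real \<Rightarrow> 'b::euclidean_space"
  assumes f: "f absolutely_integrable_on {a..b}"
  shows "abs_cont_on_interval a b (\<lambda>t. integral {a..t} f)"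
  unfolding abs_cont_on_interval_def
proof (intro allI impI)
  fix \<epsilon> :: real assume \<epsilon>: "\<epsilon> > 0"
  define h where "h n t = max (norm (f t) - real n) 0" for n t
  have nf: "(\<lambda>t. norm (f t)) integrable_on {a..b}" and f': "f integrable_on {a..b}"
    using f by (auto simp: absolutely_integrable_on_def)
  have hint: "h n integrable_on {a..b}" for n
  proof -
    have "(\<lambda>t. norm (f t)) \<in> borel_measurable (lebesgue_on {a..b})"
      using integrable_imp_measurable[OF nf] .
    then have "h n \<in> borel_measurable (lebesgue_on {a..b})" unfolding h_def by measurable
    then show ?thesis
      by (rule measurable_bounded_by_integrable_imp_integrable[OF _ nf]) (auto simp: h_def)
  qed
  have "(\<lambda>n. integral {a..b} (h n)) \<longlonglongrightarrow> integral {a..b} (\<lambda>t. 0::real)"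
  proof (rule dominated_convergence(2)[OF hint nf])
    show "(\<lambda>n. h n t) \<longlonglongrightarrow> 0" for t
    proof (rule tendsto_eventually)
      obtain N where "norm (f t) \<le> real N" using real_arch_simple by blast
      then show "\<forall>\<^sub>F n in sequentially. h n t = 0"
        unfolding eventually_sequentially h_def by (intro exI[of _ N]) auto
    qed
  qed (auto simp: h_def)
  then have "\<forall>\<^sub>F n in sequentially. integral {a..b} (h n) < \<epsilon> / 2"
    using \<epsilon> by (intro order_tendstoD(2)[where a = "\<epsilon> / 2"]) auto
  then obtain n where n: "integral {a..b} (h n) < \<epsilon> / 2" by (auto simp: eventually_sequentially)
  show "\<exists>\<delta>>0. \<forall>I. finite I \<and> (\<forall>(u, v)\<in>I. a \<le> u \<and> u < v \<and> v \<le> b) \<and>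
        disjoint_family_on (\<lambda>(u, v). {u<..<v}) I \<and> (\<Sum>(u, v)\<in>I. v - u) < \<delta>
        \<longrightarrow> (\<Sum>(u, v)\<in>I. norm (integral {a..v} f - integral {a..u} f)) < \<epsilon>"
  proof (intro exI[of _ "\<epsilon> / (2 * (real n + 1))"] conjI allI impI)
    fix I :: "(real \<times> real) set"
    assume I: "finite I \<and> (\<forall>(u, v)\<in>I. a \<le> u \<and> u < v \<and> v \<le> b) \<and>
        disjoint_family_on (\<lambda>(u, v). {u<..<v}) I \<and> (\<Sum>(u, v)\<in>I. v - u) < \<epsilon> / (2 * (real n + 1))"
    have Iuv: "a \<le> u" "u < v" "v \<le> b" if "(u, v) \<in> I" for u v using I that by auto
    have sub: "h n integrable_on {u..v}" "(\<lambda>t. norm (f t)) integrable_on {u..v}" "f integrable_on {u..v}"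
      if "(u, v) \<in> I" for u v
      by (rule integrable_subinterval_real[OF hint] integrable_subinterval_real[OF nf]
          integrable_subinterval_real[OF f'], use Iuv[OF that] in force)+
    have "(\<Sum>(u, v)\<in>I. norm (integral {a..v} f - integral {a..u} f))
        \<le> (\<Sum>(u, v)\<in>I. real n * (v - u) + integral {u..v} (h n))"
    proof (rule sum_mono, clarify)
      fix u v assume uv: "(u, v) \<in> I"
      have "norm (integral {a..v} f - integral {a..u} f) = norm (integral {u..v} f)"
        using integral_diff_subinterval[OF f'] Iuv[OF uv] by simp
      also have "\<dots> \<le> integral {u..v} (\<lambda>t. real n + h n t)"
        by (rule integral_norm_bound_integral) (use sub[OF uv] in \<open>auto intro!: integrable_add\<close>, simp add: h_def)
      also have "\<dots> = real n * (v - u) + integral {u..v} (h n)"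
        using sub[OF uv] Iuv[OF uv] by (subst integral_add) auto
      finally show "norm (integral {a..v} f - integral {a..u} f) \<le> real n * (v - u) + integral {u..v} (h n)" .
    qed
    also have "\<dots> = real n * (\<Sum>(u, v)\<in>I. v - u) + (\<Sum>(u, v)\<in>I. integral {u..v} (h n))"
      by (simp add: sum.distrib sum_distrib_left split_def)
    also have "\<dots> < \<epsilon> / 2 + \<epsilon> / 2"
    proof (rule add_le_less_mono)
      have "real n * (\<Sum>(u, v)\<in>I. v - u) \<le> (real n + 1) * (\<epsilon> / (2 * (real n + 1)))"
        using I \<epsilon> Iuv by (intro mult_mono sum_nonneg) (auto simp: less_imp_le)
      also have "\<dots> = \<epsilon> / 2" by (simp add: field_simps)
      finally show "real n * (\<Sum>(u, v)\<in>I. v - u) \<le> \<epsilon> / 2" .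
      have hi: "(h n has_integral (\<Sum>i\<in>I. case i of (u, v) \<Rightarrow> integral {u..v} (h n))) (\<Union>i\<in>I. case i of (u, v) \<Rightarrow> {u<..<v})"
      proof (rule has_integral_UN)
        fix i assume i: "i \<in> I"
        obtain u v where [simp]: "i = (u, v)" by (cases i)
        show "(h n has_integral (case i of (u, v) \<Rightarrow> integral {u..v} (h n))) (case i of (u, v) \<Rightarrow> {u<..<v})"
          using sub(1)[of u v] i by (simp add: has_integral_Icc_iff_Ioo[symmetric] integrable_integral)
      next
        show "pairwise (\<lambda>i i'. negligible ((case i of (u, v) \<Rightarrow> {u<..<v}) \<inter> (case i' of (u, v) \<Rightarrow> {u<..<v}))) I"
          using I unfolding pairwise_def disjoint_family_on_def by (metis negligible_empty)
      qed (use I in auto)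
      have "(\<Sum>(u, v)\<in>I. integral {u..v} (h n)) \<le> integral {a..b} (h n)"
        by (rule has_integral_subset_le[OF _ hi integrable_integral[OF hint]])
          (use Iuv in \<open>fastforce simp: h_def\<close>)+
      with n show "(\<Sum>(u, v)\<in>I. integral {u..v} (h n)) < \<epsilon> / 2" by simp
    qed
    finally show "(\<Sum>(u, v)\<in>I. norm (integral {a..v} f - integral {a..u} f)) < \<epsilon>" by simp
  qed (use \<epsilon> in auto)
qed

text \<open>Integration by parts for two indefinite integrals: their product is absolutely continuous and satisfies the product
  rule outside the two null sets where the factors fail to be differentiable.\<close>

lemma bilinear_by_parts:
  fixes a b :: real and mul :: "'a::euclidean_space \<Rightarrow> 'c::euclidean_space \<Rightarrow> 'b::euclidean_space"
    and f f' :: "real \<Rightarrow> 'a" and g g' :: "real \<Rightarrow> 'c"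
  assumes bl: "bounded_bilinear mul" and ab: "a \<le> b"
    and f': "f' absolutely_integrable_on {a..b}" and g': "g' absolutely_integrable_on {a..b}"
    and f: "\<And>t. t \<in> {a..b} \<Longrightarrow> f t = f a + integral {a..t} f'"
    and g: "\<And>t. t \<in> {a..b} \<Longrightarrow> g t = g a + integral {a..t} g'"
    and t: "t \<in> {a..b}"
  shows "((\<lambda>t. mul (f' t) (g t) + mul (f t) (g' t)) has_integral (mul (f t) (g t) - mul (f a) (g a))) {a..t}"
proof -
  interpret bounded_bilinear mul by fact
  have sub: "{a..t} \<subseteq> {a..b}" using t by auto
  have ac: "abs_cont_on_interval a b f" "abs_cont_on_interval a b g"
    by (rule abs_cont_dominated[OF abs_cont_indefinite_integral[OF f'] abs_cont_indefinite_integral[OF f'], where C = 1], subst (1 2) f, auto,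
        rule abs_cont_dominated[OF abs_cont_indefinite_integral[OF g'] abs_cont_indefinite_integral[OF g'], where C = 1], subst (1 2) g, auto)
  have ac': "abs_cont_on_interval a t (\<lambda>t. mul (f t) (g t))"
    using abs_cont_subinterval[OF abs_cont_bilinear[OF bl ac], of t] t by simp
  define N where "N = {t\<in>{a..b}. \<not> ((\<lambda>x. integral {a..x} f') has_vector_derivative f' t) (at t within {a..b})} \<union>
     {t\<in>{a..b}. \<not> ((\<lambda>x. integral {a..x} g') has_vector_derivative g' t) (at t within {a..b})}"
  have N: "negligible N"
    unfolding N_def by (intro negligible_Un negligible_indefinite_integral_not_differentiable
        set_lebesgue_integral_eq_integral(1)[OF f'] set_lebesgue_integral_eq_integral(1)[OF g'])
  show ?thesis
  proof (rule abs_cont_FTC[OF _ ac' N])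
    fix s assume s: "s \<in> {a..t} - N"
    then have sab: "s \<in> {a..b}" using sub by auto
    have "((\<lambda>x. integral {a..x} f') has_vector_derivative f' s) (at s within {a..b})"
      "((\<lambda>x. integral {a..x} g') has_vector_derivative g' s) (at s within {a..b})"
      using s sab unfolding N_def by blast+
    then have "((\<lambda>x. f a + integral {a..x} f') has_vector_derivative 0 + f' s) (at s within {a..b})"
      "((\<lambda>x. g a + integral {a..x} g') has_vector_derivative 0 + g' s) (at s within {a..b})"
      by - (rule has_vector_derivative_add[OF has_vector_derivative_const], assumption)+
    then have d: "(f has_vector_derivative f' s) (at s within {a..b})" "(g has_vector_derivative g' s) (at s within {a..b})"
      using has_vector_derivative_transform[OF sab f] has_vector_derivative_transform[OF sab g] by auto
    have "((\<lambda>t. mul (f t) (g t)) has_vector_derivative mul (f s) (g' s) + mul (f' s) (g s)) (at s within {a..b})"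
      using has_vector_derivative[OF d] .
    then show "((\<lambda>t. mul (f t) (g t)) has_vector_derivative mul (f' s) (g s) + mul (f s) (g' s)) (at s within {a..t})"
      using has_vector_derivative_within_subset[OF _ sub] by (simp add: add.commute)
  qed (use t in auto)
qed

lemma AE_lebesgue_on_iff_negligible:
  fixes a b :: real
  shows "(AE t in lebesgue_on {a..b}. P t) \<longleftrightarrow> negligible {t\<in>{a..b}. \<not> P t}"
proof -
  have "{x. \<not> (x \<in> {a..b} \<longrightarrow> P x)} = {t\<in>{a..b}. \<not> P t}" by auto
  then have "(AE t in lebesgue_on {a..b}. P t) \<longleftrightarrow> (\<exists>N\<in>null_sets lebesgue. {t\<in>{a..b}. \<not> P t} \<subseteq> N)"
    by (subst AE_restrict_space_iff) (simp_all add: eventually_ae_filter)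
  also have "\<dots> \<longleftrightarrow> negligible {t\<in>{a..b}. \<not> P t}"
  proof
    assume "\<exists>N\<in>null_sets lebesgue. {t\<in>{a..b}. \<not> P t} \<subseteq> N"
    then show "negligible {t\<in>{a..b}. \<not> P t}" using negligible_subset negligible_iff_null_sets by blast
  next
    assume "negligible {t\<in>{a..b}. \<not> P t}"
    then show "\<exists>N\<in>null_sets lebesgue. {t\<in>{a..b}. \<not> P t} \<subseteq> N" using negligible_iff_null_sets by blast
  qed
  finally show ?thesis .
qed

section \<open>Coarse estimates in Lp\<close>

lemma Lp_norm_nonneg: "Lp_norm a b p f \<ge> 0"
  by (simp add: Lp_norm_def)

text \<open>Together with \<open>Lp_add\<close> and \<open>Lp_absolutely_integrable\<close> this hides the distinction between \<open>p = \<infinity>\<close> and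
  \<open>p < \<infinity>\<close>, so that the later arguments are uniform in \<open>p\<close>.\<close>

lemma Lp_dominated:
  fixes f :: "real \<Rightarrow> 'a::real_normed_vector" and g :: "real \<Rightarrow> 'b::real_normed_vector"
  assumes p: "1 \<le> p" and f: "Lp_fun a b p f" and g: "g \<in> borel_measurable (lebesgue_on {a..b})"
    and C: "C \<ge> 0" and le: "AE t in lebesgue_on {a..b}. norm (g t) \<le> C * norm (f t)"
  shows "Lp_fun a b p g" and "Lp_norm a b p g \<le> C * Lp_norm a b p f"
proof -
  let ?M = "lebesgue_on {a..b}"
  have "Lp_fun a b p g \<and> Lp_norm a b p g \<le> C * Lp_norm a b p f"
  proof (cases "p = \<infinity>")
    case True
    define c where "c = esssup ?M (\<lambda>t. ennreal (norm (f t)))"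
    have c: "c < \<infinity>" using f True by (simp add: Lp_fun_def c_def)
    have "AE t in ?M. ennreal (norm (f t)) \<le> c" unfolding c_def by (rule esssup_AE)
    with le have "AE t in ?M. ennreal (norm (g t)) \<le> ennreal C * c"
    proof eventually_elim
      case (elim t)
      have "ennreal (norm (g t)) \<le> ennreal C * ennreal (norm (f t))"
        using elim C by (metis ennreal_leI ennreal_mult norm_ge_zero)
      also have "\<dots> \<le> ennreal C * c" using elim by (intro mult_left_mono) auto
      finally show ?case .
    qed
    moreover have "(\<lambda>t. ennreal (norm (g t))) \<in> borel_measurable ?M" using g by measurable
    ultimately have "esssup ?M (\<lambda>t. ennreal (norm (g t))) \<le> ennreal C * c" by (intro esssup_I)
    moreover have "ennreal C * c < \<infinity>" using c by (simp add: ennreal_mult_less_top)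
    ultimately have "esssup ?M (\<lambda>t. ennreal (norm (g t))) < \<infinity>" "enn2real (esssup ?M (\<lambda>t. ennreal (norm (g t)))) \<le> enn2real (ennreal C * c)"
      by (auto simp: enn2real_mono)
    then show ?thesis using True g C by (simp add: Lp_fun_def Lp_norm_def c_def enn2real_mult)
  next
    case False
    define q where "q = enn2real p"
    have q: "q \<ge> 1" using p False unfolding q_def by (metis enn2real_1 enn2real_mono infinity_ennreal_def top.not_eq_extremum)
    have fi: "integrable ?M (\<lambda>t. norm (f t) powr q)" using f False by (simp add: Lp_fun_def q_def)
    have le': "AE t in ?M. norm (g t) powr q \<le> C powr q * norm (f t) powr q"
      using le
    proof eventually_elim
      case (elim t)
      then have "norm (g t) powr q \<le> (C * norm (f t)) powr q" using q by (intro powr_mono2) auto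
      then show ?case by (simp add: powr_mult)
    qed
    have gi: "integrable ?M (\<lambda>t. norm (g t) powr q)"
    proof (rule Bochner_Integration.integrable_bound)
      show "integrable ?M (\<lambda>t. C powr q * norm (f t) powr q)" using fi by simp
      show "(\<lambda>t. norm (g t) powr q) \<in> borel_measurable ?M" using g by measurable
      show "AE t in ?M. norm (norm (g t) powr q) \<le> norm (C powr q * norm (f t) powr q)"
        using le' by eventually_elim simp
    qed
    have "(\<integral>t. norm (g t) powr q \<partial>?M) \<le> (\<integral>t. C powr q * norm (f t) powr q \<partial>?M)"
      using fi gi le' by (intro integral_mono_AE) auto
    then have "(\<integral>t. norm (g t) powr q \<partial>?M) \<le> C powr q * (\<integral>t. norm (f t) powr q \<partial>?M)" by simp
    then have "(\<integral>t. norm (g t) powr q \<partial>?M) powr (1/q) \<le> (C powr q * (\<integral>t. norm (f t) powr q \<partial>?M)) powr (1/q)"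
      using q by (intro powr_mono2) auto
    also have "\<dots> = C * (\<integral>t. norm (f t) powr q \<partial>?M) powr (1/q)"
      using q C by (simp add: powr_mult powr_powr)
    finally show ?thesis using g gi False by (simp add: Lp_fun_def Lp_norm_def q_def)
  qed
  then show "Lp_fun a b p g" "Lp_norm a b p g \<le> C * Lp_norm a b p f" by auto
qed

text \<open>The bound \<open>norm (f + g) \<le> 2 * max (norm f) (norm g)\<close> replaces Minkowski's inequality. It costs the factor
  \<open>2\<close>, and comparing \<open>(A + B) powr (1/q)\<close> with \<open>A powr (1/q) + B powr (1/q)\<close> through the maximum costs another
  \<open>2 powr (1/q) \<le> 2\<close>. Boundedness of operators is insensitive to such constants.\<close>

lemma Lp_add:
  fixes f g :: "real \<Rightarrow> 'b::euclidean_space"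
  assumes p: "1 \<le> p" and f: "Lp_fun a b p f" and g: "Lp_fun a b p g"
  shows "Lp_fun a b p (\<lambda>t. f t + g t)"
    and "Lp_norm a b p (\<lambda>t. f t + g t) \<le> 4 * (Lp_norm a b p f + Lp_norm a b p g)"
proof -
  let ?M = "lebesgue_on {a..b}"
  have [measurable]: "f \<in> borel_measurable ?M" "g \<in> borel_measurable ?M" using f g by (auto simp: Lp_fun_def)
  have fgm: "(\<lambda>t. f t + g t) \<in> borel_measurable ?M" by measurable
  have "Lp_fun a b p (\<lambda>t. f t + g t) \<and> Lp_norm a b p (\<lambda>t. f t + g t) \<le> 4 * (Lp_norm a b p f + Lp_norm a b p g)"
  proof (cases "p = \<infinity>")
    case True
    define c where "c = esssup ?M (\<lambda>t. ennreal (norm (f t)))"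
    define d where "d = esssup ?M (\<lambda>t. ennreal (norm (g t)))"
    have c: "c < \<infinity>" "d < \<infinity>" using f g True by (simp_all add: Lp_fun_def c_def d_def)
    have "AE t in ?M. ennreal (norm (f t)) \<le> c" "AE t in ?M. ennreal (norm (g t)) \<le> d"
      unfolding c_def d_def by (rule esssup_AE)+
    then have "AE t in ?M. ennreal (norm (f t + g t)) \<le> c + d"
    proof eventually_elim
      case (elim t)
      have "ennreal (norm (f t + g t)) \<le> ennreal (norm (f t)) + ennreal (norm (g t))"
        by (simp add: norm_triangle_ineq flip: ennreal_plus)
      also have "\<dots> \<le> c + d" using elim by (rule add_mono)
      finally show ?case .
    qed
    then have le: "esssup ?M (\<lambda>t. ennreal (norm (f t + g t))) \<le> c + d"
      by (intro esssup_I) measurable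
    have cd: "c + d < \<infinity>" using c by simp
    have "enn2real (esssup ?M (\<lambda>t. ennreal (norm (f t + g t)))) \<le> enn2real (c + d)"
      using le cd by (intro enn2real_mono) auto
    also have "\<dots> = enn2real c + enn2real d" using c by (intro enn2real_plus) auto
    finally have 1: "enn2real (esssup ?M (\<lambda>t. ennreal (norm (f t + g t)))) \<le> 4 * (enn2real c + enn2real d)"
      by (smt (verit) enn2real_nonneg)
    show ?thesis using True fgm 1 le_less_trans[OF le cd] by (simp add: Lp_fun_def Lp_norm_def c_def d_def)
  next
    case False
    define q where "q = enn2real p"
    have q: "q \<ge> 1" using p False unfolding q_def by (metis enn2real_1 enn2real_mono infinity_ennreal_def top.not_eq_extremum)
    have fi: "integrable ?M (\<lambda>t. norm (f t) powr q)" "integrable ?M (\<lambda>t. norm (g t) powr q)"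
      using f g False by (simp_all add: Lp_fun_def q_def)
    have le': "norm (f t + g t) powr q \<le> 2 powr q * (norm (f t) powr q + norm (g t) powr q)" for t
    proof -
      have "norm (f t + g t) \<le> 2 * max (norm (f t)) (norm (g t))"
        by (smt (verit) norm_triangle_ineq)
      then have "norm (f t + g t) powr q \<le> (2 * max (norm (f t)) (norm (g t))) powr q" using q by (intro powr_mono2) auto
      also have "\<dots> = 2 powr q * max (norm (f t)) (norm (g t)) powr q" by (simp add: powr_mult)
      also have "\<dots> \<le> 2 powr q * (norm (f t) powr q + norm (g t) powr q)"
        by (intro mult_left_mono) (auto simp: max_def)
      finally show ?thesis .
    qed
    have gi: "integrable ?M (\<lambda>t. norm (f t + g t) powr q)"
    proof (rule Bochner_Integration.integrable_bound)
      show "integrable ?M (\<lambda>t. 2 powr q * (norm (f t) powr q + norm (g t) powr q))" using fi by simp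
      show "(\<lambda>t. norm (f t + g t) powr q) \<in> borel_measurable ?M" by measurable
      show "AE t in ?M. norm (norm (f t + g t) powr q) \<le> norm (2 powr q * (norm (f t) powr q + norm (g t) powr q))"
        using le' by (intro AE_I2) simp
    qed
    define A B where "A = (\<integral>t. norm (f t) powr q \<partial>?M)" and "B = (\<integral>t. norm (g t) powr q \<partial>?M)"
    have AB: "A \<ge> 0" "B \<ge> 0" by (auto simp: A_def B_def)
    have "(\<integral>t. norm (f t + g t) powr q \<partial>?M) \<le> (\<integral>t. 2 powr q * (norm (f t) powr q + norm (g t) powr q) \<partial>?M)"
      using fi gi le' by (intro integral_mono) auto
    also have "\<dots> = 2 powr q * (A + B)" using fi by (simp add: A_def B_def)
    also have "\<dots> \<le> 2 powr q * (2 * max A B)" by (intro mult_left_mono) auto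
    finally have "(\<integral>t. norm (f t + g t) powr q \<partial>?M) powr (1/q) \<le> (2 powr q * (2 * max A B)) powr (1/q)"
      using q by (intro powr_mono2) auto
    also have "\<dots> = 2 * (2 powr (1/q) * max A B powr (1/q))"
      using q by (simp add: powr_mult powr_powr)
    also have "\<dots> \<le> 2 * (2 * (A powr (1/q) + B powr (1/q)))"
    proof (intro mult_left_mono mult_mono)
      have "(2::real) powr (1/q) \<le> 2 powr 1" using q by (intro powr_mono) auto
      then show "(2::real) powr (1/q) \<le> 2" by simp
      show "max A B powr (1/q) \<le> A powr (1/q) + B powr (1/q)" by (simp add: max_def)
    qed auto
    finally show ?thesis using fgm gi False by (simp add: Lp_fun_def Lp_norm_def q_def A_def B_def)
  qed
  then show "Lp_fun a b p (\<lambda>t. f t + g t)" "Lp_norm a b p (\<lambda>t. f t + g t) \<le> 4 * (Lp_norm a b p f + Lp_norm a b p g)" by auto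
qed

lemma Lp_absolutely_integrable:
  fixes f :: "real \<Rightarrow> 'b::euclidean_space"
  assumes p: "1 \<le> p" and f: "Lp_fun a b p f" and ab: "a \<le> b"
  shows "f absolutely_integrable_on {a..b}"
    and "integral {a..b} (\<lambda>t. norm (f t)) \<le> (b - a + 1) * Lp_norm a b p f"
proof -
  let ?M = "lebesgue_on {a..b}"
  have [measurable]: "f \<in> borel_measurable ?M" using f by (auto simp: Lp_fun_def)
  have "integrable ?M (\<lambda>t. norm (f t)) \<and> (\<integral>t. norm (f t) \<partial>?M) \<le> (b - a + 1) * Lp_norm a b p f"
  proof (cases "p = \<infinity>")
    case True
    define c where "c = Lp_norm a b p f"
    have "esssup ?M (\<lambda>t. ennreal (norm (f t))) = ennreal c"
      using f True by (simp add: Lp_fun_def c_def Lp_norm_def)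
    then have "AE t in ?M. ennreal (norm (f t)) \<le> ennreal c" by (metis esssup_AE)
    then have le: "AE t in ?M. norm (f t) \<le> c"
      by eventually_elim (simp add: c_def Lp_norm_nonneg)
    have i: "integrable ?M (\<lambda>t. norm (f t))"
    proof (rule Bochner_Integration.integrable_bound[where f = "\<lambda>t. c"])
      show "AE t in ?M. norm (norm (f t)) \<le> norm c" using le by eventually_elim simp
    qed auto
    have "(\<integral>t. norm (f t) \<partial>?M) \<le> (\<integral>t. c \<partial>?M)"
      using i le by (intro integral_mono_AE) auto
    also have "\<dots> = (b - a) * c" using ab by (simp add: measure_restrict_space)
    also have "\<dots> \<le> (b - a + 1) * c" by (intro mult_right_mono) (auto simp: c_def Lp_norm_nonneg)
    finally show ?thesis using i by (simp add: c_def)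
  next
    case False
    define q where "q = enn2real p"
    have q: "q \<ge> 1" using p False unfolding q_def by (metis enn2real_1 enn2real_mono infinity_ennreal_def top.not_eq_extremum)
    have fi: "integrable ?M (\<lambda>t. norm (f t) powr q)" using f False by (simp add: Lp_fun_def q_def)
    \<comment> \<open>Applied to \<open>norm (f t) / N\<close> below, with \<open>N\<close> the Lp norm of \<open>f\<close>, which makes the bound homogeneous in \<open>f\<close>.\<close>
    have le1: "x \<le> 1 + x powr q" if "x \<ge> 0" for x :: real
    proof (cases "x \<le> 1")
      case False
      then have "x powr 1 \<le> x powr q" using q by (intro powr_mono) auto
      with False show ?thesis by simp
    qed (simp add: add_increasing2)
    have i: "integrable ?M (\<lambda>t. norm (f t))"
    proof (rule Bochner_Integration.integrable_bound[where f = "\<lambda>t. 1 + norm (f t) powr q"])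
      show "AE t in ?M. norm (norm (f t)) \<le> norm (1 + norm (f t) powr q)"
        using le1 by (intro AE_I2) (auto simp: add_nonneg_nonneg abs_of_nonneg)
    qed (use fi in auto)
    define N where "N = Lp_norm a b p f"
    have N: "N = (\<integral>t. norm (f t) powr q \<partial>?M) powr (1/q)" "N \<ge> 0" using False by (auto simp: N_def Lp_norm_def q_def)
    have "(\<integral>t. norm (f t) \<partial>?M) \<le> (b - a + 1) * N"
    proof (cases "N = 0")
      case True
      then have "(\<integral>t. norm (f t) powr q \<partial>?M) = 0" using N by simp
      then have "AE t in ?M. norm (f t) powr q = 0" using fi by (subst (asm) integral_nonneg_eq_0_iff_AE) auto
      then have "AE t in ?M. norm (f t) = 0" by eventually_elim auto
      then have "(\<integral>t. norm (f t) \<partial>?M) = 0" using integral_nonneg_eq_0_iff_AE[OF i] by auto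
      then show ?thesis using True by simp
    next
      case False
      then have Np: "N > 0" using N by simp
      have Nq: "N powr q = (\<integral>t. norm (f t) powr q \<partial>?M)" using q by (simp add: N powr_powr)
      have le2: "norm (f t) \<le> N * (1 + (1 / N powr q) * norm (f t) powr q)" for t
      proof -
        have "norm (f t) / N \<le> 1 + (norm (f t) / N) powr q" using Np by (intro le1) auto
        also have "\<dots> = 1 + (1 / N powr q) * norm (f t) powr q" using Np by (simp add: powr_divide)
        finally show ?thesis using Np by (simp add: field_simps)
      qed
      have "(\<integral>t. norm (f t) \<partial>?M) \<le> (\<integral>t. N * (1 + (1 / N powr q) * norm (f t) powr q) \<partial>?M)"
        using fi i le2 by (intro integral_mono) auto
      also have "\<dots> = N * ((b - a) + (1 / N powr q) * (\<integral>t. norm (f t) powr q \<partial>?M))"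
        using fi ab by (simp add: measure_restrict_space)
      also have "\<dots> = (b - a + 1) * N" using Np by (simp flip: Nq)
      finally show ?thesis .
    qed
    with i show ?thesis by (simp add: N_def)
  qed
  then have i: "integrable ?M (\<lambda>t. norm (f t))" and le: "(\<integral>t. norm (f t) \<partial>?M) \<le> (b - a + 1) * Lp_norm a b p f" by auto
  show "f absolutely_integrable_on {a..b}"
    using i by (subst absolutely_integrable_measurable) (auto simp: o_def)
  show "integral {a..b} (\<lambda>t. norm (f t)) \<le> (b - a + 1) * Lp_norm a b p f"
    using le lebesgue_integral_eq_integral[OF i] by simp
qed

lemma Lp_one: "Lp_fun a b p (\<lambda>t. 1::real)"
proof -
  let ?M = "lebesgue_on {a..b}"
  have "esssup ?M (\<lambda>t. ennreal (norm (1::real))) \<le> 1" by (intro esssup_I) auto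
  then have "esssup ?M (\<lambda>t. ennreal (norm (1::real))) < \<infinity>" using le_less_trans by fastforce
  then show ?thesis by (auto simp: Lp_fun_def)
qed

text \<open>Measurability of \<open>g\<close> is obtained by way of gauge integrability, which does not see null sets.\<close>

lemma Lp_cong_AE:
  fixes f g :: "real \<Rightarrow> 'b::euclidean_space"
  assumes p: "1 \<le> p" and f: "Lp_fun a b p f" and ab: "a \<le> b"
    and eq: "AE t in lebesgue_on {a..b}. g t = f t"
  shows "Lp_fun a b p g" and "Lp_norm a b p g = Lp_norm a b p f"
proof -
  have "f integrable_on {a..b}"
    using Lp_absolutely_integrable(1)[OF p f ab] by (simp add: absolutely_integrable_on_def)
  moreover have "negligible {t \<in> {a..b}. g t \<noteq> f t}"
    using eq by (simp add: AE_lebesgue_on_iff_negligible)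
  ultimately have "g integrable_on {a..b}" by (rule integrable_spike) auto
  then have g: "g \<in> borel_measurable (lebesgue_on {a..b})" by (rule integrable_imp_measurable)
  have 1: "AE t in lebesgue_on {a..b}. norm (g t) \<le> 1 * norm (f t)" "AE t in lebesgue_on {a..b}. norm (f t) \<le> 1 * norm (g t)"
    using eq by (eventually_elim, simp)+
  show gl: "Lp_fun a b p g" using Lp_dominated(1)[OF p f g _ 1(1)] by simp
  show "Lp_norm a b p g = Lp_norm a b p f"
    using Lp_dominated(2)[OF p f g _ 1(1)] Lp_dominated(2)[OF p gl _ _ 1(2)] f by (simp add: Lp_fun_def)
qed

section \<open>Sobolev functions as jets\<close>

text \<open>\<open>Y k\<close> plays the role of the \<open>k\<close>-th derivative of \<open>Y 0\<close>. Differentiability is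
  replaced by the integral relation between consecutive entries, which is linear and insensitive to null sets.
  Entries vanish outside \<open>{a..b}\<close>, as Sobolev functions do in their definition.\<close>

definition jet :: "real \<Rightarrow> real \<Rightarrow> ennreal \<Rightarrow> nat \<Rightarrow> (nat \<Rightarrow> real \<Rightarrow> 'b::euclidean_space) \<Rightarrow> bool" where
  "jet a b p s Y \<longleftrightarrow>
     (\<forall>k\<le>s. \<forall>t. t \<notin> {a..b} \<longrightarrow> Y k t = 0) \<and>
     (\<forall>k<s. \<forall>t\<in>{a..b}. Y k t = Y k a + integral {a..t} (Y (Suc k))) \<and>
     Lp_fun a b p (Y s)"

locale interval_Lp =
  fixes a b :: real and p :: ennreal
  assumes ab: "a < b" and p: "1 \<le> p"
begin

lemma Lp_bounded:
  fixes g :: "real \<Rightarrow> 'b::euclidean_space"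
  assumes "g \<in> borel_measurable (lebesgue_on {a..b})" "C \<ge> 0" "\<And>t. t \<in> {a..b} \<Longrightarrow> norm (g t) \<le> C"
  shows "Lp_fun a b p g" "Lp_norm a b p g \<le> C * Lp_norm a b p (\<lambda>t. 1::real)"
  by (rule Lp_dominated[OF p Lp_one assms(1,2)], use assms(3) in \<open>auto intro!: AE_I2\<close>)+

lemma Lp_continuous:
  fixes g :: "real \<Rightarrow> 'b::euclidean_space"
  assumes g: "continuous_on {a..b} g"
  shows "Lp_fun a b p g"
proof -
  have "bounded (g ` {a..b})" using g by (intro compact_imp_bounded compact_continuous_image) auto
  then obtain C where C: "\<forall>x\<in>g ` {a..b}. norm x \<le> C" unfolding bounded_iff by blast
  have "norm (g t) \<le> \<bar>C\<bar>" if "t \<in> {a..b}" for t using C that by (meson abs_ge_self image_eqI order_trans)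
  then show ?thesis by (intro Lp_bounded(1)[of g "\<bar>C\<bar>"] continuous_imp_measurable_on_sets_lebesgue g) auto
qed

lemma Lp_integrable: "Lp_fun a b p f \<Longrightarrow> f absolutely_integrable_on {a..b}"
  and Lp_integrable': "Lp_fun a b p f \<Longrightarrow> f integrable_on {a..b}"
  for f :: "real \<Rightarrow> 'b::euclidean_space"
  using Lp_absolutely_integrable(1)[OF p _ less_imp_le[OF ab]] set_lebesgue_integral_eq_integral(1) by blast+

lemma Lp_bounded_linear:
  fixes f :: "real \<Rightarrow> 'b::euclidean_space" and h :: "'b \<Rightarrow> 'c::euclidean_space"
  assumes f: "Lp_fun a b p f" and h: "bounded_linear h"
  shows "Lp_fun a b p (\<lambda>t. h (f t))"
proof -
  obtain K where K: "K \<ge> 0" "\<And>x. norm (h x) \<le> norm x * K" using bounded_linear.nonneg_bounded[OF h] by blast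
  have [measurable]: "f \<in> borel_measurable (lebesgue_on {a..b})" using f by (simp add: Lp_fun_def)
  have "h \<in> borel_measurable borel" using h by (intro borel_measurable_continuous_onI linear_continuous_on)
  then have "(\<lambda>t. h (f t)) \<in> borel_measurable (lebesgue_on {a..b})" by measurable
  then show ?thesis by (rule Lp_dominated(1)[OF p f _ K(1)]) (use K(2) in \<open>auto simp: mult.commute\<close>)
qed

lemma primitive_abs_cont:
  fixes y :: "real \<Rightarrow> 'b::euclidean_space"
  assumes y: "\<And>t. t \<in> {a..b} \<Longrightarrow> y t = y a + integral {a..t} g" and g: "Lp_fun a b p g"
  shows "abs_cont_on_interval a b y"
proof (rule abs_cont_dominated[OF abs_cont_indefinite_integral abs_cont_indefinite_integral, where C = 1])
  fix u v assume "a \<le> u" "u < v" "v \<le> b"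
  then have "y v - y u = integral {a..v} g - integral {a..u} g" using y[of u] y[of v] by simp
  then show "norm (y v - y u) \<le> 1 * (norm (integral {a..v} g - integral {a..u} g) + norm (integral {a..v} g - integral {a..u} g))"
    by simp
qed (use Lp_integrable[OF g] in auto)

lemma primitive_AE_derivative:
  fixes y :: "real \<Rightarrow> 'b::euclidean_space"
  assumes y: "\<And>t. t \<in> {a..b} \<Longrightarrow> y t = y a + integral {a..t} g" and g: "Lp_fun a b p g"
  shows "AE t in lebesgue_on {a..b}. (y has_vector_derivative g t) (at t within {a..b})"
proof -
  have "{t\<in>{a..b}. \<not> (y has_vector_derivative g t) (at t within {a..b})}
      \<subseteq> {t\<in>{a..b}. \<not> ((\<lambda>x. integral {a..x} g) has_vector_derivative g t) (at t within {a..b})}"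
  proof clarify
    fix t assume t: "t \<in> {a..b}" and d: "((\<lambda>x. integral {a..x} g) has_vector_derivative g t) (at t within {a..b})"
      and n: "\<not> (y has_vector_derivative g t) (at t within {a..b})"
    have "((\<lambda>x. y a + integral {a..x} g) has_vector_derivative 0 + g t) (at t within {a..b})"
      by (rule has_vector_derivative_add[OF has_vector_derivative_const d])
    with n show False using has_vector_derivative_transform[OF t y] by auto
  qed
  with negligible_indefinite_integral_not_differentiable[OF Lp_integrable'[OF g]]
  show ?thesis unfolding AE_lebesgue_on_iff_negligible using negligible_subset by blast
qed

text \<open>Downwards from \<open>s\<close>: a primitive of an integrable function is continuous, hence bounded, hence in \<open>L_p\<close>.\<close>

lemma jet_Lp:
  assumes Y: "jet a b p s Y" and k: "k \<le> s"
  shows "Lp_fun a b p (Y k)"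
  using k
proof (induction k rule: inc_induct)
  case base then show ?case using Y by (simp add: jet_def)
next
  case (step k)
  have "\<And>t. t \<in> {a..b} \<Longrightarrow> Y k t = Y k a + integral {a..t} (Y (Suc k))"
    using Y step.hyps unfolding jet_def by blast
  from primitive_abs_cont[OF this step.IH] have "abs_cont_on_interval a b (Y k)" .
  then show ?case by (intro Lp_continuous abs_cont_imp_continuous)
qed

lemma jet_primitive: "\<lbrakk>jet a b p s Y; k < s; t \<in> {a..b}\<rbrakk> \<Longrightarrow> Y k t = Y k a + integral {a..t} (Y (Suc k))"
  unfolding jet_def by blast

lemma jet_outside: "\<lbrakk>jet a b p s Y; k \<le> s; t \<notin> {a..b}\<rbrakk> \<Longrightarrow> Y k t = 0"
  by (simp add: jet_def)

lemma jet_abs_cont: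
  assumes Y: "jet a b p s Y" and k: "k < s"
  shows "abs_cont_on_interval a b (Y k)"
  by (rule primitive_abs_cont[OF jet_primitive[OF Y k]]) (use jet_Lp[OF Y] k in auto)

lemma jet_continuous: "jet a b p s Y \<Longrightarrow> k < s \<Longrightarrow> continuous_on {a..b} (Y k)"
  by (intro abs_cont_imp_continuous jet_abs_cont)

lemma jet_integrable: "jet a b p s Y \<Longrightarrow> k \<le> s \<Longrightarrow> Y k integrable_on {a..b}"
  by (intro Lp_integrable' jet_Lp)

lemma jet_mono:
  assumes Y: "jet a b p s Y" and k: "k \<le> s"
  shows "jet a b p k Y"
  unfolding jet_def
proof (intro conjI allI impI ballI)
  show "Y i t = 0" if "i \<le> k" "t \<notin> {a..b}" for i t using jet_outside[OF Y _ that(2)] that(1) k by simp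
  show "Y i t = Y i a + integral {a..t} (Y (Suc i))" if "i < k" "t \<in> {a..b}" for i t
    by (rule jet_primitive[OF Y _ that(2)]) (use that(1) k in simp)
qed (rule jet_Lp[OF Y k])

lemma jet_shift:
  assumes Y: "jet a b p (k + s) Y"
  shows "jet a b p s (\<lambda>i. Y (k + i))"
  unfolding jet_def
proof (intro conjI allI impI ballI)
  show "Y (k + i) t = 0" if "i \<le> s" "t \<notin> {a..b}" for i t using jet_outside[OF Y _ that(2)] that(1) by simp
  show "Y (k + i) t = Y (k + i) a + integral {a..t} (Y (k + Suc i))" if "i < s" "t \<in> {a..b}" for i t
    unfolding add_Suc_right by (rule jet_primitive[OF Y _ that(2)]) (use that(1) in simp)
qed (rule jet_Lp[OF Y], simp)

lemma jet_Suc_iff: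
  "jet a b p (Suc s) Y \<longleftrightarrow> (\<forall>t. t \<notin> {a..b} \<longrightarrow> Y 0 t = 0) \<and>
     (\<forall>t\<in>{a..b}. Y 0 t = Y 0 a + integral {a..t} (Y 1)) \<and> jet a b p s (\<lambda>i. Y (Suc i))"
proof (intro iffI conjI; (elim conjE)?)
  assume Y: "jet a b p (Suc s) Y"
  show "\<forall>t. t \<notin> {a..b} \<longrightarrow> Y 0 t = 0" by (intro allI impI jet_outside[OF Y le0])
  show "\<forall>t\<in>{a..b}. Y 0 t = Y 0 a + integral {a..t} (Y 1)" unfolding One_nat_def by (intro ballI jet_primitive[OF Y zero_less_Suc])
  show "jet a b p s (\<lambda>i. Y (Suc i))" using jet_shift[of 1 s Y] Y by simp
next
  assume 0: "\<forall>t. t \<notin> {a..b} \<longrightarrow> Y 0 t = 0" and 1: "\<forall>t\<in>{a..b}. Y 0 t = Y 0 a + integral {a..t} (Y 1)"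
    and Y: "jet a b p s (\<lambda>i. Y (Suc i))"
  show "jet a b p (Suc s) Y"
    unfolding jet_def
  proof (intro conjI allI impI ballI)
    show "Y k t = 0" if "k \<le> Suc s" "t \<notin> {a..b}" for k t
      using that 0 jet_outside[OF Y, of "k - 1" t] by (cases k) auto
    show "Y k t = Y k a + integral {a..t} (Y (Suc k))" if "k < Suc s" "t \<in> {a..b}" for k t
    proof (cases k)
      case 0
      show ?thesis unfolding 0 One_nat_def[symmetric] by (rule 1[rule_format, OF that(2)])
    next
      case (Suc j)
      with that jet_primitive[OF Y, of j t] show ?thesis by blast
    qed
    show "Lp_fun a b p (Y (Suc s))" using jet_Lp[OF Y order_refl] .
  qed
qed

lemma jet_add:
  assumes Y: "jet a b p s Y" and Z: "jet a b p s Z"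
  shows "jet a b p s (\<lambda>k t. Y k t + Z k t)"
  unfolding jet_def
proof (intro conjI allI impI ballI)
  fix k t assume k: "k < s" and t: "t \<in> {a..b}"
  have "Y (Suc k) integrable_on {a..t}" "Z (Suc k) integrable_on {a..t}"
    using jet_integrable[OF Y, of "Suc k"] jet_integrable[OF Z, of "Suc k"] k t by (auto elim!: integrable_subinterval_real)
  then show "Y k t + Z k t = Y k a + Z k a + integral {a..t} (\<lambda>t. Y (Suc k) t + Z (Suc k) t)"
    using jet_primitive[OF Y k t] jet_primitive[OF Z k t] by (simp add: integral_add)
qed (use assms Lp_add(1)[OF p] in \<open>auto simp: jet_def\<close>)

lemma jet_bounded_linear:
  fixes h :: "'b::euclidean_space \<Rightarrow> 'c::euclidean_space"
  assumes Y: "jet a b p s Y" and h: "bounded_linear h"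
  shows "jet a b p s (\<lambda>k t. h (Y k t))"
  unfolding jet_def
proof (intro conjI allI impI ballI)
  interpret bounded_linear h by fact
  show "h (Y k t) = 0" if "k \<le> s" "t \<notin> {a..b}" for k t using jet_outside[OF Y that] by (simp add: zero)
  fix k t assume k: "k < s" and t: "t \<in> {a..b}"
  have "Y (Suc k) integrable_on {a..t}"
    using jet_integrable[OF Y, of "Suc k"] k t by (auto elim!: integrable_subinterval_real)
  from integral_linear[OF this h]
  show "h (Y k t) = h (Y k a) + integral {a..t} (\<lambda>t. h (Y (Suc k) t))"
    using jet_primitive[OF Y k t] by (simp add: add o_def)
next
  show "Lp_fun a b p (\<lambda>t. h (Y s t))" using Lp_bounded_linear[OF jet_Lp[OF Y] h] by simp
qed

lemma jet_zero: "jet a b p s (\<lambda>k t. 0)"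
  unfolding jet_def using Lp_continuous[of "\<lambda>t. 0"] by auto

lemma jet_sum:
  assumes "finite S" "\<And>i. i \<in> S \<Longrightarrow> jet a b p s (Y i)"
  shows "jet a b p s (\<lambda>k t. \<Sum>i\<in>S. Y i k t)"
  using assms by (induction S rule: finite_induct) (auto simp: jet_zero jet_add)

lemma ivl_deriv_eq:
  fixes f :: "real \<Rightarrow> 'b::euclidean_space"
  assumes "t \<in> {a..b}" "(f has_vector_derivative d) (at t within {a..b})"
  shows "ivl_deriv a b f t = d"
  unfolding ivl_deriv_def using vector_derivative_within_closed_interval[OF ab assms] assms(1) by simp

lemma jet_has_vector_derivative:
  assumes Y: "jet a b p s Y" and k: "Suc k < s" and t: "t \<in> {a..b}"
  shows "(Y k has_vector_derivative Y (Suc k) t) (at t within {a..b})"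
proof -
  have "((\<lambda>x. Y k a + integral {a..x} (Y (Suc k))) has_vector_derivative 0 + Y (Suc k) t) (at t within {a..b})"
    by (intro has_vector_derivative_add[OF has_vector_derivative_const] integral_has_vector_derivative jet_continuous[OF Y k] t)
  then show ?thesis
    using has_vector_derivative_transform[OF t jet_primitive[OF Y Suc_lessD[OF k]]] by auto
qed

lemma jet_nth_deriv:
  assumes Y: "jet a b p s Y" and k: "k < s"
  shows "nth_deriv a b k (Y 0) = Y k"
  using k
proof (induction k)
  case 0 then show ?case by (simp add: nth_deriv_def)
next
  case (Suc k)
  then have "nth_deriv a b (Suc k) (Y 0) = ivl_deriv a b (Y k)" by (simp add: nth_deriv_def)
  also have "\<dots> = Y (Suc k)"
  proof
    fix t show "ivl_deriv a b (Y k) t = Y (Suc k) t"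
    proof (cases "t \<in> {a..b}")
      case True then show ?thesis by (intro ivl_deriv_eq jet_has_vector_derivative[OF Y Suc.prems])
    next
      case False then show ?thesis using jet_outside[OF Y _ False, of "Suc k"] Suc.prems by (auto simp: ivl_deriv_def)
    qed
  qed
  finally show ?case .
qed

text \<open>The top entry is only integrable, so this is where Lebesgue's differentiation theorem enters; the
  lower entries are continuous and are true derivatives everywhere.\<close>

lemma jet_nth_deriv_AE:
  assumes Y: "jet a b p s Y"
  shows "AE t in lebesgue_on {a..b}. nth_deriv a b s (Y 0) t = Y s t"
proof (cases s)
  case 0 then show ?thesis by (simp add: nth_deriv_def)
next
  case (Suc k)
  have "nth_deriv a b s (Y 0) = ivl_deriv a b (Y k)"
    using jet_nth_deriv[OF Y, of k] Suc by (simp add: nth_deriv_def)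
  moreover have "AE t in lebesgue_on {a..b}. (Y k has_vector_derivative Y s t) (at t within {a..b})"
    unfolding Suc by (rule primitive_AE_derivative[OF jet_primitive[OF Y] jet_Lp[OF Y]]) (auto simp: Suc)
  then have "AE t in lebesgue_on {a..b}. ivl_deriv a b (Y k) t = Y s t"
    by (rule AE_mp) (auto intro!: AE_I2 ivl_deriv_eq)
  ultimately show ?thesis by simp
qed

lemma jet_imp_sobolev_fun:
  assumes Y: "jet a b p s Y"
  shows "sobolev_fun a b p s (Y 0)"
  unfolding sobolev_fun_def
proof (intro conjI allI impI)
  show "Y 0 t = 0" if "t \<notin> {a..b}" for t using jet_outside[OF Y _ that] by simp
  show "Lp_fun a b p (nth_deriv a b s (Y 0))"
    by (rule Lp_cong_AE(1)[OF p jet_Lp[OF Y] less_imp_le[OF ab] jet_nth_deriv_AE[OF Y]]) simp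
  assume s: "1 \<le> s"
  show "C_k_on a b (s - 1) (Y 0)"
    unfolding C_k_on_def
  proof (intro conjI allI impI ballI)
    fix j t assume j: "j < s - 1" and t: "t \<in> {a..b}"
    then have "(Y j has_vector_derivative Y (Suc j) t) (at t within {a..b})" by (intro jet_has_vector_derivative[OF Y]) auto
    then show "nth_deriv a b j (Y 0) differentiable at t within {a..b}"
      using jet_nth_deriv[OF Y, of j] j by (auto simp: differentiable_def has_vector_derivative_def)
  next
    fix j assume "j \<le> s - 1"
    then show "continuous_on {a..b} (nth_deriv a b j (Y 0))"
      using jet_continuous[OF Y, of j] jet_nth_deriv[OF Y, of j] s by auto
  qed
  have e: "nth_deriv a b (s - 1) (Y 0) = Y (s - 1)" using jet_nth_deriv[OF Y, of "s - 1"] s by simp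
  show "abs_cont_on_interval a b (nth_deriv a b (s - 1) (Y 0))"
    unfolding e using jet_abs_cont[OF Y, of "s - 1"] s by simp
  have "AE t in lebesgue_on {a..b}. (Y (s - 1) has_vector_derivative Y s t) (at t within {a..b})"
  proof -
    obtain k where k: "s = Suc k" using s by (cases s) auto
    show ?thesis unfolding k diff_Suc_1
      by (rule primitive_AE_derivative[OF jet_primitive[OF Y] jet_Lp[OF Y]]) (auto simp: k)
  qed
  then show "AE t in lebesgue_on {a..b}. nth_deriv a b (s - 1) (Y 0) differentiable at t within {a..b}"
    unfolding e by eventually_elim (auto simp: differentiable_def has_vector_derivative_def)
qed

text \<open>Below the order \<open>s - 1\<close> the derivatives exist everywhere and the classical fundamental theorem applies. At
  the order \<open>s - 1\<close> there is only absolute continuity together with an almost everywhere derivative.\<close>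

lemma sobolev_fun_imp_jet:
  fixes y :: "real \<Rightarrow> 'b::euclidean_space"
  assumes y: "sobolev_fun a b p s y"
  shows "jet a b p s (\<lambda>k. nth_deriv a b k y)"
  unfolding jet_def
proof (intro conjI allI impI ballI)
  show "nth_deriv a b k y t = 0" if "t \<notin> {a..b}" for k t
    using y that by (cases k) (auto simp: sobolev_fun_def nth_deriv_def ivl_deriv_def)
  show "Lp_fun a b p (nth_deriv a b s y)" using y by (simp add: sobolev_fun_def)
  fix k t assume k: "k < s" and t: "t \<in> {a..b}"
  have deriv: "(nth_deriv a b k y has_vector_derivative nth_deriv a b (Suc k) y x) (at x within {a..b})"
    if "nth_deriv a b k y differentiable (at x within {a..b})" "x \<in> {a..b}" for x
    using that by (simp add: nth_deriv_def ivl_deriv_def vector_derivative_works)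
  have sub: "{a..t} \<subseteq> {a..b}" using t by auto
  have "(nth_deriv a b (Suc k) y has_integral nth_deriv a b k y t - nth_deriv a b k y a) {a..t}"
  proof (cases "k < s - 1")
    case True
    show ?thesis
    proof (rule fundamental_theorem_of_calculus)
      fix x assume "x \<in> {a..t}"
      then show "(nth_deriv a b k y has_vector_derivative nth_deriv a b (Suc k) y x) (at x within {a..t})"
        using has_vector_derivative_within_subset[OF deriv sub] y True sub by (auto simp: sobolev_fun_def C_k_on_def)
    qed (use t in auto)
  next
    case False
    then have ks: "k = s - 1" "s \<ge> 1" using k by auto
    define N where "N = {x\<in>{a..b}. \<not> nth_deriv a b k y differentiable (at x within {a..b})}"
    show ?thesis
    proof (rule abs_cont_FTC)
      show "negligible N" unfolding N_def AE_lebesgue_on_iff_negligible[symmetric] using y ks by (simp add: sobolev_fun_def)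
      show "abs_cont_on_interval a t (nth_deriv a b k y)"
        by (rule abs_cont_subinterval[of a b]) (use y ks t in \<open>simp_all add: sobolev_fun_def\<close>)
      fix x assume x: "x \<in> {a..t} - N"
      then have "x \<in> {a..b}" "nth_deriv a b k y differentiable (at x within {a..b})" using sub by (auto simp: N_def)
      then show "(nth_deriv a b k y has_vector_derivative nth_deriv a b (Suc k) y x) (at x within {a..t})"
        using has_vector_derivative_within_subset[OF deriv sub] by blast
    qed (use t in auto)
  qed
  then show "nth_deriv a b k y t = nth_deriv a b k y a + integral {a..t} (nth_deriv a b (Suc k) y)"
    by (simp add: integral_unique)
qed

lemma aefun_eq_iff:
  fixes f g :: "real \<Rightarrow> 'b::zero"
  assumes "\<And>t. t \<notin> {a..b} \<Longrightarrow> f t = 0" "\<And>t. t \<notin> {a..b} \<Longrightarrow> g t = 0"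
  shows "aefun f = aefun g \<longleftrightarrow> (AE t in lebesgue_on {a..b}. f t = g t)"
proof -
  have "aefun f = aefun g \<longleftrightarrow> (AE t in lebesgue. f t = g t)" by (simp add: aefun.abs_eq_iff)
  also have "\<dots> \<longleftrightarrow> (AE t in lebesgue. t \<in> {a..b} \<longrightarrow> f t = g t)"
    by (rule arg_cong[where f = "\<lambda>P. AE t in lebesgue. P t"]) (use assms in fastforce)
  also have "\<dots> \<longleftrightarrow> (AE t in lebesgue_on {a..b}. f t = g t)"
    by (subst AE_restrict_space_iff) auto
  finally show ?thesis .
qed

lemma continuous_AE_eq:
  fixes f g :: "real \<Rightarrow> 'b::euclidean_space"
  assumes f: "continuous_on {a..b} f" and g: "continuous_on {a..b} g"
    and eq: "AE t in lebesgue_on {a..b}. f t = g t" and t: "t \<in> {a..b}"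
  shows "f t = g t"
proof -
  have c: "continuous_on {a..b} (\<lambda>t. norm (f t - g t))" by (intro continuous_intros f g)
  have "((\<lambda>t. norm (f t - g t)) has_integral 0) {a..b}"
    by (rule has_integral_spike[OF eq[unfolded AE_lebesgue_on_iff_negligible] _ has_integral_0]) auto
  then have "integral {a..b} (\<lambda>t. norm (f t - g t)) = 0" by (rule integral_unique)
  with integral_eq_0_iff[OF c ab] t show ?thesis by simp
qed

text \<open>For \<open>s > 0\<close> the bottom entries are continuous and equal almost everywhere, so they are equal, and with them all
  entries that are true derivatives. It follows that representatives of equivalence classes can be
  exchanged for arbitrary jets (\<open>sobolev_rep_of_jet\<close>, \<open>sobolev_norm_jet\<close>).\<close>

lemma jet_unique:
  assumes Y: "jet a b p s Y" and Z: "jet a b p s Z" and eq: "aefun (Y 0) = aefun (Z 0)"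
  shows "k < s \<Longrightarrow> Y k = Z k" and "AE t in lebesgue_on {a..b}. Y s t = Z s t"
proof -
  have ae: "AE t in lebesgue_on {a..b}. Y 0 t = Z 0 t"
    using aefun_eq_iff[of "Y 0" "Z 0"] jet_outside[OF Y] jet_outside[OF Z] eq by auto
  have 0: "Y 0 = Z 0" if "s > 0"
  proof
    fix t show "Y 0 t = Z 0 t"
      using continuous_AE_eq[OF jet_continuous[OF Y that] jet_continuous[OF Z that] ae, of t]
        jet_outside[OF Y, of 0 t] jet_outside[OF Z, of 0 t] by (cases "t \<in> {a..b}") auto
  qed
  show "k < s \<Longrightarrow> Y k = Z k"
    using jet_nth_deriv[OF Y, of k] jet_nth_deriv[OF Z, of k] 0 by auto
  show "AE t in lebesgue_on {a..b}. Y s t = Z s t"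
  proof (cases "s = 0")
    case True with ae show ?thesis by simp
  next
    case False
    with 0 have "Y 0 = Z 0" by simp
    with jet_nth_deriv_AE[OF Y] jet_nth_deriv_AE[OF Z] show ?thesis by auto
  qed
qed

lemma sobolev_iff_jet:
  fixes u :: "'b::euclidean_space aefun"
  shows "u \<in> sobolev a b p s \<longleftrightarrow> (\<exists>Y. jet a b p s Y \<and> aefun (Y 0) = u)"
proof
  assume "u \<in> sobolev a b p s"
  then obtain y where y: "sobolev_fun a b p s y" "u = aefun y" by (auto simp: sobolev_def)
  then show "\<exists>Y. jet a b p s Y \<and> aefun (Y 0) = u"
    using sobolev_fun_imp_jet[OF y(1)] by (intro exI[of _ "\<lambda>k. nth_deriv a b k y"]) (simp add: nth_deriv_def)
qed (auto simp: sobolev_def intro: jet_imp_sobolev_fun)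

lemma sobolev_rep_jet:
  fixes u :: "'b::euclidean_space aefun"
  assumes "u \<in> sobolev a b p s"
  shows "jet a b p s (\<lambda>k. nth_deriv a b k (sobolev_rep a b p s u))" "aefun (sobolev_rep a b p s u) = u"
proof -
  have "\<exists>y. sobolev_fun a b p s y \<and> aefun y = u" using assms by (auto simp: sobolev_def)
  then have "sobolev_fun a b p s (sobolev_rep a b p s u) \<and> aefun (sobolev_rep a b p s u) = u"
    unfolding sobolev_rep_def by (rule someI_ex)
  then show "jet a b p s (\<lambda>k. nth_deriv a b k (sobolev_rep a b p s u))" "aefun (sobolev_rep a b p s u) = u"
    by (auto intro: sobolev_fun_imp_jet)
qed

lemma sobolev_rep_of_jet:
  assumes Y: "jet a b p s Y"
  shows "k < s \<Longrightarrow> nth_deriv a b k (sobolev_rep a b p s (aefun (Y 0))) = Y k"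
    and "AE t in lebesgue_on {a..b}. nth_deriv a b s (sobolev_rep a b p s (aefun (Y 0))) t = Y s t"
proof -
  have u: "aefun (Y 0) \<in> sobolev a b p s" using Y by (auto simp: sobolev_iff_jet)
  have e: "aefun (nth_deriv a b 0 (sobolev_rep a b p s (aefun (Y 0)))) = aefun (Y 0)"
    using sobolev_rep_jet(2)[OF u] by (simp add: nth_deriv_def)
  show "k < s \<Longrightarrow> nth_deriv a b k (sobolev_rep a b p s (aefun (Y 0))) = Y k"
    using jet_unique(1)[OF sobolev_rep_jet(1)[OF u] Y e] .
  show "AE t in lebesgue_on {a..b}. nth_deriv a b s (sobolev_rep a b p s (aefun (Y 0))) t = Y s t"
    using jet_unique(2)[OF sobolev_rep_jet(1)[OF u] Y e] .
qed

lemma sobolev_norm_jet: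
  assumes Y: "jet a b p s Y"
  shows "sobolev_norm a b p s (aefun (Y 0)) = (\<Sum>k\<le>s. Lp_norm a b p (Y k))"
  unfolding sobolev_norm_def
proof (rule sum.cong[OF refl])
  fix k assume "k \<in> {..s}"
  then consider "k < s" | "k = s" by force
  then show "Lp_norm a b p (nth_deriv a b k (sobolev_rep a b p s (aefun (Y 0)))) = Lp_norm a b p (Y k)"
  proof cases
    case 1 then show ?thesis using sobolev_rep_of_jet(1)[OF Y] by simp
  next
    case 2 then show ?thesis
      using Lp_cong_AE(2)[OF p jet_Lp[OF Y order_refl] less_imp_le[OF ab] sobolev_rep_of_jet(2)[OF Y]] by simp
  qed
qed

definition sup_const :: real where "sup_const = (b - a + 1) * (1 / (b - a) + 1)"

text \<open>The one-dimensional Sobolev embedding: average \<open>norm (Y k t) \<le> norm (Y k x) + D\<close> over \<open>x\<close> in \<open>{a..b}\<close>, where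
  \<open>D\<close> is the integral of \<open>norm (Y (Suc k))\<close>.\<close>

lemma jet_sup_bound:
  assumes Y: "jet a b p s Y" and k: "k < s" and t: "t \<in> {a..b}"
  shows "norm (Y k t) \<le> sup_const * (Lp_norm a b p (Y k) + Lp_norm a b p (Y (Suc k)))"
proof -
  have i: "Y k absolutely_integrable_on {a..b}" "Y (Suc k) absolutely_integrable_on {a..b}"
    using jet_Lp[OF Y] k by (auto intro!: Lp_integrable)
  then have ni: "(\<lambda>t. norm (Y k t)) integrable_on {a..b}" "(\<lambda>t. norm (Y (Suc k) t)) integrable_on {a..b}"
    by (auto simp: absolutely_integrable_on_def)
  have si: "Y (Suc k) integrable_on {a..b}" using i(2) by (simp add: absolutely_integrable_on_def)
  define D where "D = integral {a..b} (\<lambda>t. norm (Y (Suc k) t))"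
  have osc: "norm (Y k v - Y k u) \<le> D" if "a \<le> u" "u \<le> v" "v \<le> b" for u v
  proof -
    have "Y k v - Y k u = integral {u..v} (Y (Suc k))"
      using jet_primitive[OF Y k, of u] jet_primitive[OF Y k, of v] integral_diff_subinterval[OF si that] that by simp
    also have "norm \<dots> \<le> integral {u..v} (\<lambda>t. norm (Y (Suc k) t))"
      by (rule integral_norm_bound_integral) (use that si ni in \<open>auto elim!: integrable_subinterval_real\<close>)
    also have "\<dots> \<le> D" unfolding D_def
      by (rule integral_subset_le) (use that ni in \<open>auto elim!: integrable_subinterval_real\<close>)
    finally show ?thesis .
  qed
  have "norm (Y k t) \<le> norm (Y k s') + D" if s': "s' \<in> {a..b}" for s'
  proof -
    have "norm (Y k t - Y k s') \<le> D"
      using osc[of s' t] osc[of t s'] s' t by (cases "s' \<le> t") (auto simp: norm_minus_commute)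
    then show ?thesis by norm
  qed
  then have "integral {a..b} (\<lambda>x. norm (Y k t)) \<le> integral {a..b} (\<lambda>x. norm (Y k x) + D)"
    using ni by (intro integral_le) (auto intro!: integrable_add)
  also have "\<dots> = integral {a..b} (\<lambda>x. norm (Y k x)) + (b - a) * D"
    using ni ab by (subst integral_add) auto
  finally have "(b - a) * norm (Y k t) \<le> integral {a..b} (\<lambda>x. norm (Y k x)) + (b - a) * D" using ab by simp
  then have "norm (Y k t) \<le> 1 / (b - a) * integral {a..b} (\<lambda>x. norm (Y k x)) + D" using ab by (simp add: field_simps)
  also have "\<dots> \<le> 1 / (b - a) * ((b - a + 1) * Lp_norm a b p (Y k)) + (b - a + 1) * Lp_norm a b p (Y (Suc k))"
    unfolding D_def using jet_Lp[OF Y] k ab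
    by (intro add_mono mult_left_mono Lp_absolutely_integrable(2)[OF p]) auto
  also have "\<dots> \<le> (1 / (b - a) + 1) * ((b - a + 1) * Lp_norm a b p (Y k)) + (1 / (b - a) + 1) * ((b - a + 1) * Lp_norm a b p (Y (Suc k)))"
  proof -
    have *: "x \<le> (1 / (b - a) + 1) * x" if "x \<ge> 0" for x using ab mult_right_mono[of 1 "1 / (b - a) + 1" x] that by simp
    have nn: "(b - a + 1) * L \<ge> 0" if "L \<ge> 0" for L
      using ab that by simp
    show ?thesis by (rule add_mono[OF mult_right_mono[OF _ nn] *[OF nn]]) (simp_all add: Lp_norm_nonneg)
  qed
  also have "\<dots> = sup_const * (Lp_norm a b p (Y k) + Lp_norm a b p (Y (Suc k)))"
  proof -
    have "d * (c * x) + d * (c * y) = c * d * (x + y)" for c d x y :: real by (simp add: algebra_simps)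
    then show ?thesis by (simp add: sup_const_def)
  qed
  finally show ?thesis .
qed

lemma sup_const_nonneg: "sup_const \<ge> 0" using ab by (simp add: sup_const_def)

end

section \<open>Volterra equations with integrable Lipschitz bound\<close>

text \<open>\<open>exp (K t) / 2\<close> is absolutely continuous, because \<open>exp\<close> is Lipschitz on the bounded range of \<open>K\<close>, and its
  derivative is the integrand almost everywhere.\<close>

lemma integral_exp_weight:
  fixes \<kappa> :: "real \<Rightarrow> real"
  assumes ab: "a < b" and \<kappa>: "\<kappa> absolutely_integrable_on {a..b}"
  defines "K \<equiv> \<lambda>t. 2 * integral {a..t} \<kappa>"
  assumes t: "t \<in> {a..b}"
  shows "((\<lambda>s. \<kappa> s * exp (K s)) has_integral (exp (K t) - 1) / 2) {a..t}"
proof -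
  have sub: "{a..t} \<subseteq> {a..b}" using t by auto
  have acI: "abs_cont_on_interval a b (\<lambda>t. integral {a..t} \<kappa>)" by (rule abs_cont_indefinite_integral[OF \<kappa>])
  have acK: "abs_cont_on_interval a b K" unfolding K_def
    by (rule abs_cont_dominated[OF acI acI, where C = 1]) (unfold real_norm_def right_diff_distrib[symmetric] abs_mult, simp)
  have "bounded (K ` {a..b})" by (intro compact_imp_bounded compact_continuous_image abs_cont_imp_continuous acK) auto
  then obtain M where M: "\<forall>x\<in>K ` {a..b}. norm x \<le> M" unfolding bounded_iff by blast
  have lip: "\<bar>exp y - exp x\<bar> \<le> exp M * \<bar>y - x\<bar>" if "x \<le> M" "y \<le> M" for x y :: real
  proof -
    have *: "exp y - exp x \<le> exp M * (y - x) \<and> exp x \<le> exp y" if "x \<le> y" "y \<le> M" for x y :: real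
    proof -
      have "1 - exp (x - y) \<le> y - x" using exp_ge_add_one_self[of "x - y"] by linarith
      then have "exp y * (1 - exp (x - y)) \<le> exp y * (y - x)" by (intro mult_left_mono) auto
      also have "exp y * (1 - exp (x - y)) = exp y - exp x" by (simp add: algebra_simps flip: exp_add)
      finally have "exp y - exp x \<le> exp y * (y - x)" .
      also have "\<dots> \<le> exp M * (y - x)" using that by (intro mult_right_mono) auto
      finally show ?thesis using that by simp
    qed
    show ?thesis using *[of x y] *[of y x] that by (cases "x \<le> y") (auto simp: abs_if algebra_simps)
  qed
  have acE: "abs_cont_on_interval a b (\<lambda>t. exp (K t) / 2)"
  proof (rule abs_cont_dominated[OF acK acK, where C = "exp M / 4"])
    fix u v assume "a \<le> u" "u < v" "v \<le> b"
    then have "K u \<le> M" "K v \<le> M" using M by (auto dest!: bspec[of _ _ "K _"] simp: abs_le_iff)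
    from lip[OF this] show "norm (exp (K v) / 2 - exp (K u) / 2) \<le> exp M / 4 * (norm (K v - K u) + norm (K v - K u))"
      by (simp flip: diff_divide_distrib)
  qed
  define N where "N = {t\<in>{a..b}. \<not> ((\<lambda>x. integral {a..x} \<kappa>) has_vector_derivative \<kappa> t) (at t within {a..b})}"
  have "((\<lambda>s. \<kappa> s * exp (K s)) has_integral exp (K t) / 2 - exp (K a) / 2) {a..t}"
  proof (rule abs_cont_FTC)
    show "abs_cont_on_interval a t (\<lambda>t. exp (K t) / 2)" by (rule abs_cont_subinterval[OF acE]) (use t in auto)
    show "negligible N" unfolding N_def
      by (rule negligible_indefinite_integral_not_differentiable[OF set_lebesgue_integral_eq_integral(1)[OF \<kappa>]])
    fix s assume s: "s \<in> {a..t} - N"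
    then have "((\<lambda>x. integral {a..x} \<kappa>) has_vector_derivative \<kappa> s) (at s within {a..b})" using sub by (auto simp: N_def)
    then have d: "((\<lambda>x. integral {a..x} \<kappa>) has_real_derivative \<kappa> s) (at s within {a..t})"
      using has_vector_derivative_within_subset[OF _ sub] by (simp add: has_real_derivative_iff_has_vector_derivative)
    have "((\<lambda>t. exp (K t) / 2) has_real_derivative \<kappa> s * exp (K s)) (at s within {a..t})"
      unfolding K_def by (auto intro!: derivative_eq_intros d)
    then show "((\<lambda>t. exp (K t) / 2) has_vector_derivative \<kappa> s * exp (K s)) (at s within {a..t})"
      by (simp add: has_real_derivative_iff_has_vector_derivative)
  qed (use t in auto)
  then show ?thesis by (simp add: K_def diff_divide_distrib)
qed

text \<open>The Lipschitz condition compares \<open>H u\<close> and \<open>H v\<close> at time \<open>s\<close> through the values of \<open>u\<close> and \<open>v\<close> up to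
  time \<open>s\<close>, so \<open>H\<close> may involve iterated integrals of \<open>u\<close>. This reduces an equation of order \<open>r\<close>
  to a single unknown function without passing to a first-order system.\<close>

locale volterra =
  fixes a b :: real and H :: "(real \<Rightarrow> 'b::euclidean_space) \<Rightarrow> real \<Rightarrow> 'b" and \<kappa> :: "real \<Rightarrow> real"
  assumes ab: "a < b" and \<kappa>: "\<kappa> absolutely_integrable_on {a..b}" "\<And>t. t \<in> {a..b} \<Longrightarrow> \<kappa> t \<ge> 0"
    and H_integrable: "\<And>u. continuous_on {a..b} u \<Longrightarrow> H u integrable_on {a..b}"
    and H_lipschitz: "\<And>u v s D. \<lbrakk>continuous_on {a..b} u; continuous_on {a..b} v; s \<in> {a..b};
      \<And>\<sigma>. \<sigma> \<in> {a..s} \<Longrightarrow> norm (u \<sigma> - v \<sigma>) \<le> D\<rbrakk> \<Longrightarrow> norm (H u s - H v s) \<le> \<kappa> s * D"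
begin

text \<open>Measured against \<open>exp (weight t)\<close>, integrating \<open>H u - H v\<close> halves distances (\<open>integral_contraction\<close>): the
  factor \<open>2\<close> is the source of the contraction constant \<open>1 / 2\<close>, with no restriction on the length of the interval.\<close>

definition weight :: "real \<Rightarrow> real" where "weight t = 2 * integral {a..t} \<kappa>"

lemma weight_continuous: "continuous_on {a..b} weight"
  unfolding weight_def by (intro continuous_intros abs_cont_imp_continuous abs_cont_indefinite_integral \<kappa>)

lemma \<kappa>_integrable: "\<kappa> integrable_on {a..b}"
  using \<kappa>(1) set_lebesgue_integral_eq_integral(1) by blast

lemma weight_mono: "a \<le> s \<Longrightarrow> s \<le> t \<Longrightarrow> t \<le> b \<Longrightarrow> weight s \<le> weight t"
proof -
  assume st: "a \<le> s" "s \<le> t" "t \<le> b"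
  have "integral {a..t} \<kappa> - integral {a..s} \<kappa> = integral {s..t} \<kappa>"
    by (rule integral_diff_subinterval[OF \<kappa>_integrable st])
  moreover have "integral {s..t} \<kappa> \<ge> 0"
    by (rule Henstock_Kurzweil_Integration.integral_nonneg) (use st \<kappa>(2) in \<open>auto intro: integrable_subinterval_real[OF \<kappa>_integrable]\<close>)
  ultimately show ?thesis by (simp add: weight_def)
qed

lemma integral_contraction:
  assumes u: "continuous_on {a..b} u" and v: "continuous_on {a..b} v" and d: "d \<ge> 0"
    and le: "\<And>\<sigma>. \<sigma> \<in> {a..b} \<Longrightarrow> norm (u \<sigma> - v \<sigma>) \<le> exp (weight \<sigma>) * d" and t: "t \<in> {a..b}"
  shows "norm (integral {a..t} (H u) - integral {a..t} (H v)) \<le> exp (weight t) * (d / 2)"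
proof -
  have i: "H u integrable_on {a..t}" "H v integrable_on {a..t}"
    using H_integrable[OF u] H_integrable[OF v] t by (auto elim!: integrable_subinterval_real)
  have w: "((\<lambda>s. \<kappa> s * exp (weight s) * d) has_integral (exp (weight t) - 1) / 2 * d) {a..t}"
    unfolding weight_def by (rule has_integral_mult_left[OF integral_exp_weight[OF ab \<kappa>(1) t]])
  have "integral {a..t} (H u) - integral {a..t} (H v) = integral {a..t} (\<lambda>s. H u s - H v s)"
    using i by (simp add: Henstock_Kurzweil_Integration.integral_diff)
  also have "norm \<dots> \<le> integral {a..t} (\<lambda>s. \<kappa> s * exp (weight s) * d)"
  proof (rule integral_norm_bound_integral)
    fix s assume s: "s \<in> {a..t}"
    have "norm (H u s - H v s) \<le> \<kappa> s * (exp (weight s) * d)"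
    proof (rule H_lipschitz[OF u v])
      fix \<sigma> assume \<sigma>: "\<sigma> \<in> {a..s}"
      then have "norm (u \<sigma> - v \<sigma>) \<le> exp (weight \<sigma>) * d" using s t by (intro le) auto
      also have "\<dots> \<le> exp (weight s) * d" using \<sigma> s t d by (intro mult_right_mono) (auto intro: weight_mono)
      finally show "norm (u \<sigma> - v \<sigma>) \<le> exp (weight s) * d" .
    qed (use s t in auto)
    then show "norm (H u s - H v s) \<le> \<kappa> s * exp (weight s) * d" by (simp add: mult.assoc)
  qed (use i w in \<open>auto intro!: integrable_diff\<close>)
  also have "\<dots> = (exp (weight t) - 1) / 2 * d" using w by (rule integral_unique)
  also have "\<dots> \<le> exp (weight t) * (d / 2)" using d by (simp add: algebra_simps)
  finally show ?thesis .
qed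

text \<open>The weighted distance of two solutions attains its maximum, which is at most half of itself.\<close>

lemma unique_solution:
  assumes u: "continuous_on {a..b} u" "\<And>t. t \<in> {a..b} \<Longrightarrow> u t = c + integral {a..t} (H u)"
    and v: "continuous_on {a..b} v" "\<And>t. t \<in> {a..b} \<Longrightarrow> v t = c + integral {a..t} (H v)"
    and t: "t \<in> {a..b}"
  shows "u t = v t"
proof -
  define \<rho> where "\<rho> t = exp (- weight t) * norm (u t - v t)" for t
  have "continuous_on {a..b} \<rho>" unfolding \<rho>_def by (intro continuous_intros u v weight_continuous)
  then obtain m where m: "m \<in> {a..b}" "\<And>t. t \<in> {a..b} \<Longrightarrow> \<rho> t \<le> \<rho> m"
    using continuous_attains_sup[of "{a..b}" \<rho>] ab by auto
  have eq: "norm (u t - v t) = exp (weight t) * \<rho> t" for t by (simp add: \<rho>_def exp_minus)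
  have m0: "\<rho> m \<ge> 0" by (simp add: \<rho>_def)
  have "norm (integral {a..m} (H u) - integral {a..m} (H v)) \<le> exp (weight m) * (\<rho> m / 2)"
    by (rule integral_contraction[OF u(1) v(1) m0 _ m(1)]) (simp add: eq m)
  then have "exp (weight m) * \<rho> m \<le> exp (weight m) * (\<rho> m / 2)"
    using eq[of m] u(2)[OF m(1)] v(2)[OF m(1)] by simp
  then have "\<rho> m \<le> \<rho> m / 2" by simp
  then have "\<rho> m = 0" using m0 by simp
  then have "\<rho> t \<le> 0" using m(2)[OF t] by simp
  then show ?thesis by (simp add: \<rho>_def mult_le_0_iff)
qed

text \<open>Banach's fixed point theorem for \<open>w = exp (- weight) * u\<close>, for which the weighted distance of \<open>u\<close> becomes
  the plain sup distance of bounded continuous functions.\<close>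

lemma ex_solution: "\<exists>u. continuous_on {a..b} u \<and> (\<forall>t\<in>{a..b}. u t = c + integral {a..t} (H u))"
proof -
  \<comment> \<open>Clamping to \<open>{a..b}\<close> turns functions on the interval into bounded continuous functions on the line.\<close>
  define P where "P t = max a (min b t)" for t :: real
  have P: "P t \<in> {a..b}" for t using ab by (auto simp: P_def)
  have Pid: "P t = t" if "t \<in> {a..b}" for t using that by (auto simp: P_def)
  have Pc: "continuous_on UNIV P" unfolding P_def by (intro continuous_intros)
  define U where "U w t = exp (weight t) *\<^sub>R apply_bcontfun w t" for w :: "real \<Rightarrow>\<^sub>C 'b" and t
  have Uc: "continuous_on {a..b} (U w)" for w unfolding U_def by (intro continuous_intros weight_continuous) simp
  define \<phi> where "\<phi> w t = exp (- weight t) *\<^sub>R (c + integral {a..t} (H (U w)))" for w t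
  have \<phi>c: "continuous_on {a..b} (\<phi> w)" for w
    unfolding \<phi>_def by (intro continuous_intros weight_continuous indefinite_integral_continuous_1 H_integrable Uc)
  define \<Phi> where "\<Phi> w = Bcontfun (\<lambda>t. \<phi> w (P t))" for w
  have \<Phi>: "apply_bcontfun (\<Phi> w) t = \<phi> w (P t)" for w t
  proof -
    have "bounded (\<phi> w ` {a..b})" using \<phi>c by (intro compact_imp_bounded compact_continuous_image) auto
    then obtain C where C: "\<forall>x\<in>\<phi> w ` {a..b}. norm x \<le> C" unfolding bounded_iff by blast
    have "continuous_on UNIV (\<lambda>t. \<phi> w (P t))"
      by (rule continuous_on_compose2[OF \<phi>c Pc]) (use P in auto)
    then have "(\<lambda>t. \<phi> w (P t)) \<in> bcontfun" by (rule bcontfun_normI[where b = C]) (use C P in auto)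
    then show ?thesis unfolding \<Phi>_def by (simp add: Bcontfun_inverse)
  qed
  have "\<exists>!w. \<Phi> w = w"
  proof (rule banach_fix_type[where c = "1 / 2"])
    show "\<forall>x y. dist (\<Phi> x) (\<Phi> y) \<le> 1 / 2 * dist x y"
    proof (intro allI dist_bound)
      fix x y :: "real \<Rightarrow>\<^sub>C 'b" and t
      define s where "s = P t"
      have s: "s \<in> {a..b}" using P by (simp add: s_def)
      have le: "norm (integral {a..s} (H (U x)) - integral {a..s} (H (U y))) \<le> exp (weight s) * (dist x y / 2)"
      proof (rule integral_contraction[OF Uc Uc _ _ s])
        fix \<sigma>
        have "norm (U x \<sigma> - U y \<sigma>) = exp (weight \<sigma>) * dist (apply_bcontfun x \<sigma>) (apply_bcontfun y \<sigma>)"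
          by (simp add: U_def dist_norm flip: scaleR_diff_right)
        also have "\<dots> \<le> exp (weight \<sigma>) * dist x y" by (intro mult_left_mono dist_bounded) auto
        finally show "norm (U x \<sigma> - U y \<sigma>) \<le> exp (weight \<sigma>) * dist x y" .
      qed simp
      have "dist (\<phi> x s) (\<phi> y s) = exp (- weight s) * norm (integral {a..s} (H (U x)) - integral {a..s} (H (U y)))"
        by (simp add: \<phi>_def dist_norm flip: scaleR_diff_right)
      also have "\<dots> \<le> exp (- weight s) * (exp (weight s) * (dist x y / 2))" by (intro mult_left_mono le) auto
      also have "\<dots> = 1 / 2 * dist x y" by (simp add: exp_minus)
      finally show "dist (apply_bcontfun (\<Phi> x) t) (apply_bcontfun (\<Phi> y) t) \<le> 1 / 2 * dist x y"
        by (simp add: \<Phi> s_def)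
    qed
  qed auto
  then obtain w where w: "\<Phi> w = w" by blast
  have "U w t = c + integral {a..t} (H (U w))" if t: "t \<in> {a..b}" for t
  proof -
    have "apply_bcontfun w t = \<phi> w t" using \<Phi>[of w t] w Pid[OF t] by simp
    then show ?thesis by (simp add: U_def[of w t] \<phi>_def exp_minus)
  qed
  then show ?thesis using Uc by blast
qed

end

section \<open>The initial value problem in its lowest regularity\<close>

text \<open>If \<open>u\<close> is the derivative of order \<open>r - 1\<close> of \<open>y\<close>, the \<open>i\<close>-th iterate is the derivative of order
  \<open>r - 1 - i\<close>, where \<open>c i\<close> is the initial value of the derivative of order \<open>r - 2 - i\<close>.\<close>

primrec iter_primitive :: "real \<Rightarrow> (nat \<Rightarrow> 'b::euclidean_space) \<Rightarrow> nat \<Rightarrow> (real \<Rightarrow> 'b) \<Rightarrow> real \<Rightarrow> 'b" where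
  "iter_primitive a c 0 u = u"
| "iter_primitive a c (Suc i) u = (\<lambda>t. c i + integral {a..t} (iter_primitive a c i u))"

lemma iter_primitive_continuous:
  assumes "continuous_on {a..b} u"
  shows "continuous_on {a..b} (iter_primitive a c i u)"
proof (induction i)
  case (Suc i)
  then show ?case
    by (auto intro!: continuous_intros indefinite_integral_continuous_1 integrable_continuous_real)
qed (use assms in simp)

lemma iter_primitive_lipschitz:
  fixes u v :: "real \<Rightarrow> 'b::euclidean_space"
  assumes u: "continuous_on {a..b} u" and v: "continuous_on {a..b} v" and s: "s \<in> {a..b}"
    and le: "\<And>\<sigma>. \<sigma> \<in> {a..s} \<Longrightarrow> norm (u \<sigma> - v \<sigma>) \<le> D" and t: "t \<in> {a..s}"
  shows "norm (iter_primitive a c i u t - iter_primitive a c i v t) \<le> (b - a) ^ i * D"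
  using t
proof (induction i arbitrary: t)
  case (Suc i)
  have sub: "{a..t} \<subseteq> {a..b}" using Suc.prems s by auto
  have D: "D \<ge> 0" using le[of a] s by (auto intro: order.trans[OF norm_ge_zero])
  have i: "iter_primitive a c i u integrable_on {a..t}" "iter_primitive a c i v integrable_on {a..t}"
    using iter_primitive_continuous[OF u, of c i] iter_primitive_continuous[OF v, of c i] sub
    by (auto intro!: integrable_continuous_real elim: continuous_on_subset)
  have "iter_primitive a c (Suc i) u t - iter_primitive a c (Suc i) v t
      = integral {a..t} (\<lambda>s. iter_primitive a c i u s - iter_primitive a c i v s)"
    using i by (simp add: Henstock_Kurzweil_Integration.integral_diff)
  also have "norm \<dots> \<le> integral {a..t} (\<lambda>s. (b - a) ^ i * D)"
    by (rule integral_norm_bound_integral) (use i Suc in \<open>auto intro!: integrable_diff\<close>)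
  also have "\<dots> = (t - a) * ((b - a) ^ i * D)" using Suc.prems by simp
  also have "\<dots> \<le> (b - a) * ((b - a) ^ i * D)" using D Suc.prems s by (intro mult_right_mono) auto
  finally show ?case by (simp add: mult.assoc)
qed (use le in simp)

context interval_Lp
begin

text \<open>A factor in \<open>L_p\<close> times a bounded factor, on either side.\<close>

lemma Lp_bilinear:
  fixes mul :: "'c::euclidean_space \<Rightarrow> 'd::euclidean_space \<Rightarrow> 'b::euclidean_space"
  assumes K: "bounded_bilinear mul" "K \<ge> 0" "\<And>x y. norm (mul x y) \<le> norm x * norm y * K"
    and G: "G \<ge> 0"
  shows "\<lbrakk>Lp_fun a b p f; g \<in> borel_measurable (lebesgue_on {a..b}); \<And>t. t \<in> {a..b} \<Longrightarrow> norm (g t) \<le> G\<rbrakk>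
      \<Longrightarrow> Lp_fun a b p (\<lambda>t. mul (f t) (g t)) \<and> Lp_norm a b p (\<lambda>t. mul (f t) (g t)) \<le> K * G * Lp_norm a b p f"
    and "\<lbrakk>Lp_fun a b p g'; f' \<in> borel_measurable (lebesgue_on {a..b}); \<And>t. t \<in> {a..b} \<Longrightarrow> norm (f' t) \<le> G\<rbrakk>
      \<Longrightarrow> Lp_fun a b p (\<lambda>t. mul (f' t) (g' t)) \<and> Lp_norm a b p (\<lambda>t. mul (f' t) (g' t)) \<le> K * G * Lp_norm a b p g'"
proof -
  have meas: "(\<lambda>t. mul (f t) (g t)) \<in> borel_measurable (lebesgue_on {a..b})"
    if "f \<in> borel_measurable (lebesgue_on {a..b})" "g \<in> borel_measurable (lebesgue_on {a..b})" for f g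
    by (rule borel_measurable_continuous_Pair[OF that]) (intro bounded_bilinear.continuous_on[OF K(1)] continuous_intros)
  have KG: "0 \<le> K * G" using K(2) G by simp
  { assume f: "Lp_fun a b p f" and g: "g \<in> borel_measurable (lebesgue_on {a..b})" "\<And>t. t \<in> {a..b} \<Longrightarrow> norm (g t) \<le> G"
    have fm: "f \<in> borel_measurable (lebesgue_on {a..b})" using f by (simp add: Lp_fun_def)
    have "norm (mul (f t) (g t)) \<le> K * G * norm (f t)" if "t \<in> {a..b}" for t
    proof -
      have "norm (f t) * norm (g t) * K \<le> norm (f t) * G * K" using g(2)[OF that] K(2) by (intro mult_right_mono mult_left_mono) auto
      then show ?thesis using K(3)[of "f t" "g t"] by (simp add: mult_ac)
    qed
    then show "Lp_fun a b p (\<lambda>t. mul (f t) (g t)) \<and> Lp_norm a b p (\<lambda>t. mul (f t) (g t)) \<le> K * G * Lp_norm a b p f"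
      using Lp_dominated[OF p f meas[OF fm g(1)] KG AE_I2] by (metis space_lebesgue_on) }
  { assume g: "Lp_fun a b p g'" and f: "f' \<in> borel_measurable (lebesgue_on {a..b})" "\<And>t. t \<in> {a..b} \<Longrightarrow> norm (f' t) \<le> G"
    have gm: "g' \<in> borel_measurable (lebesgue_on {a..b})" using g by (simp add: Lp_fun_def)
    have "norm (mul (f' t) (g' t)) \<le> K * G * norm (g' t)" if "t \<in> {a..b}" for t
    proof -
      have "norm (f' t) * norm (g' t) * K \<le> G * norm (g' t) * K" using f(2)[OF that] K(2) by (intro mult_right_mono) auto
      then show ?thesis using K(3)[of "f' t" "g' t"] by (simp add: mult_ac)
    qed
    then show "Lp_fun a b p (\<lambda>t. mul (f' t) (g' t)) \<and> Lp_norm a b p (\<lambda>t. mul (f' t) (g' t)) \<le> K * G * Lp_norm a b p g'"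
      using Lp_dominated[OF p g meas[OF f(1) gm] KG AE_I2] by (metis space_lebesgue_on) }
qed

lemma Lp_diff_fun:
  fixes f g :: "real \<Rightarrow> 'b::euclidean_space"
  assumes "Lp_fun a b p f" "Lp_fun a b p g"
  shows "Lp_fun a b p (\<lambda>t. f t - g t)"
  using Lp_add(1)[OF p assms(1) Lp_bounded_linear[OF assms(2) bounded_linear_minus[OF bounded_linear_ident]]] by simp

lemma Lp_sum_fun:
  fixes f :: "'i \<Rightarrow> real \<Rightarrow> 'b::euclidean_space"
  assumes "finite S" "\<And>i. i \<in> S \<Longrightarrow> Lp_fun a b p (f i)"
  shows "Lp_fun a b p (\<lambda>t. \<Sum>i\<in>S. f i t)"
  using assms
proof (induction S rule: finite_induct)
  case empty
  then show ?case by (simp add: Lp_continuous)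
next
  case (insert i S)
  then show ?case by (auto intro!: Lp_add(1)[OF p])
qed

end

locale linear_ode = interval_Lp +
  fixes mul :: "'c::euclidean_space \<Rightarrow> 'b::euclidean_space \<Rightarrow> 'b" and r :: nat and A :: "nat \<Rightarrow> real \<Rightarrow> 'c"
  assumes mul: "bounded_bilinear mul" and r: "1 \<le> r" and A: "\<And>k. k < r \<Longrightarrow> Lp_fun a b p (A k)"
begin

text \<open>The equation solved for \<open>y^(r)\<close>, in terms of \<open>u = y^(r-1)\<close>.\<close>

definition rhs :: "(nat \<Rightarrow> 'b) \<Rightarrow> (real \<Rightarrow> 'b) \<Rightarrow> (real \<Rightarrow> 'b) \<Rightarrow> real \<Rightarrow> 'b" where
  "rhs c f u t = f t - (\<Sum>j = 1..r. mul (A (r - j) t) (iter_primitive a c (j - 1) u t))"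

lemma rhs_Lp:
  assumes f: "Lp_fun a b p f" and u: "continuous_on {a..b} u"
  shows "Lp_fun a b p (rhs c f u)"
  unfolding rhs_def
proof (intro Lp_diff_fun f Lp_sum_fun)
  fix j assume j: "j \<in> {1..r}"
  let ?g = "iter_primitive a c (j - 1) u"
  obtain K where K: "K \<ge> 0" "\<And>x y. norm (mul x y) \<le> norm x * norm y * K"
    using bounded_bilinear.nonneg_bounded[OF mul] by blast
  have g: "continuous_on {a..b} ?g" by (rule iter_primitive_continuous[OF u])
  have "bounded (?g ` {a..b})" using g by (intro compact_imp_bounded compact_continuous_image) auto
  then obtain C where C: "\<forall>x\<in>?g ` {a..b}. norm x \<le> C" unfolding bounded_iff by blast
  have "norm (?g t) \<le> \<bar>C\<bar>" if "t \<in> {a..b}" for t using C that by (meson abs_ge_self image_eqI order_trans)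
  then show "Lp_fun a b p (\<lambda>t. mul (A (r - j) t) (?g t))"
    using Lp_bilinear(1)[OF mul K, of "\<bar>C\<bar>" "A (r - j)" ?g] A[of "r - j"] j r
      continuous_imp_measurable_on_sets_lebesgue[OF g] by auto
qed simp

lemma volterra_rhs:
  assumes f: "Lp_fun a b p f"
  obtains \<kappa> where "volterra a b (rhs c f) \<kappa>"
proof -
  obtain K where K: "K \<ge> 0" "\<And>x y. norm (mul x y) \<le> norm x * norm y * K"
    using bounded_bilinear.nonneg_bounded[OF mul] by blast
  define \<kappa> where "\<kappa> t = (\<Sum>j = 1..r. norm (A (r - j) t) * ((b - a) ^ (j - 1) * K))" for t
  have "volterra a b (rhs c f) \<kappa>"
  proof (rule volterra.intro)
    show "\<kappa> absolutely_integrable_on {a..b}"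
      unfolding \<kappa>_def
    proof (intro absolutely_integrable_sum)
      fix j assume "j \<in> {1..r}"
      then have "A (r - j) absolutely_integrable_on {a..b}" by (intro Lp_integrable A) (use r in auto)
      then have "(\<lambda>t. norm (A (r - j) t)) absolutely_integrable_on {a..b}" by (rule absolutely_integrable_norm[unfolded o_def])
      then show "(\<lambda>t. norm (A (r - j) t) * ((b - a) ^ (j - 1) * K)) absolutely_integrable_on {a..b}"
        by (rule absolutely_integrable_linear[OF _ bounded_linear_mult_left, unfolded o_def])
    qed simp
    show "\<kappa> t \<ge> 0" for t unfolding \<kappa>_def using ab K by (intro sum_nonneg mult_nonneg_nonneg) auto
    show "rhs c f u integrable_on {a..b}" if "continuous_on {a..b} u" for u
      by (intro Lp_integrable' rhs_Lp f that)
    fix u v :: "real \<Rightarrow> 'b" and s D assume uv: "continuous_on {a..b} u" "continuous_on {a..b} v" and s: "s \<in> {a..b}"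
      and D: "\<And>\<sigma>. \<sigma> \<in> {a..s} \<Longrightarrow> norm (u \<sigma> - v \<sigma>) \<le> D"
    let ?T = "iter_primitive a c"
    have "rhs c f u s - rhs c f v s = (\<Sum>j = 1..r. mul (A (r - j) s) (?T (j - 1) v s - ?T (j - 1) u s))"
      by (simp add: rhs_def bounded_bilinear.diff_right[OF mul] sum_subtractf)
    also have "norm \<dots> \<le> (\<Sum>j = 1..r. norm (A (r - j) s) * ((b - a) ^ (j - 1) * K) * D)"
    proof (rule sum_norm_le)
      fix j
      have le: "norm (?T (j - 1) v s - ?T (j - 1) u s) \<le> (b - a) ^ (j - 1) * D"
        using iter_primitive_lipschitz[OF uv s D, of s c "j - 1"] s by (simp add: norm_minus_commute)
      have "norm (mul (A (r - j) s) (?T (j - 1) v s - ?T (j - 1) u s))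
          \<le> norm (A (r - j) s) * norm (?T (j - 1) v s - ?T (j - 1) u s) * K" by (rule K)
      also have "\<dots> \<le> norm (A (r - j) s) * ((b - a) ^ (j - 1) * D) * K"
        by (intro mult_right_mono mult_left_mono le K) auto
      finally show "norm (mul (A (r - j) s) (?T (j - 1) v s - ?T (j - 1) u s)) \<le> norm (A (r - j) s) * ((b - a) ^ (j - 1) * K) * D"
        by (simp add: mult_ac)
    qed
    finally show "norm (rhs c f u s - rhs c f v s) \<le> \<kappa> s * D" by (simp add: \<kappa>_def sum_distrib_right)
  qed (rule ab)
  then show ?thesis by (rule that)
qed

text \<open>The solution \<open>u\<close> of the Volterra equation is the entry of order \<open>r - 1\<close>; the others are the iterated primitives of
  \<open>u\<close> below it and \<open>rhs c f u\<close> above it.\<close>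

lemma ex_jet_solution:
  assumes f: "Lp_fun a b p f"
  obtains Y where "jet a b p r Y" "\<And>k. k < r \<Longrightarrow> Y k a = \<eta> k"
    "\<And>t. t \<in> {a..b} \<Longrightarrow> Y r t + (\<Sum>j = 1..r. mul (A (r - j) t) (Y (r - j) t)) = f t"
proof -
  define c where "c i = \<eta> (r - 2 - i)" for i
  obtain \<kappa> where "volterra a b (rhs c f) \<kappa>" using volterra_rhs[OF f] by blast
  then obtain u where u: "continuous_on {a..b} u" "\<And>t. t \<in> {a..b} \<Longrightarrow> u t = \<eta> (r - 1) + integral {a..t} (rhs c f u)"
    using volterra.ex_solution by blast
  let ?T = "iter_primitive a c"
  define Y where "Y k t = (if t \<in> {a..b} then if k < r then ?T (r - 1 - k) u t else rhs c f u t else 0)" for k t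
  have prim: "Y k t = \<eta> k + integral {a..t} (Y (Suc k))" if k: "k < r" and t: "t \<in> {a..b}" for k t
  proof (cases "Suc k < r")
    case True
    then have e: "r - 1 - k = Suc (r - 1 - Suc k)" "r - 2 - (r - 1 - Suc k) = k" by auto
    have "integral {a..t} (Y (Suc k)) = integral {a..t} (?T (r - 1 - Suc k) u)"
      by (rule integral_cong) (use t True in \<open>auto simp: Y_def\<close>)
    moreover have "Y k t = ?T (Suc (r - 1 - Suc k)) u t" using t k e(1) by (simp add: Y_def)
    moreover have "c (r - 1 - Suc k) = \<eta> k" unfolding c_def e(2) ..
    ultimately show ?thesis by simp
  next
    case False
    with k have kr: "k = r - 1" by simp
    have "integral {a..t} (Y (Suc k)) = integral {a..t} (rhs c f u)"
      by (rule integral_cong) (use t False in \<open>auto simp: Y_def\<close>)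
    moreover have "Y k t = u t" using t k kr by (simp add: Y_def)
    ultimately show ?thesis using u(2)[OF t] kr by simp
  qed
  have Ya: "Y k a = \<eta> k" if "k < r" for k using prim[OF that, of a] ab by simp
  have "Lp_fun a b p (Y r)"
    by (rule Lp_cong_AE(1)[OF p rhs_Lp[OF f u(1), of c] less_imp_le[OF ab]]) (auto simp: Y_def intro!: AE_I2)
  then have "jet a b p r Y" using prim Ya unfolding jet_def by (auto simp: Y_def)
  moreover have "Y r t + (\<Sum>j = 1..r. mul (A (r - j) t) (Y (r - j) t)) = f t" if t: "t \<in> {a..b}" for t
  proof -
    have "(\<Sum>j = 1..r. mul (A (r - j) t) (Y (r - j) t)) = (\<Sum>j = 1..r. mul (A (r - j) t) (?T (j - 1) u t))"
      by (rule sum.cong) (use t in \<open>auto simp: Y_def\<close>)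
    then show ?thesis using t by (simp add: Y_def[of r] rhs_def)
  qed
  ultimately show ?thesis using Ya that by blast
qed

text \<open>The entry of order \<open>r - 1\<close> solves the same Volterra equation as the zero function; the entry of order \<open>0\<close> is
  an iterated primitive of it.\<close>

lemma jet_solution_zero:
  assumes Y: "jet a b p r Y" and 0: "\<And>k. k < r \<Longrightarrow> Y k a = 0"
    and eq: "AE t in lebesgue_on {a..b}. Y r t + (\<Sum>j = 1..r. mul (A (r - j) t) (Y (r - j) t)) = 0"
  shows "Y 0 = (\<lambda>t. 0)"
proof -
  define c where "c = (\<lambda>i::nat. 0 :: 'b)"
  define f where "f = (\<lambda>t::real. 0 :: 'b)"
  let ?T = "iter_primitive a c"
  have f: "Lp_fun a b p f" unfolding f_def by (rule Lp_continuous) simp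
  obtain \<kappa> where V: "volterra a b (rhs c f) \<kappa>" using volterra_rhs[OF f] by blast
  define u where "u = Y (r - 1)"
  have uc: "continuous_on {a..b} u" unfolding u_def using jet_continuous[OF Y] r by simp
  have T: "?T i u t = Y (r - 1 - i) t" if "i < r" "t \<in> {a..b}" for i t
    using that
  proof (induction i arbitrary: t)
    case (Suc i)
    then have e: "r - 1 - i = Suc (r - 1 - Suc i)" by simp
    have "integral {a..t} (?T i u) = integral {a..t} (Y (r - 1 - i))"
      by (rule integral_cong) (use Suc in auto)
    then show ?case using jet_primitive[OF Y, of "r - 1 - Suc i" t] Suc.prems 0[of "r - 1 - Suc i"] e by (simp add: c_def)
  qed (simp add: u_def)
  have uI: "u t = 0 + integral {a..t} (rhs c f u)" if t: "t \<in> {a..b}" for t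
  proof -
    have "integral {a..t} (rhs c f u) = integral {a..t} (Y r)"
    proof (rule integral_spike)
      show "negligible {t\<in>{a..b}. \<not> (Y r t + (\<Sum>j = 1..r. mul (A (r - j) t) (Y (r - j) t)) = 0)}"
        using eq by (simp only: AE_lebesgue_on_iff_negligible)
      fix x assume x: "x \<in> {a..t} - {t\<in>{a..b}. \<not> (Y r t + (\<Sum>j = 1..r. mul (A (r - j) t) (Y (r - j) t)) = 0)}"
      then have xab: "x \<in> {a..b}" and "Y r x + (\<Sum>j = 1..r. mul (A (r - j) x) (Y (r - j) x)) = 0" using t by auto
      moreover have "(\<Sum>j = 1..r. mul (A (r - j) x) (?T (j - 1) u x)) = (\<Sum>j = 1..r. mul (A (r - j) x) (Y (r - j) x))"
        by (rule sum.cong) (use T xab in auto)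
      ultimately show "Y r x = rhs c f u x" by (simp add: rhs_def f_def eq_neg_iff_add_eq_0)
    qed
    then show ?thesis using jet_primitive[OF Y, of "r - 1" t] 0[of "r - 1"] r t by (simp add: u_def)
  qed
  have T0: "?T i (\<lambda>t. 0) = (\<lambda>t. 0)" for i by (induction i) (auto simp: c_def)
  have r0: "rhs c f (\<lambda>t. 0) = (\<lambda>t. 0)" by (simp add: rhs_def f_def T0 bounded_bilinear.zero_right[OF mul] fun_eq_iff)
  have u0: "u t = 0" if "t \<in> {a..b}" for t
    by (rule volterra.unique_solution[OF V uc uI _ _ that, where v = "\<lambda>t. 0"]) (auto simp: r0)
  show ?thesis
  proof
    fix t show "Y 0 t = 0"
    proof (cases "t \<in> {a..b}")
      case True
      have "norm (?T (r - 1) u t - ?T (r - 1) (\<lambda>t. 0) t) \<le> (b - a) ^ (r - 1) * 0"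
        by (rule iter_primitive_lipschitz[OF uc _ True]) (use u0 True in auto)
      then show ?thesis using T[of "r - 1" t] r True by (simp add: T0)
    next
      case False then show ?thesis using jet_outside[OF Y] by simp
    qed
  qed
qed

end

section \<open>Products, boundedness and regularity\<close>

context interval_Lp
begin

definition jnorm :: "nat \<Rightarrow> (nat \<Rightarrow> real \<Rightarrow> 'b::euclidean_space) \<Rightarrow> real" where
  "jnorm s Y = (\<Sum>k\<le>s. Lp_norm a b p (Y k))"

lemma jnorm_nonneg: "jnorm s Y \<ge> 0"
  by (simp add: jnorm_def sum_nonneg Lp_norm_nonneg)

lemma jnorm_mono: "k \<le> s \<Longrightarrow> jnorm k Y \<le> jnorm s Y"
  unfolding jnorm_def by (intro sum_mono2) (auto simp: Lp_norm_nonneg)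

lemma Lp_norm_le_jnorm: "k \<le> s \<Longrightarrow> Lp_norm a b p (Y k) \<le> jnorm s Y"
  unfolding jnorm_def by (rule member_le_sum) (auto simp: Lp_norm_nonneg)

lemma jnorm_Suc: "jnorm (Suc s) Y = Lp_norm a b p (Y 0) + jnorm s (\<lambda>i. Y (Suc i))"
  unfolding jnorm_def by (rule sum.atMost_Suc_shift)

lemma jnorm_shift: "jnorm s (\<lambda>i. Y (k + i)) \<le> jnorm (k + s) Y"
proof -
  have "jnorm s (\<lambda>i. Y (k + i)) = (\<Sum>j\<in>(+) k ` {..s}. Lp_norm a b p (Y j))"
    unfolding jnorm_def by (subst sum.reindex) (auto simp: inj_on_def)
  also have "\<dots> \<le> jnorm (k + s) Y"
    unfolding jnorm_def by (intro sum_mono2) (auto simp: Lp_norm_nonneg)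
  finally show ?thesis .
qed

lemma jnorm_add:
  assumes Y: "jet a b p s Y" and Z: "jet a b p s Z"
  shows "jnorm s (\<lambda>k t. Y k t + Z k t) \<le> 4 * (jnorm s Y + jnorm s Z)"
proof -
  have "jnorm s (\<lambda>k t. Y k t + Z k t) \<le> (\<Sum>k\<le>s. 4 * (Lp_norm a b p (Y k) + Lp_norm a b p (Z k)))"
    unfolding jnorm_def by (intro sum_mono Lp_add(2)[OF p] jet_Lp[OF Y] jet_Lp[OF Z]) auto
  then show ?thesis by (simp add: jnorm_def sum.distrib sum_distrib_left)
qed

lemma jet_Cons:
  assumes "\<And>t. t \<notin> {a..b} \<Longrightarrow> y t = 0" "\<And>t. t \<in> {a..b} \<Longrightarrow> y t = y a + integral {a..t} (Z 0)" "jet a b p s Z"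
  shows "jet a b p (Suc s) (case_nat y Z)"
proof -
  have "case_nat y Z 0 = y" "case_nat y Z 1 = Z 0" "(\<lambda>i. case_nat y Z (Suc i)) = Z" by auto
  with assms show ?thesis unfolding jet_Suc_iff by metis
qed

text \<open>If the top derivative \<open>Y r\<close> has itself \<open>s\<close> derivatives, the two jets can be spliced.\<close>

lemma jet_append:
  assumes Y: "jet a b p r Y" and R: "jet a b p s R" and eq: "R 0 = Y r"
  shows "jet a b p (s + r) (\<lambda>k. if k < r then Y k else R (k - r))" (is "jet a b p (s + r) ?Y")
  unfolding jet_def
proof (intro conjI allI impI ballI)
  show "?Y k t = 0" if "k \<le> s + r" "t \<notin> {a..b}" for k t
    using jet_outside[OF Y _ that(2), of k] jet_outside[OF R _ that(2), of "k - r"] that(1) by auto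
  show "?Y k t = ?Y k a + integral {a..t} (?Y (Suc k))" if k: "k < s + r" and t: "t \<in> {a..b}" for k t
  proof -
    consider "Suc k < r" | "Suc k = r" | "r \<le> k" by linarith
    then show ?thesis
    proof cases
      case 1
      then have e: "?Y k = Y k" "?Y (Suc k) = Y (Suc k)" and kr: "k < r" by auto
      show ?thesis unfolding e by (rule jet_primitive[OF Y kr t])
    next
      case 2
      then have e: "?Y k = Y k" "?Y (Suc k) = Y (Suc k)" and kr: "k < r" using eq by auto
      show ?thesis unfolding e by (rule jet_primitive[OF Y kr t])
    next
      case 3
      then have e: "?Y k = R (k - r)" "?Y (Suc k) = R (Suc (k - r))" and kr: "k - r < s" using k by (auto simp: Suc_diff_le)
      show ?thesis unfolding e by (rule jet_primitive[OF R kr t])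
    qed
  qed
  show "Lp_fun a b p (?Y (s + r))" using jet_Lp[OF R, of s] by simp
qed

text \<open>Sobolev functions of positive order form an algebra. By integration by parts the derivative of \<open>A g\<close> is \<open>A' g + A g'\<close>, a sum of two
  products of one order less, so the Leibniz formula is never written out. The constant is
  uniform in \<open>g\<close>. The induction starts at order \<open>1\<close>: there \<open>A'\<close> and \<open>g'\<close> are merely in \<open>L_p\<close>, but each is multiplied by a
  continuous factor.\<close>

lemma product_jet:
  fixes mul :: "'c::euclidean_space \<Rightarrow> 'd::euclidean_space \<Rightarrow> 'b::euclidean_space"
  assumes mul: "bounded_bilinear mul"
  shows "jet a b p (Suc N) A \<Longrightarrow> \<exists>C\<ge>0. \<forall>g. jet a b p (Suc N) g \<longrightarrow>
    (\<exists>Z. jet a b p (Suc N) Z \<and> Z 0 = (\<lambda>t. mul (A 0 t) (g 0 t)) \<and> jnorm (Suc N) Z \<le> C * jnorm (Suc N) g)"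
proof (induction N arbitrary: A)
  interpret bounded_bilinear mul by fact
  obtain K where K: "K \<ge> 0" "\<And>x y. norm (mul x y) \<le> norm x * norm y * K" using nonneg_bounded by blast
  note Lpb = Lp_bilinear[OF mul K]
  have deriv: "(\<lambda>s. mul (A 1 s) (g 0 s) + mul (A 0 s) (g 1 s)) integrable_on {a..t} \<and>
      mul (A 0 t) (g 0 t) = mul (A 0 a) (g 0 a) + integral {a..t} (\<lambda>s. mul (A 1 s) (g 0 s) + mul (A 0 s) (g 1 s))"
    if "jet a b p (Suc N) A" "jet a b p (Suc N) g" "t \<in> {a..b}" for N A g t
  proof -
    have "((\<lambda>s. mul (A (Suc 0) s) (g 0 s) + mul (A 0 s) (g (Suc 0) s)) has_integral (mul (A 0 t) (g 0 t) - mul (A 0 a) (g 0 a))) {a..t}"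
    proof (rule bilinear_by_parts[OF mul less_imp_le[OF ab] _ _ _ _ that(3)])
      show "A (Suc 0) absolutely_integrable_on {a..b}" by (rule Lp_integrable[OF jet_Lp[OF that(1)]]) simp
      show "g (Suc 0) absolutely_integrable_on {a..b}" by (rule Lp_integrable[OF jet_Lp[OF that(2)]]) simp
      show "A 0 t = A 0 a + integral {a..t} (A (Suc 0))" if "t \<in> {a..b}" for t
        by (rule jet_primitive[OF \<open>jet a b p (Suc N) A\<close> zero_less_Suc that])
      show "g 0 t = g 0 a + integral {a..t} (g (Suc 0))" if "t \<in> {a..b}" for t
        by (rule jet_primitive[OF \<open>jet a b p (Suc N) g\<close> zero_less_Suc that])
    qed
    from has_integral_integrable[OF this] integral_unique[OF this] show ?thesis by simp
  qed
  have zeroth: "Lp_norm a b p (\<lambda>t. mul (A 0 t) (g 0 t)) \<le> K * sup_const * Lp_norm a b p (A 0) * jnorm (Suc N) g \<and>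
     (\<forall>t\<in>{a..b}. norm (g 0 t) \<le> sup_const * jnorm (Suc N) g)"
    if A: "jet a b p (Suc N) A" and g: "jet a b p (Suc N) g" for N A g
  proof -
    have "Lp_norm a b p (g 0) + Lp_norm a b p (g (Suc 0)) \<le> jnorm (Suc N) g"
      unfolding jnorm_Suc using Lp_norm_le_jnorm[of 0 N "\<lambda>i. g (Suc i)"] by simp
    then have sb: "norm (g 0 t) \<le> sup_const * jnorm (Suc N) g" if "t \<in> {a..b}" for t
      using order.trans[OF jet_sup_bound[OF g zero_less_Suc that] mult_left_mono[OF _ sup_const_nonneg]] by blast
    have "Lp_norm a b p (\<lambda>t. mul (A 0 t) (g 0 t)) \<le> K * (sup_const * jnorm (Suc N) g) * Lp_norm a b p (A 0)"
      using Lpb(1)[OF _ jet_Lp[OF A] _ sb] jet_Lp[OF g, of 0] sup_const_nonneg jnorm_nonneg[of "Suc N" g]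
      by (auto simp: Lp_fun_def)
    with sb show ?thesis by (simp add: mult_ac)
  qed
  { case 0
    note A = 0
    obtain G where G: "G \<ge> 0" "\<And>t. t \<in> {a..b} \<Longrightarrow> norm (A 0 t) \<le> G"
      using jet_sup_bound[OF A] Lp_norm_nonneg sup_const_nonneg
      by (metis add_nonneg_nonneg mult_nonneg_nonneg zero_less_Suc)
    define C where "C = K * sup_const * Lp_norm a b p (A 0) + 4 * (K * sup_const * Lp_norm a b p (A 1) + K * G)"
    have "C \<ge> 0" unfolding C_def using K G sup_const_nonneg by (intro add_nonneg_nonneg mult_nonneg_nonneg Lp_norm_nonneg) auto
    moreover have "\<exists>Z. jet a b p (Suc 0) Z \<and> Z 0 = (\<lambda>t. mul (A 0 t) (g 0 t)) \<and> jnorm (Suc 0) Z \<le> C * jnorm (Suc 0) g"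
      if g: "jet a b p (Suc 0) g" for g
    proof -
      define Z where "Z = (\<lambda>i::nat. \<lambda>t. mul (A 1 t) (g 0 t) + mul (A 0 t) (g 1 t))"
      have m: "g 0 \<in> borel_measurable (lebesgue_on {a..b})" "A 0 \<in> borel_measurable (lebesgue_on {a..b})"
        using jet_Lp[OF A, of 0] jet_Lp[OF g, of 0] by (auto simp: Lp_fun_def)
      note z = zeroth[OF A g]
      have L1: "Lp_fun a b p (\<lambda>t. mul (A 1 t) (g 0 t))" "Lp_norm a b p (\<lambda>t. mul (A 1 t) (g 0 t)) \<le> K * (sup_const * jnorm (Suc 0) g) * Lp_norm a b p (A 1)"
        using Lpb(1)[OF _ jet_Lp[OF A, of 1] m(1), of "sup_const * jnorm (Suc 0) g"] z sup_const_nonneg jnorm_nonneg[of "Suc 0" g] by auto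
      have L2: "Lp_fun a b p (\<lambda>t. mul (A 0 t) (g 1 t))" "Lp_norm a b p (\<lambda>t. mul (A 0 t) (g 1 t)) \<le> K * G * Lp_norm a b p (g 1)"
        using Lpb(2)[OF G(1) jet_Lp[OF g, of 1] m(2) G(2)] by auto
      have Lz: "Lp_fun a b p (Z 0)" unfolding Z_def by (rule Lp_add(1)[OF p L1(1) L2(1)])
      have "jet a b p 0 Z"
        unfolding jet_def using Lz jet_outside[OF A] jet_outside[OF g] by (auto simp: Z_def zero_left zero_right)
      then have "jet a b p (Suc 0) (case_nat (\<lambda>t. mul (A 0 t) (g 0 t)) Z)"
      proof (rule jet_Cons[rotated 2])
        show "mul (A 0 t) (g 0 t) = 0" if "t \<notin> {a..b}" for t using jet_outside[OF A le0 that] by (simp add: zero_left)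
        show "mul (A 0 t) (g 0 t) = mul (A 0 a) (g 0 a) + integral {a..t} (Z 0)" if "t \<in> {a..b}" for t
          unfolding Z_def using deriv[OF A g that] by blast
      qed
      moreover have "jnorm (Suc 0) (case_nat (\<lambda>t. mul (A 0 t) (g 0 t)) Z) \<le> C * jnorm (Suc 0) g"
      proof -
        have "Lp_norm a b p (Z 0) \<le> 4 * (K * (sup_const * jnorm (Suc 0) g) * Lp_norm a b p (A 1) + K * G * Lp_norm a b p (g 1))"
          unfolding Z_def using Lp_add(2)[OF p L1(1) L2(1)] L1(2) L2(2) by simp
        also have "\<dots> \<le> 4 * (K * (sup_const * jnorm (Suc 0) g) * Lp_norm a b p (A 1) + K * G * jnorm (Suc 0) g)"
          using Lp_norm_le_jnorm[of 1 "Suc 0" g] K G by (intro mult_left_mono add_left_mono) auto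
        finally have "Lp_norm a b p (Z 0) \<le> 4 * (K * (sup_const * jnorm (Suc 0) g) * Lp_norm a b p (A 1) + K * G * jnorm (Suc 0) g)" .
        then have "jnorm (Suc 0) (case_nat (\<lambda>t. mul (A 0 t) (g 0 t)) Z) \<le> K * sup_const * Lp_norm a b p (A 0) * jnorm (Suc 0) g
           + 4 * (K * (sup_const * jnorm (Suc 0) g) * Lp_norm a b p (A 1) + K * G * jnorm (Suc 0) g)"
          using z by (simp add: jnorm_def)
        also have "\<dots> = C * jnorm (Suc 0) g" by (simp add: C_def algebra_simps)
        finally show ?thesis .
      qed
      ultimately show ?thesis by (intro exI[of _ "case_nat (\<lambda>t. mul (A 0 t) (g 0 t)) Z"]) simp
    qed
    ultimately show ?case by blast
  next
    case (Suc N)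
    note A = Suc.prems
    have A1: "jet a b p (Suc N) (\<lambda>i. A (Suc i))" using jet_shift[of 1 "Suc N" A] A by simp
    have A0: "jet a b p (Suc N) A" using jet_mono[OF A] by simp
    obtain C1 where C1: "C1 \<ge> 0" "\<And>g. jet a b p (Suc N) g \<Longrightarrow>
      (\<exists>Z. jet a b p (Suc N) Z \<and> Z 0 = (\<lambda>t. mul (A (Suc 0) t) (g 0 t)) \<and> jnorm (Suc N) Z \<le> C1 * jnorm (Suc N) g)"
      using Suc.IH[OF A1] by blast
    obtain C2 where C2: "C2 \<ge> 0" "\<And>g. jet a b p (Suc N) g \<Longrightarrow>
      (\<exists>Z. jet a b p (Suc N) Z \<and> Z 0 = (\<lambda>t. mul (A 0 t) (g 0 t)) \<and> jnorm (Suc N) Z \<le> C2 * jnorm (Suc N) g)"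
      using Suc.IH[OF A0] by blast
    define C where "C = K * sup_const * Lp_norm a b p (A 0) + 4 * (C1 + C2)"
    have "C \<ge> 0" unfolding C_def using K C1 C2 sup_const_nonneg by (intro add_nonneg_nonneg mult_nonneg_nonneg Lp_norm_nonneg) auto
    moreover have "\<exists>Z. jet a b p (Suc (Suc N)) Z \<and> Z 0 = (\<lambda>t. mul (A 0 t) (g 0 t)) \<and> jnorm (Suc (Suc N)) Z \<le> C * jnorm (Suc (Suc N)) g"
      if g: "jet a b p (Suc (Suc N)) g" for g
    proof -
      have g1: "jet a b p (Suc N) (\<lambda>i. g (Suc i))" using jet_shift[of 1 "Suc N" g] g by simp
      have g0: "jet a b p (Suc N) g" using jet_mono[OF g] by simp
      obtain Z1 where Z1: "jet a b p (Suc N) Z1" "Z1 0 = (\<lambda>t. mul (A 1 t) (g 0 t))" "jnorm (Suc N) Z1 \<le> C1 * jnorm (Suc N) g"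
        using C1(2)[OF g0] by auto
      obtain Z2 where Z2: "jet a b p (Suc N) Z2" "Z2 0 = (\<lambda>t. mul (A 0 t) (g 1 t))" "jnorm (Suc N) Z2 \<le> C2 * jnorm (Suc N) (\<lambda>i. g (Suc i))"
        using C2(2)[OF g1] by auto
      define Z where "Z k t = Z1 k t + Z2 k t" for k t
      have "jet a b p (Suc N) Z" unfolding Z_def by (rule jet_add[OF Z1(1) Z2(1)])
      then have "jet a b p (Suc (Suc N)) (case_nat (\<lambda>t. mul (A 0 t) (g 0 t)) Z)"
      proof (rule jet_Cons[rotated 2])
        show "mul (A 0 t) (g 0 t) = 0" if "t \<notin> {a..b}" for t using jet_outside[OF A le0 that] by (simp add: zero_left)
        have Z0: "Z 0 = (\<lambda>t. mul (A 1 t) (g 0 t) + mul (A 0 t) (g 1 t))" by (simp add: Z_def fun_eq_iff Z1(2) Z2(2))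
        show "mul (A 0 t) (g 0 t) = mul (A 0 a) (g 0 a) + integral {a..t} (Z 0)" if "t \<in> {a..b}" for t
          unfolding Z0 using deriv[OF A g that] by blast
      qed
      moreover have "jnorm (Suc (Suc N)) (case_nat (\<lambda>t. mul (A 0 t) (g 0 t)) Z) \<le> C * jnorm (Suc (Suc N)) g"
      proof -
        have "jnorm (Suc N) Z1 \<le> C1 * jnorm (Suc (Suc N)) g"
          using order.trans[OF Z1(3) mult_left_mono[OF jnorm_mono C1(1)]] by simp
        moreover have "jnorm (Suc N) Z2 \<le> C2 * jnorm (Suc (Suc N)) g"
          using order.trans[OF Z2(3) mult_left_mono[OF _ C2(1)]] jnorm_shift[of "Suc N" g 1] by simp
        ultimately have "jnorm (Suc N) Z \<le> 4 * (C1 * jnorm (Suc (Suc N)) g + C2 * jnorm (Suc (Suc N)) g)"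
          using jnorm_add[OF Z1(1) Z2(1)] unfolding Z_def by simp
        with zeroth[OF A g] show ?thesis by (subst jnorm_Suc) (simp add: C_def algebra_simps)
      qed
      ultimately show ?thesis by (intro exI[of _ "case_nat (\<lambda>t. mul (A 0 t) (g 0 t)) Z"]) simp
    qed
    ultimately show ?case by blast }
qed

text \<open>For \<open>n = 0\<close> the coefficient is only in \<open>L_p\<close>, and \<open>g\<close> has to be bounded; one more derivative
  of \<open>g\<close> provides this. The derivatives of order less than \<open>r\<close> of a function in \<open>W_p^(n+r)\<close> have it to spare.\<close>

lemma product_jet_loss:
  fixes mul :: "'c::euclidean_space \<Rightarrow> 'd::euclidean_space \<Rightarrow> 'b::euclidean_space"
  assumes mul: "bounded_bilinear mul" and A: "jet a b p n A"
  shows "\<exists>C\<ge>0. \<forall>g. jet a b p (Suc n) g \<longrightarrow>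
    (\<exists>Z. jet a b p n Z \<and> Z 0 = (\<lambda>t. mul (A 0 t) (g 0 t)) \<and> jnorm n Z \<le> C * jnorm (Suc n) g)"
proof (cases n)
  case 0
  interpret bounded_bilinear mul by fact
  obtain K where K: "K \<ge> 0" "\<And>x y. norm (mul x y) \<le> norm x * norm y * K" using nonneg_bounded by blast
  define C where "C = K * sup_const * Lp_norm a b p (A 0)"
  have "C \<ge> 0" unfolding C_def using K sup_const_nonneg by (intro mult_nonneg_nonneg Lp_norm_nonneg) auto
  moreover have "\<exists>Z. jet a b p 0 Z \<and> Z 0 = (\<lambda>t. mul (A 0 t) (g 0 t)) \<and> jnorm 0 Z \<le> C * jnorm (Suc 0) g"
    if g: "jet a b p (Suc 0) g" for g
  proof -
    have sb: "norm (g 0 t) \<le> sup_const * jnorm (Suc 0) g" if "t \<in> {a..b}" for t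
      using jet_sup_bound[OF g zero_less_Suc that] by (simp add: jnorm_def)
    have "Lp_fun a b p (\<lambda>t. mul (A 0 t) (g 0 t)) \<and> Lp_norm a b p (\<lambda>t. mul (A 0 t) (g 0 t)) \<le> K * (sup_const * jnorm (Suc 0) g) * Lp_norm a b p (A 0)"
      using Lp_bilinear(1)[OF mul K _ jet_Lp[OF A] _ sb] jet_Lp[OF g, of 0] sup_const_nonneg jnorm_nonneg[of "Suc 0" g]
      by (auto simp: Lp_fun_def)
    then show ?thesis using jet_outside[OF A]
      by (intro exI[of _ "\<lambda>i t. mul (A 0 t) (g 0 t)"]) (auto simp: jet_def jnorm_def C_def mult_ac zero_left)
  qed
  ultimately show ?thesis unfolding 0 by blast
next
  case (Suc N)
  then obtain C where C: "C \<ge> 0" "\<And>g. jet a b p n g \<Longrightarrow>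
    \<exists>Z. jet a b p n Z \<and> Z 0 = (\<lambda>t. mul (A 0 t) (g 0 t)) \<and> jnorm n Z \<le> C * jnorm n g"
    using product_jet[OF mul, of N A] A by blast
  have "\<exists>Z. jet a b p n Z \<and> Z 0 = (\<lambda>t. mul (A 0 t) (g 0 t)) \<and> jnorm n Z \<le> C * jnorm (Suc n) g"
    if g: "jet a b p (Suc n) g" for g
  proof -
    obtain Z where "jet a b p n Z" "Z 0 = (\<lambda>t. mul (A 0 t) (g 0 t))" "jnorm n Z \<le> C * jnorm n g"
      using C(2)[OF jet_mono[OF g]] by auto
    moreover have "C * jnorm n g \<le> C * jnorm (Suc n) g" by (intro mult_left_mono jnorm_mono C) simp
    ultimately show ?thesis by fastforce
  qed
  with C(1) show ?thesis by blast
qed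

end

locale sobolev_ode = interval_Lp +
  fixes mul :: "'c::euclidean_space \<Rightarrow> 'b::euclidean_space \<Rightarrow> 'b" and r n :: nat and A :: "nat \<Rightarrow> nat \<Rightarrow> real \<Rightarrow> 'c"
  assumes mul: "bounded_bilinear mul" and r: "1 \<le> r" and A_jet: "\<And>k. k < r \<Longrightarrow> jet a b p n (A k)"
begin

sublocale linear_ode a b p mul r "\<lambda>k. A k 0"
  by (intro linear_ode.intro interval_Lp_axioms linear_ode_axioms.intro mul r jet_Lp[OF A_jet]) auto

definition diff_expr :: "(nat \<Rightarrow> real \<Rightarrow> 'b) \<Rightarrow> real \<Rightarrow> 'b" where
  "diff_expr Y t = Y r t + (\<Sum>j = 1..r. mul (A (r - j) 0 t) (Y (r - j) t))"

text \<open>The jet of the image is produced together with the bound, so this also shows that the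
  differential expression maps \<open>W_p^(n+r)\<close> into \<open>W_p^n\<close>.\<close>

lemma diff_expr_bounded:
  "\<exists>C\<ge>0. \<forall>Y. jet a b p (n + r) Y \<longrightarrow> (\<exists>Z. jet a b p n Z \<and> Z 0 = diff_expr Y \<and> jnorm n Z \<le> C * jnorm (n + r) Y)"
proof -
  have sums: "\<exists>C\<ge>0. \<forall>Y. jet a b p (n + r) Y \<longrightarrow> (\<exists>Z. jet a b p n Z \<and>
      Z 0 = (\<lambda>t. \<Sum>j\<in>S. mul (A (r - j) 0 t) (Y (r - j) t)) \<and> jnorm n Z \<le> C * jnorm (n + r) Y)"
    if "finite S" "S \<subseteq> {1..r}" for S
    using that
  proof (induction S rule: finite_induct)
    case empty
    have "jnorm n (\<lambda>k t. 0 :: 'b) = 0"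
    proof -
      have "Lp_norm a b p (\<lambda>t. 0 :: 'b) \<le> 0 * Lp_norm a b p (\<lambda>t. 1::real)"
        by (rule Lp_bounded(2)) auto
      then have "Lp_norm a b p (\<lambda>t. 0 :: 'b) = 0" using Lp_norm_nonneg[of a b p "\<lambda>t. 0 :: 'b"] by simp
      then show ?thesis by (simp add: jnorm_def)
    qed
    then show ?case using jet_zero by (intro exI[of _ 0]) (auto intro!: exI[of _ "\<lambda>k t. 0 :: 'b"])
  next
    case (insert j S)
    then have j: "1 \<le> j" "j \<le> r" by auto
    obtain C where C: "C \<ge> 0" "\<And>Y. jet a b p (n + r) Y \<Longrightarrow> \<exists>Z. jet a b p n Z \<and>
      Z 0 = (\<lambda>t. \<Sum>j\<in>S. mul (A (r - j) 0 t) (Y (r - j) t)) \<and> jnorm n Z \<le> C * jnorm (n + r) Y"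
      using insert by auto
    have "r - j < r" using j by auto
    from product_jet_loss[OF mul A_jet[OF this]] obtain D where D: "D \<ge> 0" "\<And>g. jet a b p (Suc n) g \<Longrightarrow>
      \<exists>Z. jet a b p n Z \<and> Z 0 = (\<lambda>t. mul (A (r - j) 0 t) (g 0 t)) \<and> jnorm n Z \<le> D * jnorm (Suc n) g" by blast
    have "\<exists>Z. jet a b p n Z \<and> Z 0 = (\<lambda>t. \<Sum>j\<in>insert j S. mul (A (r - j) 0 t) (Y (r - j) t)) \<and>
        jnorm n Z \<le> (4 * (D + C)) * jnorm (n + r) Y"
      if Y: "jet a b p (n + r) Y" for Y
    proof -
      have e: "r - j + Suc n \<le> n + r" using j by auto
      have g: "jet a b p (Suc n) (\<lambda>i. Y (r - j + i))" by (intro jet_shift jet_mono[OF Y e])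
      have le: "jnorm (Suc n) (\<lambda>i. Y (r - j + i)) \<le> jnorm (n + r) Y"
        using order.trans[OF jnorm_shift jnorm_mono[OF e]] .
      obtain Z1 where Z1: "jet a b p n Z1" "Z1 0 = (\<lambda>t. mul (A (r - j) 0 t) (Y (r - j) t))"
        "jnorm n Z1 \<le> D * jnorm (Suc n) (\<lambda>i. Y (r - j + i))" using D(2)[OF g] by auto
      obtain Z2 where Z2: "jet a b p n Z2" "Z2 0 = (\<lambda>t. \<Sum>j\<in>S. mul (A (r - j) 0 t) (Y (r - j) t))"
        "jnorm n Z2 \<le> C * jnorm (n + r) Y" using C(2)[OF Y] by auto
      have "jnorm n Z1 \<le> D * jnorm (n + r) Y" using order.trans[OF Z1(3) mult_left_mono[OF le D(1)]] .
      then have "jnorm n (\<lambda>k t. Z1 k t + Z2 k t) \<le> (4 * (D + C)) * jnorm (n + r) Y"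
        using jnorm_add[OF Z1(1) Z2(1)] Z2(3) by (simp add: algebra_simps)
      then show ?thesis using jet_add[OF Z1(1) Z2(1)] insert.hyps
        by (intro exI[of _ "\<lambda>k t. Z1 k t + Z2 k t"]) (simp add: Z1(2) Z2(2))
    qed
    then show ?case using C(1) D(1) by (intro exI[of _ "4 * (D + C)"]) auto
  qed
  obtain C where C: "C \<ge> 0" "\<And>Y. jet a b p (n + r) Y \<Longrightarrow> \<exists>Z. jet a b p n Z \<and>
      Z 0 = (\<lambda>t. \<Sum>j\<in>{1..r}. mul (A (r - j) 0 t) (Y (r - j) t)) \<and> jnorm n Z \<le> C * jnorm (n + r) Y"
    using sums[of "{1..r}"] by auto
  have "\<exists>Z. jet a b p n Z \<and> Z 0 = diff_expr Y \<and> jnorm n Z \<le> (4 * (1 + C)) * jnorm (n + r) Y"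
    if Y: "jet a b p (n + r) Y" for Y
  proof -
    obtain Z where Z: "jet a b p n Z" "Z 0 = (\<lambda>t. \<Sum>j\<in>{1..r}. mul (A (r - j) 0 t) (Y (r - j) t))"
        "jnorm n Z \<le> C * jnorm (n + r) Y" using C(2)[OF Y] by auto
    have s: "jet a b p n (\<lambda>i. Y (r + i))" using Y by (intro jet_shift) (simp add: add.commute)
    have le: "jnorm n (\<lambda>i. Y (r + i)) \<le> jnorm (n + r) Y" using jnorm_shift[of n Y r] by (simp add: add.commute)
    have "jnorm n (\<lambda>k t. Y (r + k) t + Z k t) \<le> (4 * (1 + C)) * jnorm (n + r) Y"
      using jnorm_add[OF s Z(1)] Z(3) le by (simp add: algebra_simps)
    then show ?thesis using jet_add[OF s Z(1)]
      by (intro exI[of _ "\<lambda>k t. Y (r + k) t + Z k t"]) (simp add: Z(2) diff_expr_def fun_eq_iff)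
  qed
  with C(1) show ?thesis by (intro exI[of _ "4 * (1 + C)"]) auto
qed

text \<open>Bootstrapping: if the solution has \<open>m + r\<close> derivatives and \<open>m < n\<close>, then all terms of
  \<open>f - (sum of A_(r-j) y^(r-j))\<close> have \<open>m + 1\<close> derivatives, and this function is \<open>y^(r)\<close>.\<close>

lemma ex_regular_solution:
  assumes F: "jet a b p n F"
  obtains Y where "jet a b p (n + r) Y" "\<And>k. k < r \<Longrightarrow> Y k a = \<eta> k" "diff_expr Y = F 0"
proof -
  obtain Y0 where Y0: "jet a b p r Y0" "\<And>k. k < r \<Longrightarrow> Y0 k a = \<eta> k"
    "\<And>t. t \<in> {a..b} \<Longrightarrow> Y0 r t + (\<Sum>j = 1..r. mul (A (r - j) 0 t) (Y0 (r - j) t)) = F 0 t"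
    using ex_jet_solution[OF jet_Lp[OF F le0]] by blast
  have "\<exists>Y. jet a b p (m + r) Y \<and> (\<forall>k\<le>r. Y k = Y0 k)" if "m \<le> n" for m
    using that
  proof (induction m)
    case 0
    show ?case using Y0(1) by (intro exI[of _ Y0]) simp
  next
    case (Suc m)
    then obtain Y where Y: "jet a b p (m + r) Y" "\<And>k. k \<le> r \<Longrightarrow> Y k = Y0 k" by auto
    \<comment> \<open>Since \<open>j \<ge> 1\<close>, the function \<open>y^(r-j)\<close> has at least \<open>m + 1\<close> derivatives.\<close>
    have "\<exists>Z. jet a b p (Suc m) Z \<and> Z 0 = (\<lambda>t. mul (A (r - j) 0 t) (Y0 (r - j) t))" if j: "j \<in> {1..r}" for j
    proof -
      have "jet a b p (Suc m) (A (r - j))" using jet_mono[OF A_jet Suc.prems] j by auto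
      moreover have "jet a b p (Suc m) (\<lambda>i. Y (r - j + i))"
        using j by (intro jet_shift jet_mono[OF Y(1)]) auto
      moreover have "Y (r - j) = Y0 (r - j)" using Y(2) by simp
      ultimately show ?thesis using product_jet[OF mul, of m "A (r - j)"] by fastforce
    qed
    then obtain Z where Z: "\<And>j. j \<in> {1..r} \<Longrightarrow> jet a b p (Suc m) (Z j)"
      "\<And>j. j \<in> {1..r} \<Longrightarrow> Z j 0 = (\<lambda>t. mul (A (r - j) 0 t) (Y0 (r - j) t))" by metis
    define R where "R k t = F k t + - (\<Sum>j\<in>{1..r}. Z j k t)" for k t
    have R: "jet a b p (Suc m) R" unfolding R_def
      by (intro jet_add jet_mono[OF F Suc.prems] jet_bounded_linear[OF _ bounded_linear_minus[OF bounded_linear_ident]] jet_sum Z(1)) auto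
    have "R 0 = Y0 r"
    proof
      fix t
      have "(\<Sum>j\<in>{1..r}. Z j 0 t) = (\<Sum>j = 1..r. mul (A (r - j) 0 t) (Y0 (r - j) t))"
        by (rule sum.cong) (auto simp: Z(2))
      then show "R 0 t = Y0 r t"
        using Y0(3)[of t] jet_outside[OF R, of 0 t] jet_outside[OF Y0(1), of r t]
        by (cases "t \<in> {a..b}") (auto simp: R_def algebra_simps)
    qed
    then show ?case using jet_append[OF Y0(1) R]
      by (intro exI[of _ "\<lambda>k. if k < r then Y0 k else R (k - r)"]) auto
  qed
  then obtain Y where Y: "jet a b p (n + r) Y" "\<And>k. k \<le> r \<Longrightarrow> Y k = Y0 k" by auto
  show ?thesis
  proof (rule that[OF Y(1)])
    show "Y k a = \<eta> k" if "k < r" for k using Y(2) Y0(2) that by simp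
    show "diff_expr Y = F 0"
    proof
      fix t
      have "diff_expr Y t = Y0 r t + (\<Sum>j = 1..r. mul (A (r - j) 0 t) (Y0 (r - j) t))"
        by (simp add: diff_expr_def Y(2))
      then show "diff_expr Y t = F 0 t"
      proof (cases "t \<in> {a..b}")
        case False
        then have "Y k t = 0" if "k \<le> r" for k using jet_outside[OF Y(1) _ False] that by simp
        then show ?thesis using jet_outside[OF F le0 False]
          by (simp add: diff_expr_def bounded_bilinear.zero_right[OF mul])
      qed (use Y0(3) in simp)
    qed
  qed
qed

lemma regular_solution_zero:
  assumes Y: "jet a b p (n + r) Y" and 0: "\<And>k. k < r \<Longrightarrow> Y k a = 0"
    and eq: "AE t in lebesgue_on {a..b}. diff_expr Y t = 0"
  shows "Y 0 = (\<lambda>t. 0)"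
  by (rule jet_solution_zero[OF jet_mono[OF Y] 0 eq[unfolded diff_expr_def]]) auto

end

section \<open>Index of a surjection paired with finitely many functionals\<close>

text \<open>The maps here are linear on a subspace only, so linearity has to be carried to finite sums by hand.\<close>

lemma linear_on_sum:
  assumes "vector_space s1" "vector_space s2" and N: "module.subspace s1 N"
    and add: "\<And>x y. \<lbrakk>x \<in> N; y \<in> N\<rbrakk> \<Longrightarrow> f (x + y) = f x + f y"
    and scale: "\<And>c x. x \<in> N \<Longrightarrow> f (s1 c x) = s2 c (f x)"
    and v: "\<And>i. i \<in> S \<Longrightarrow> v i \<in> N"
  shows "f (\<Sum>i\<in>S. s1 (c i) (v i)) = (\<Sum>i\<in>S. s2 (c i) (f (v i)))"
proof -
  interpret v1: vector_space s1 by fact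
  interpret v2: vector_space s2 by fact
  have f0: "f 0 = 0" using scale[of 0 0] v1.subspace_0[OF N] by simp
  show ?thesis using v
  proof (induction S rule: infinite_finite_induct)
    case (insert i S)
    have "(\<Sum>i\<in>S. s1 (c i) (v i)) \<in> N" using insert.prems by (intro v1.subspace_sum[OF N] v1.subspace_scale[OF N]) auto
    then show ?case using insert by (simp add: add scale v1.subspace_scale[OF N])
  qed (auto simp: f0)
qed

text \<open>Vectors with a dual system of functionals that separates points form a basis: the coefficients of \<open>x\<close> are the values
  \<open>\<phi> i x\<close>.\<close>

lemma dual_basis:
  fixes sc :: "complex \<Rightarrow> 'v::ab_group_add \<Rightarrow> 'v" and \<phi> :: "'i \<Rightarrow> 'v \<Rightarrow> complex"
  assumes "vector_space sc" and N: "module.subspace sc N" and I: "finite I"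
    and e: "\<And>i. i \<in> I \<Longrightarrow> e i \<in> N"
    and add: "\<And>i x y. \<lbrakk>i \<in> I; x \<in> N; y \<in> N\<rbrakk> \<Longrightarrow> \<phi> i (x + y) = \<phi> i x + \<phi> i y"
    and scale: "\<And>i c x. \<lbrakk>i \<in> I; x \<in> N\<rbrakk> \<Longrightarrow> \<phi> i (sc c x) = c * \<phi> i x"
    and dual: "\<And>i j. \<lbrakk>i \<in> I; j \<in> I\<rbrakk> \<Longrightarrow> \<phi> i (e j) = (if i = j then 1 else 0)"
    and total: "\<And>x. \<lbrakk>x \<in> N; \<And>i. i \<in> I \<Longrightarrow> \<phi> i x = 0\<rbrakk> \<Longrightarrow> x = 0"
  shows "finite (e ` I)" "\<not> module.dependent sc (e ` I)" "module.span sc (e ` I) = N" "card (e ` I) = card I"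
proof -
  interpret v: vector_space sc by fact
  have vc: "vector_space ((*) :: complex \<Rightarrow> complex \<Rightarrow> complex)" by unfold_locales (auto simp: algebra_simps)
  have inj: "inj_on e I"
  proof (rule inj_onI)
    fix i j assume "i \<in> I" "j \<in> I" "e i = e j"
    then show "i = j" using dual[of i i] dual[of i j] by (auto split: if_splits)
  qed
  have lin: "\<phi> j (\<Sum>i\<in>I. sc (c i) (e i)) = c j" if j: "j \<in> I" for j c
  proof -
    have "\<phi> j (\<Sum>i\<in>I. sc (c i) (e i)) = (\<Sum>i\<in>I. c i * \<phi> j (e i))"
      by (rule linear_on_sum[OF assms(1) vc N]) (use add scale e j in auto)
    also have "\<dots> = (\<Sum>i\<in>I. if j = i then c i else 0)" by (rule sum.cong) (use dual j in auto)
    finally show ?thesis using I j by simp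
  qed
  show "finite (e ` I)" using I by simp
  show "card (e ` I) = card I" by (rule card_image[OF inj])
  show "\<not> v.dependent (e ` I)"
  proof (rule v.independent_if_scalars_zero)
    fix f x assume s: "(\<Sum>x\<in>e ` I. sc (f x) x) = 0" and "x \<in> e ` I"
    then obtain j where j: "j \<in> I" "x = e j" by blast
    have "(\<Sum>i\<in>I. sc (f (e i)) (e i)) = 0" using s by (simp add: sum.reindex[OF inj])
    then have "\<phi> j (\<Sum>i\<in>I. sc (f (e i)) (e i)) = \<phi> j (sc 0 (e j))" by simp
    then show "f x = 0" using lin[OF j(1), of "\<lambda>i. f (e i)"] scale[OF j(1) e[OF j(1)], of 0] j(2) by simp
  qed (use I in simp)
  show "v.span (e ` I) = N"
  proof
    show "v.span (e ` I) \<subseteq> N" by (rule v.span_minimal) (use e N in auto)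
    show "N \<subseteq> v.span (e ` I)"
    proof
      fix x assume x: "x \<in> N"
      define y where "y = (\<Sum>i\<in>I. sc (\<phi> i x) (e i))"
      have y: "y \<in> N" unfolding y_def by (intro v.subspace_sum[OF N] v.subspace_scale[OF N] e)
      have my: "sc (- 1) y \<in> N" by (rule v.subspace_scale[OF N y])
      have "x + sc (- 1) y = 0"
      proof (rule total)
        show "x + sc (- 1) y \<in> N" by (rule v.subspace_add[OF N x my])
        show "\<phi> i (x + sc (- 1) y) = 0" if i: "i \<in> I" for i
        proof -
          have "\<phi> i (x + sc (- 1) y) = \<phi> i x + (- 1) * \<phi> i y" by (simp only: add[OF i x my] scale[OF i y])
          moreover have "\<phi> i y = \<phi> i x" unfolding y_def by (rule lin[OF i])
          ultimately show ?thesis by simp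
        qed
      qed
      then have "x = y" by simp
      moreover have "y \<in> v.span (e ` I)" unfolding y_def by (intro v.span_sum v.span_scale v.span_base imageI)
      ultimately show "x \<in> v.span (e ` I)" by simp
    qed
  qed
qed

text \<open>Steinitz exchange modulo \<open>U\<close>: move every \<open>s\<close> in \<open>S\<close> within its coset to a vector \<open>w s\<close> in the span of \<open>B\<close>. The \<open>w s\<close> are
  still independent, now inside a finitely generated space.\<close>

lemma quotient_basis_card_le:
  assumes "vector_space sc" and U: "module.subspace sc U"
    and B: "quotient_basis sc V U B" "finite B" and S: "quotient_basis sc V U B'" "finite S" "S \<subseteq> B'"
  shows "card S \<le> card B"
proof -
  interpret v: vector_space sc by fact
  have "\<forall>s\<in>S. \<exists>w. w \<in> v.span B \<and> s - w \<in> U"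
  proof -
    have "\<forall>v\<in>V. \<exists>w\<in>v.span B. v - w \<in> U" using B(1) by (simp add: quotient_basis_def)
    moreover have "S \<subseteq> V" using S(1,3) by (auto simp: quotient_basis_def)
    ultimately show ?thesis by (meson subsetD)
  qed
  then obtain w where w: "\<And>s. s \<in> S \<Longrightarrow> w s \<in> v.span B" "\<And>s. s \<in> S \<Longrightarrow> s - w s \<in> U" by metis
  have ind: "c s = 0" if "(\<Sum>s\<in>S. sc (c s) (w s)) \<in> U" "s \<in> S" for c s
  proof -
    have "(\<Sum>s\<in>S. sc (c s) (s - w s)) + (\<Sum>s\<in>S. sc (c s) (w s)) \<in> U"
      by (rule v.subspace_add[OF U _ that(1)]) (intro v.subspace_sum[OF U] v.subspace_scale[OF U] w(2))
    also have "(\<Sum>s\<in>S. sc (c s) (s - w s)) + (\<Sum>s\<in>S. sc (c s) (w s)) = (\<Sum>s\<in>S. sc (c s) s)"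
      by (simp add: v.scale_right_diff_distrib sum_subtractf)
    finally show ?thesis using S that(2) unfolding quotient_basis_def by blast
  qed
  have inj: "inj_on w S"
  proof (rule inj_onI, rule ccontr)
    fix s t assume st: "s \<in> S" "t \<in> S" "w s = w t" "s \<noteq> t"
    define c where "c x = (if x = s then 1 else if x = t then - 1 else 0 :: complex)" for x
    have "(\<Sum>x\<in>S. sc (c x) (w x)) = (\<Sum>x\<in>{s, t}. sc (c x) (w x))"
      using st S(2) by (intro sum.mono_neutral_right) (auto simp: c_def)
    also have "\<dots> = 0" using st by (simp add: c_def)
    finally have "c s = 0" using ind[of c s] st v.subspace_0[OF U] by simp
    then show False by (simp add: c_def)
  qed
  have "\<not> v.dependent (w ` S)"
  proof (rule v.independent_if_scalars_zero)
    fix f x assume s: "(\<Sum>x\<in>w ` S. sc (f x) x) = 0" and "x \<in> w ` S"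
    then obtain j where j: "j \<in> S" "x = w j" by blast
    show "f x = 0" using ind[of "\<lambda>i. f (w i)" j] s j v.subspace_0[OF U] by (simp add: sum.reindex[OF inj])
  qed (use S in simp)
  then have "card (w ` S) \<le> card B"
    using v.independent_span_bound[OF B(2)] w(1) by blast
  then show ?thesis by (simp add: card_image[OF inj])
qed

text \<open>The dimension of a quotient is defined by choosing some basis, a priori an infinite one; any
  finite basis determines it.\<close>

lemma quotient_dim_eq_card:
  assumes "vector_space sc" "module.subspace sc U" and B: "quotient_basis sc V U B" "finite B"
  shows "quotient_dim sc V U = card B"
proof -
  define B' where "B' = (SOME B. quotient_basis sc V U B)"
  have B': "quotient_basis sc V U B'" unfolding B'_def using B(1) by (rule someI)
  note le = quotient_basis_card_le[OF assms(1,2)]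
  have fin: "finite B'"
  proof (rule ccontr)
    assume "infinite B'"
    then obtain S where "S \<subseteq> B'" "finite S" "card S = Suc (card B)" using infinite_arbitrarily_large by blast
    with le[OF B B'] show False by fastforce
  qed
  have "card B' = card B"
    using le[OF B B' fin order_refl] le[OF B' fin B order_refl] by simp
  then show ?thesis by (simp add: quotient_dim_def B'_def)
qed

text \<open>Let \<open>E1\<close> be a basis of the kernel of \<open>B\<close> on \<open>N = ker L\<close>, extended by \<open>E2\<close> to a basis of \<open>N\<close>. Then \<open>B\<close> maps \<open>E2\<close>
  injectively to a basis of \<open>B N\<close>, which \<open>G\<close> extends to a basis of the coordinate space, and the pairs \<open>(0, g)\<close> with \<open>g\<close> in \<open>G\<close>
  form a basis of the cokernel. The index is \<open>card E1 - card G\<close> with \<open>card E1 + card E2 = card E\<close> and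
  \<open>card G + card E2 = CARD('l)\<close>.\<close>

lemma fredholm_from_surjective:
  fixes X :: "'v::ab_group_add cnspace" and Y :: "'w::ab_group_add cnspace" and B :: "'v \<Rightarrow> complex^'l"
  assumes vX: "vector_space (cscale X)" and vY: "vector_space (cscale Y)"
    and X: "module.subspace (cscale X) (elems X)" and Y0: "0 \<in> elems Y"
    and L: "L ` elems X = elems Y"
    and L_add: "\<And>x y. \<lbrakk>x \<in> elems X; y \<in> elems X\<rbrakk> \<Longrightarrow> L (x + y) = L x + L y"
    and L_scale: "\<And>c x. x \<in> elems X \<Longrightarrow> L (cscale X c x) = cscale Y c (L x)"
    and B_add: "\<And>x y. \<lbrakk>x \<in> elems X; y \<in> elems X\<rbrakk> \<Longrightarrow> B (x + y) = B x + B y"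
    and B_scale: "\<And>c x. x \<in> elems X \<Longrightarrow> B (cscale X c x) = c *s B x"
    and E: "finite E" "\<not> module.dependent (cscale X) E" "module.span (cscale X) E = {x \<in> elems X. L x = 0}"
  defines "T \<equiv> \<lambda>x. (L x, B x)"
  shows "\<exists>K. finite K \<and> module.span (cscale X) K = op_kernel X T"
    and "quotient_findim (cscale (prod_space Y coord_space)) (elems (prod_space Y coord_space)) (T ` elems X)"
    and "fredholm_index X (prod_space Y coord_space) T = int (card E) - int CARD('l)"
proof -
  let ?s = "cscale X" and ?Z = "prod_space Y (coord_space :: (complex^'l) cnspace)"
  interpret vX: vector_space ?s by fact
  interpret vY: vector_space "cscale Y" by fact
  have vZ: "vector_space (cscale ?Z)" by (rule vector_space_cscale_prod[OF vY vector_space_cscale(2)])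
  interpret vZ: vector_space "cscale ?Z" by fact
  have vC: "vector_space ((*s) :: complex \<Rightarrow> complex^'l \<Rightarrow> _)" using vector_space_cscale(2) by (simp add: coord_space_def)
  have sZ: "cscale ?Z c (f, z) = (cscale Y c f, c *s z)" for c f z by (simp add: prod_space_def coord_space_def)
  have eZ: "elems ?Z = elems Y \<times> UNIV" by (simp add: prod_space_def coord_space_def)
  define N where "N = {x \<in> elems X. L x = 0}"
  have N: "vX.subspace N" using vX.subspace_span[of E] E(3) by (simp add: N_def)
  have NX: "N \<subseteq> elems X" by (auto simp: N_def)
  define K where "K = {x \<in> N. B x = 0}"
  have K_ker: "op_kernel X T = K" by (auto simp: op_kernel_def K_def N_def T_def zero_prod_def)
  have B0: "B 0 = 0" using B_scale[of 0 0] vX.subspace_0[OF X] by simp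
  have K: "vX.subspace K"
    unfolding K_def vX.subspace_def using vX.subspace_0[OF N] vX.subspace_add[OF N] vX.subspace_scale[OF N] NX B0
    by (auto simp: B_add B_scale subset_eq)
  obtain E1 where E1: "E1 \<subseteq> K" "\<not> vX.dependent E1" "K \<subseteq> vX.span E1"
    using vX.maximal_independent_subset[of K] by blast
  have spE1: "vX.span E1 = K" using E1 vX.span_minimal[OF E1(1) K] by blast
  obtain F where F: "E1 \<subseteq> F" "F \<subseteq> N" "\<not> vX.dependent F" "N \<subseteq> vX.span F"
    using vX.maximal_independent_subset_extend[of E1 N] E1(1,2) by (auto simp: K_def)
  have finF: "finite F" "card F \<le> card E"
    using vX.independent_span_bound[OF E(1) F(3)] F(2) E(3) by (auto simp: N_def)
  have "card E \<le> card F"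
    using vX.independent_span_bound[OF finF(1) E(2)] F(4) vX.span_superset[of E] E(3) by (auto simp: N_def)
  with finF have cardF: "card F = card E" by simp
  define E2 where "E2 = F - E1"
  have fin: "finite E1" "finite E2" using finF F(1) by (auto simp: E2_def intro: finite_subset)
  have cards: "card E1 + card E2 = card E"
    unfolding cardF[symmetric] E2_def using F(1) finF(1) by (metis card_Diff_subset card_mono fin(1) le_add_diff_inverse)
  have Bsum: "B (\<Sum>i\<in>S. ?s (c i) (v i)) = (\<Sum>i\<in>S. c i *s B (v i))" if "\<And>i. i \<in> S \<Longrightarrow> v i \<in> elems X" for S :: "'v set" and c v
    by (rule linear_on_sum[OF vX vC X]) (use B_add B_scale that in auto)
  have ind2: "c x = 0" if c: "(\<Sum>x\<in>E2. c x *s B x) = 0" and x: "x \<in> E2" for c x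
  proof -
    have E2N: "y \<in> N" if "y \<in> E2" for y using that F(2) by (auto simp: E2_def)
    have "(\<Sum>x\<in>E2. ?s (c x) x) \<in> N" using E2N by (intro vX.subspace_sum[OF N] vX.subspace_scale[OF N])
    moreover have "B (\<Sum>x\<in>E2. ?s (c x) x) = 0" using c Bsum[of E2 "\<lambda>x. x" c] E2N NX by auto
    ultimately have "(\<Sum>x\<in>E2. ?s (c x) x) \<in> vX.span E1" unfolding spE1 K_def by simp
    then obtain d where d: "(\<Sum>x\<in>E2. ?s (c x) x) = (\<Sum>x\<in>E1. ?s (d x) x)"
      unfolding vX.span_finite[OF fin(1)] by auto
    \<comment> \<open>The two expansions of one vector, subtracted: a vanishing combination of the basis \<open>F\<close>.\<close>
    define g where "g y = (if y \<in> E1 then - d y else c y)" for y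
    have "(\<Sum>y\<in>F. ?s (g y) y) = (\<Sum>y\<in>E2. ?s (g y) y) + (\<Sum>y\<in>E1. ?s (g y) y)"
      unfolding E2_def by (rule sum.subset_diff[OF F(1) finF(1)])
    also have "(\<Sum>y\<in>E2. ?s (g y) y) = (\<Sum>y\<in>E2. ?s (c y) y)" by (rule sum.cong) (auto simp: g_def E2_def)
    also have "(\<Sum>y\<in>E1. ?s (g y) y) = - (\<Sum>y\<in>E1. ?s (d y) y)" by (simp add: g_def sum_negf)
    finally have "(\<Sum>y\<in>F. ?s (g y) y) = 0" using d by simp
    from vX.independentD[OF F(3) finF(1) order_refl this, of x] x show "c x = 0" by (auto simp: g_def E2_def)
  qed
  have injB: "inj_on B E2"
  proof (rule inj_onI, rule ccontr)
    fix s t assume st: "s \<in> E2" "t \<in> E2" "B s = B t" "s \<noteq> t"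
    define c where "c x = (if x = s then 1 else if x = t then - 1 else 0 :: complex)" for x
    have "(\<Sum>x\<in>E2. c x *s B x) = (\<Sum>x\<in>{s, t}. c x *s B x)"
      using st fin(2) by (intro sum.mono_neutral_right) (auto simp: c_def)
    also have "\<dots> = 0" using st by (simp add: c_def)
    finally have "c s = 0" using ind2[of c s] st by simp
    then show False by (simp add: c_def)
  qed
  have indB: "\<not> vec.dependent (B ` E2)"
  proof (rule vec.independent_if_scalars_zero)
    fix f x assume s: "(\<Sum>x\<in>B ` E2. f x *s x) = 0" and "x \<in> B ` E2"
    then obtain j where j: "j \<in> E2" "x = B j" by blast
    show "f x = 0" using ind2[of "\<lambda>i. f (B i)" j] s j by (simp add: sum.reindex[OF injB])
  qed (use fin in simp)
  obtain C where C: "B ` E2 \<subseteq> C" "\<not> vec.dependent C" "UNIV \<subseteq> vec.span C"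
    using vec.maximal_independent_subset_extend[of "B ` E2" UNIV] indB by auto
  have finC: "finite C" using vec.finiteI_independent[OF C(2)] .
  have cardC: "card C = CARD('l)"
    using vec.dim_eq_card_independent[OF C(2)] vec.dim_span[of C] C(3) vec_dim_card[where 'a=complex and 'n='l] by (metis top.extremum_uniqueI)
  define G where "G = C - B ` E2"
  have finG: "finite G" using finC by (simp add: G_def)
  have cardG: "card G + card E2 = CARD('l)"
    unfolding G_def cardC[symmetric] using C(1) finC fin(2) card_image[OF injB]
    by (metis card_Diff_subset card_mono finite_imageI le_add_diff_inverse2)
  define Q where "Q = Pair (0 :: 'w) ` G"
  have injP: "inj_on (Pair (0 :: 'w)) G" by (simp add: inj_on_def)
  have sumQ: "(\<Sum>q\<in>S. cscale ?Z (c q) (0, q)) = (0, \<Sum>q\<in>S. c q *s q)" for c and S :: "(complex^'l) set"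
    by (simp add: sZ prod_eq_iff fst_sum snd_sum)
  have BN: "B x \<in> vec.span (B ` E2)" if x: "x \<in> N" for x
  proof -
    obtain d where d: "x = (\<Sum>y\<in>F. ?s (d y) y)" using x F(4) unfolding vX.span_finite[OF finF(1)] by auto
    have "B x = (\<Sum>y\<in>F. d y *s B y)" unfolding d by (rule Bsum) (use F(2) NX in auto)
    also have "\<dots> \<in> vec.span (B ` E2)"
    proof (intro vec.span_sum vec.span_scale)
      fix y assume y: "y \<in> F"
      show "B y \<in> vec.span (B ` E2)"
      proof (cases "y \<in> E1")
        case True then have "B y = 0" using E1(1) by (auto simp: K_def)
        then show ?thesis by (simp add: vec.span_zero)
      next
        case False with y show ?thesis by (intro vec.span_base) (auto simp: E2_def)
      qed
    qed
    finally show ?thesis .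
  qed
  have Tsub: "vZ.subspace (T ` elems X)"
    unfolding vZ.subspace_def
  proof (intro conjI ballI allI)
    show "0 \<in> T ` elems X"
    proof
      show "0 = T 0" using L_scale[of 0 0] B0 vX.subspace_0[OF X] by (simp add: T_def zero_prod_def)
    qed (rule vX.subspace_0[OF X])
    show "x + y \<in> T ` elems X" if xy: "x \<in> T ` elems X" "y \<in> T ` elems X" for x y
    proof -
      from xy obtain u v where uv: "u \<in> elems X" "v \<in> elems X" "x = T u" "y = T v" by blast
      then have "x + y = T (u + v)" by (simp add: T_def L_add B_add)
      with vX.subspace_add[OF X uv(1,2)] show ?thesis by blast
    qed
    show "cscale ?Z c x \<in> T ` elems X" if x: "x \<in> T ` elems X" for c x
    proof -
      from x obtain u where u: "u \<in> elems X" "x = T u" by blast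
      then have "cscale ?Z c x = T (?s c u)" by (simp add: T_def L_scale B_scale sZ)
      with vX.subspace_scale[OF X u(1)] show ?thesis by blast
    qed
  qed
  have Q: "quotient_basis (cscale ?Z) (elems ?Z) (T ` elems X) Q"
    unfolding quotient_basis_def
  proof (intro conjI ballI allI impI)
    show "Q \<subseteq> elems ?Z" using Y0 by (auto simp: Q_def eZ)
    fix v assume "v \<in> elems ?Z"
    then obtain f z where v: "v = (f, z)" "f \<in> elems Y" by (auto simp: eZ)
    then have "f \<in> L ` elems X" using L by simp
    then obtain x where x: "x \<in> elems X" "L x = f" by auto
    have "z - B x \<in> vec.span C" using C(3) by blast
    then obtain d where d: "z - B x = (\<Sum>y\<in>C. d y *s y)" unfolding vec.span_finite[OF finC] by auto
    have d': "z - B x = (\<Sum>y\<in>G. d y *s y) + (\<Sum>y\<in>B ` E2. d y *s y)"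
      unfolding d G_def by (rule sum.subset_diff[OF C(1) finC])
    define u where "u = (\<Sum>y\<in>E2. ?s (d (B y)) y)"
    have E2N: "y \<in> N" if "y \<in> E2" for y using that F(2) by (auto simp: E2_def)
    have u: "u \<in> N" unfolding u_def using E2N by (intro vX.subspace_sum[OF N] vX.subspace_scale[OF N])
    have Bu: "B u = (\<Sum>y\<in>B ` E2. d y *s y)"
      unfolding u_def using E2N NX by (subst Bsum) (auto simp: sum.reindex[OF injB])
    have w: "(0, \<Sum>y\<in>G. d y *s y) \<in> vZ.span Q"
      unfolding sumQ[symmetric] by (intro vZ.span_sum vZ.span_scale vZ.span_base) (auto simp: Q_def)
    have eq: "v - (0, \<Sum>y\<in>G. d y *s y) = T (x + u)"
      using u x d' Bu NX by (auto simp: v T_def L_add B_add N_def algebra_simps subset_eq)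
    have xu: "x + u \<in> elems X" using x u NX by (intro vX.subspace_add[OF X]) auto
    show "\<exists>w\<in>vZ.span Q. v - w \<in> T ` elems X"
      by (rule bexI[OF _ w]) (unfold eq, rule imageI[OF xu])
  next
    fix S c v assume S: "finite S \<and> S \<subseteq> Q \<and> (\<Sum>v\<in>S. cscale ?Z (c v) v) \<in> T ` elems X" and v: "v \<in> S"
    then obtain G' where G': "G' \<subseteq> G" "S = Pair 0 ` G'" unfolding Q_def by (meson subset_imageE)
    have "(\<Sum>v\<in>S. cscale ?Z (c v) v) = (\<Sum>q\<in>G'. cscale ?Z (c (0, q)) (0, q))"
      unfolding G'(2) by (subst sum.reindex) (use G'(1) injP in \<open>auto simp: inj_on_def\<close>)
    also have "\<dots> = (0, \<Sum>q\<in>G'. c (0, q) *s q)" by (rule sumQ)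
    finally obtain x where x: "x \<in> elems X" "L x = 0" "B x = (\<Sum>q\<in>G'. c (0, q) *s q)"
      using S by (auto simp: T_def)
    then have "B x \<in> vec.span (B ` E2)" by (intro BN) (simp add: N_def)
    then obtain d where d: "B x = (\<Sum>y\<in>B ` E2. d y *s y)"
      unfolding vec.span_finite[OF finite_imageI[OF fin(2)]] by auto
    \<comment> \<open>Again two expansions of one vector, \<open>B x\<close>, now subtracted in the basis \<open>C\<close>.\<close>
    define g where "g y = (if y \<in> B ` E2 then - d y else if y \<in> G' then c (0, y) else 0)" for y
    have "(\<Sum>y\<in>C. g y *s y) = (\<Sum>y\<in>G. g y *s y) + (\<Sum>y\<in>B ` E2. g y *s y)"
      unfolding G_def by (rule sum.subset_diff[OF C(1) finC])
    also have "(\<Sum>y\<in>G. g y *s y) = (\<Sum>y\<in>G'. c (0, y) *s y)"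
      using G'(1) finG by (intro sum.mono_neutral_cong_right) (auto simp: g_def G_def)
    also have "(\<Sum>y\<in>B ` E2. g y *s y) = - (\<Sum>y\<in>B ` E2. d y *s y)" by (simp add: g_def sum_negf vec.scale_minus_left)
    finally have g0: "(\<Sum>y\<in>C. g y *s y) = 0" using d x(3) by simp
    obtain y where y: "y \<in> G'" "v = (0, y)" using v G'(2) by blast
    then have "g y = 0" using vec.independentD[OF C(2) finC order_refl g0] G'(1) by (auto simp: G_def)
    then show "c v = 0" using y G'(1) by (auto simp: g_def G_def)
  qed
  have finQ: "finite Q" and cardQ: "card Q = card G" using finG card_image[OF injP] by (auto simp: Q_def)
  show "\<exists>K. finite K \<and> vX.span K = op_kernel X T" using spE1 fin(1) K_ker by blast
  show "quotient_findim (cscale ?Z) (elems ?Z) (T ` elems X)"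
    unfolding quotient_findim_def using Q finQ by blast
  have "vX.dim (op_kernel X T) = card E1"
    unfolding K_ker using vX.dim_unique[OF E1(1,3,2) refl] .
  moreover have "quotient_dim (cscale ?Z) (elems ?Z) (T ` elems X) = card G"
    using quotient_dim_eq_card[OF vZ Tsub Q finQ] cardQ by simp
  ultimately show "fredholm_index X ?Z T = int (card E) - int CARD('l)"
    unfolding fredholm_index_def using cards cardG by simp
qed

section \<open>The differential operator on equivalence classes\<close>

lemma bounded_bilinear_matrix_vector: "bounded_bilinear ((*v) :: complex^'n^'m \<Rightarrow> complex^'n \<Rightarrow> complex^'m)"
  unfolding bilinear_conv_bounded_bilinear[symmetric] bilinear_def
  by (auto intro!: linearI simp: matrix_vector_mult_def vec_eq_iff algebra_simps sum.distrib scaleR_sum_right)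

lemma bounded_linear_vector_scale: "bounded_linear ((*s) c :: complex^'n \<Rightarrow> complex^'n)"
  unfolding linear_conv_bounded_linear[symmetric]
  by (auto intro!: linearI simp: vec_eq_iff algebra_simps)

lemma aefun_plus: "aefun f + aefun g = aefun (\<lambda>t. f t + g t)"
  by (rule plus_aefun.abs_eq)

lemma aefun_scale: "scale_aefun c (aefun f) = aefun (\<lambda>t. c *s f t)"
  by (rule scale_aefun.abs_eq)

lemma aefun_zero: "0 = aefun (\<lambda>t. 0)"
  by (simp add: zero_aefun.abs_eq)

context interval_Lp
begin

lemma subspace_sobolev: "module.subspace scale_aefun (sobolev a b p s :: (complex^'m) aefun set)"
proof -
  interpret vector_space "scale_aefun :: complex \<Rightarrow> (complex^'m) aefun \<Rightarrow> _" by (rule vector_space_scale_aefun)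
  show ?thesis
    unfolding subspace_def
  proof (intro conjI ballI allI)
    show "(0 :: (complex^'m) aefun) \<in> sobolev a b p s"
      unfolding sobolev_iff_jet aefun_zero using jet_zero by blast
    fix u v :: "(complex^'m) aefun" assume "u \<in> sobolev a b p s" "v \<in> sobolev a b p s"
    then obtain Y Z where YZ: "jet a b p s Y" "u = aefun (Y 0)" "jet a b p s Z" "v = aefun (Z 0)"
      unfolding sobolev_iff_jet by blast
    show "u + v \<in> sobolev a b p s"
      unfolding sobolev_iff_jet YZ aefun_plus using jet_add[OF YZ(1,3)] by blast
  next
    fix c and u :: "(complex^'m) aefun" assume "u \<in> sobolev a b p s"
    then obtain Y where Y: "jet a b p s Y" "u = aefun (Y 0)" unfolding sobolev_iff_jet by blast
    show "scale_aefun c u \<in> sobolev a b p s"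
      unfolding sobolev_iff_jet Y aefun_scale using jet_bounded_linear[OF Y(1) bounded_linear_vector_scale] by blast
  qed
qed

text \<open>For \<open>n = 0\<close> the top derivative of the representative agrees with \<open>Y r\<close> only almost everywhere; as
  elements of the quotient type the two sides are still equal.\<close>

lemma diff_op_jet:
  fixes A :: "nat \<Rightarrow> (complex^'m^'m) aefun"
  assumes r: "1 \<le> r" and Y: "jet a b p (n + r) Y"
  shows "diff_op a b p n r A (aefun (Y 0))
    = aefun (\<lambda>t. Y r t + (\<Sum>j = 1..r. sobolev_rep a b p n (A (r - j)) t *v Y (r - j) t))"
proof -
  define f where "f = sobolev_rep a b p (n + r) (aefun (Y 0))"
  have u: "aefun (Y 0) \<in> sobolev a b p (n + r)" using Y by (auto simp: sobolev_iff_jet)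
  have low: "nth_deriv a b (r - j) f = Y (r - j)" if "j \<in> {1..r}" for j
    unfolding f_def by (rule sobolev_rep_of_jet(1)[OF Y]) (use that r in auto)
  have "AE t in lebesgue_on {a..b}. nth_deriv a b r f t = Y r t"
    using sobolev_rep_of_jet[OF Y] unfolding f_def by (cases "n = 0") auto
  then have "aefun (nth_deriv a b r f) = aefun (Y r)"
    using jet_outside[OF sobolev_rep_jet(1)[OF u], of r] jet_outside[OF Y, of r]
    by (subst aefun_eq_iff) (auto simp: f_def)
  moreover have "(\<lambda>t. \<Sum>j = 1..r. sobolev_rep a b p n (A (r - j)) t *v nth_deriv a b (r - j) f t)
      = (\<lambda>t. \<Sum>j = 1..r. sobolev_rep a b p n (A (r - j)) t *v Y (r - j) t)"
    by (intro ext sum.cong refl) (simp add: low)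
  ultimately show ?thesis
    unfolding diff_op_def Let_def f_def[symmetric] aefun_plus[symmetric] by simp
qed

end

locale sobolev_diff_op = interval_Lp +
  fixes n r :: nat and A :: "nat \<Rightarrow> (complex^'m^'m) aefun"
  assumes r: "1 \<le> r" and A_sobolev: "\<And>k. k < r \<Longrightarrow> A k \<in> sobolev a b p n"
begin

definition coeff_jet :: "nat \<Rightarrow> nat \<Rightarrow> real \<Rightarrow> complex^'m^'m" where
  "coeff_jet k i = nth_deriv a b i (sobolev_rep a b p n (A k))"

sublocale ode: sobolev_ode a b p "(*v) :: complex^'m^'m \<Rightarrow> complex^'m \<Rightarrow> complex^'m" r n coeff_jet
proof (intro sobolev_ode.intro interval_Lp_axioms sobolev_ode_axioms.intro bounded_bilinear_matrix_vector r)
  show "jet a b p n (coeff_jet k)" if "k < r" for k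
    using sobolev_rep_jet(1)[OF A_sobolev[OF that]] by (simp add: coeff_jet_def[abs_def])
qed

abbreviation L :: "(complex^'m) aefun \<Rightarrow> (complex^'m) aefun" where
  "L \<equiv> diff_op a b p n r A"

lemma L_jet: "jet a b p (n + r) Y \<Longrightarrow> L (aefun (Y 0)) = aefun (ode.diff_expr Y)"
  by (simp add: diff_op_jet[OF r] ode.diff_expr_def[abs_def] coeff_jet_def nth_deriv_def)

lemma domain_jet:
  fixes u :: "(complex^'m) aefun"
  assumes "u \<in> sobolev a b p (n + r)"
  obtains Y where "jet a b p (n + r) Y" "u = aefun (Y 0)"
  using assms unfolding sobolev_iff_jet by blast

lemma L_add:
  assumes "u \<in> sobolev a b p (n + r)" "v \<in> sobolev a b p (n + r)"
  shows "L (u + v) = L u + L v"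
proof -
  obtain Y where Y: "jet a b p (n + r) Y" "u = aefun (Y 0)" using domain_jet[OF assms(1)] by blast
  obtain Z where Z: "jet a b p (n + r) Z" "v = aefun (Z 0)" using domain_jet[OF assms(2)] by blast
  have "u + v = aefun ((\<lambda>k t. Y k t + Z k t) 0)" by (simp add: Y Z aefun_plus)
  then have "L (u + v) = aefun (ode.diff_expr (\<lambda>k t. Y k t + Z k t))" using L_jet[OF jet_add[OF Y(1) Z(1)]] by simp
  also have "ode.diff_expr (\<lambda>k t. Y k t + Z k t) = (\<lambda>t. ode.diff_expr Y t + ode.diff_expr Z t)"
    by (simp add: fun_eq_iff ode.diff_expr_def matrix_vector_right_distrib sum.distrib)
  finally show ?thesis using L_jet[OF Y(1)] L_jet[OF Z(1)] by (simp add: Y Z aefun_plus)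
qed

lemma L_scale:
  assumes "u \<in> sobolev a b p (n + r)"
  shows "L (scale_aefun c u) = scale_aefun c (L u)"
proof -
  obtain Y where Y: "jet a b p (n + r) Y" "u = aefun (Y 0)" using domain_jet[OF assms(1)] by blast
  have "scale_aefun c u = aefun ((\<lambda>k t. c *s Y k t) 0)" by (simp add: Y aefun_scale)
  then have "L (scale_aefun c u) = aefun (ode.diff_expr (\<lambda>k t. c *s Y k t))"
    using L_jet[OF jet_bounded_linear[OF Y(1) bounded_linear_vector_scale[of c]]] by simp
  also have "ode.diff_expr (\<lambda>k t. c *s Y k t) = (\<lambda>t. c *s ode.diff_expr Y t)"
    by (simp add: fun_eq_iff ode.diff_expr_def vector_scalar_commute vec.scale_right_distrib vec.scale_sum_right)
  finally show ?thesis using L_jet[OF Y(1)] by (simp add: Y aefun_scale)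
qed

lemma L_bounded:
  obtains C where "C \<ge> 0" "\<And>u :: (complex^'m) aefun. u \<in> sobolev a b p (n + r) \<Longrightarrow>
    L u \<in> sobolev a b p n \<and> sobolev_norm a b p n (L u) \<le> C * sobolev_norm a b p (n + r) u"
proof -
  obtain C where C: "C \<ge> 0" "\<And>Y. jet a b p (n + r) Y \<Longrightarrow>
      \<exists>Z. jet a b p n Z \<and> Z 0 = ode.diff_expr Y \<and> jnorm n Z \<le> C * jnorm (n + r) Y"
    using ode.diff_expr_bounded by blast
  show ?thesis
  proof (rule that[OF C(1)])
    fix u :: "(complex^'m) aefun" assume "u \<in> sobolev a b p (n + r)"
    then obtain Y where Y: "jet a b p (n + r) Y" "u = aefun (Y 0)" using domain_jet by blast
    obtain Z where Z: "jet a b p n Z" "Z 0 = ode.diff_expr Y" "jnorm n Z \<le> C * jnorm (n + r) Y"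
      using C(2)[OF Y(1)] by blast
    have Lu: "L u = aefun (Z 0)" using L_jet[OF Y(1)] by (simp add: Y Z)
    show "L u \<in> sobolev a b p n \<and> sobolev_norm a b p n (L u) \<le> C * sobolev_norm a b p (n + r) u"
    proof -
      have "sobolev_norm a b p n (L u) = jnorm n Z" by (simp add: Lu sobolev_norm_jet[OF Z(1)] jnorm_def)
      moreover have "sobolev_norm a b p (n + r) u = jnorm (n + r) Y" by (simp add: Y(2) sobolev_norm_jet[OF Y(1)] jnorm_def)
      moreover have "L u \<in> sobolev a b p n" unfolding Lu sobolev_iff_jet using Z(1) by blast
      ultimately show ?thesis using Z(3) by simp
    qed
  qed
qed

lemma L_surj_with_initial_values:
  assumes "f \<in> sobolev a b p n"
  obtains Y where "jet a b p (n + r) Y" "\<And>k. k < r \<Longrightarrow> Y k a = \<eta> k" "L (aefun (Y 0)) = f"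
proof -
  obtain F where F: "jet a b p n F" "aefun (F 0) = f" using assms by (auto simp: sobolev_iff_jet)
  obtain Y where Y: "jet a b p (n + r) Y" "\<And>k. k < r \<Longrightarrow> Y k a = \<eta> k" "ode.diff_expr Y = F 0"
    using ode.ex_regular_solution[OF F(1)] by blast
  then show ?thesis using that[OF Y(1,2)] L_jet[OF Y(1)] F(2) by simp
qed

lemma L_inj_with_initial_values:
  assumes Y: "jet a b p (n + r) Y" "\<And>k. k < r \<Longrightarrow> Y k a = 0" and L: "L (aefun (Y 0)) = 0"
  shows "aefun (Y 0) = 0"
proof -
  obtain Z where Z: "jet a b p n Z" "Z 0 = ode.diff_expr Y" using ode.diff_expr_bounded Y(1) by blast
  have "aefun (ode.diff_expr Y) = aefun (\<lambda>t. 0)" using L L_jet[OF Y(1)] by (simp add: aefun_zero)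
  then have "AE t in lebesgue_on {a..b}. ode.diff_expr Y t = 0"
    using jet_outside[OF Z(1) le0] by (subst (asm) aefun_eq_iff) (auto simp: Z(2))
  from ode.regular_solution_zero[OF Y this] show ?thesis by (simp add: aefun_zero)
qed

text \<open>The coordinates on \<open>ker L\<close>: the component \<open>snd q\<close> of the derivative of order \<open>fst q\<close> at \<open>a\<close>.\<close>

definition initial_value :: "nat \<times> 'm \<Rightarrow> (complex^'m) aefun \<Rightarrow> complex" where
  "initial_value q u = nth_deriv a b (fst q) (sobolev_rep a b p (n + r) u) a $ snd q"

lemma initial_value_jet:
  "jet a b p (n + r) Y \<Longrightarrow> fst q < r \<Longrightarrow> initial_value q (aefun (Y 0)) = Y (fst q) a $ snd q"
  unfolding initial_value_def by (subst sobolev_rep_of_jet(1)) auto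

text \<open>By unique solvability of the initial value problem, the \<open>m r\<close> initial values form a dual system to the
  solutions of \<open>L u = 0\<close> whose initial values are the unit vectors.\<close>

lemma kernel_basis:
  obtains E where "finite E" "\<not> module.dependent scale_aefun E"
    "module.span scale_aefun E = {u \<in> sobolev a b p (n + r). L u = 0}" "card E = CARD('m) * r"
proof -
  interpret v: vector_space "scale_aefun :: complex \<Rightarrow> (complex^'m) aefun \<Rightarrow> _" by (rule vector_space_scale_aefun)
  define N where "N = {u \<in> sobolev a b p (n + r). L u = 0}"
  define I where "I = {..<r} \<times> (UNIV :: 'm set)"
  note X = subspace_sobolev[of "n + r", where 'm='m]
  have L0: "L 0 = 0" using L_scale[OF v.subspace_0[OF X], of 0] by simp
  have N: "v.subspace N"
    unfolding N_def v.subspace_def using v.subspace_0[OF X] v.subspace_add[OF X] v.subspace_scale[OF X] L0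
    by (auto simp: L_add L_scale)
  have "\<exists>u\<in>N. \<forall>q'\<in>I. initial_value q' u = (if q' = q then 1 else 0)" for q
  proof -
    obtain k i where q: "q = (k, i)" by (cases q)
    have "(0 :: (complex^'m) aefun) \<in> sobolev a b p n" using v.subspace_0[OF subspace_sobolev] .
    then obtain Y where Y: "jet a b p (n + r) Y" "\<And>k'. k' < r \<Longrightarrow> Y k' a = (if k' = k then axis i 1 else 0)" "L (aefun (Y 0)) = 0"
      using L_surj_with_initial_values[of 0 "\<lambda>k'. if k' = k then axis i 1 else 0"] by blast
    have "aefun (Y 0) \<in> N" using Y(1,3) by (auto simp: N_def sobolev_iff_jet)
    moreover have "initial_value q' (aefun (Y 0)) = (if q' = q then 1 else 0)" if "q' \<in> I" for q'
      using that Y(2)[of "fst q'"] initial_value_jet[OF Y(1), of q'] by (cases q') (auto simp: I_def q axis_def)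
    ultimately show ?thesis by blast
  qed
  then obtain e where e: "\<And>q. e q \<in> N" "\<And>q q'. q' \<in> I \<Longrightarrow> initial_value q' (e q) = (if q' = q then 1 else 0)"
    by metis
  have jets: "\<exists>Y. jet a b p (n + r) Y \<and> u = aefun (Y 0)" if "u \<in> N" for u
    using that domain_jet by (auto simp: N_def)
  have add: "initial_value q (u + v) = initial_value q u + initial_value q v" if q: "q \<in> I" and uv: "u \<in> N" "v \<in> N" for q u v
    proof -
      obtain Y Z where YZ: "jet a b p (n + r) Y" "u = aefun (Y 0)" "jet a b p (n + r) Z" "v = aefun (Z 0)"
        using jets uv by blast
      have q': "fst q < r" using q by (auto simp: I_def)
      show ?thesis
        using initial_value_jet[OF jet_add[OF YZ(1,3)] q'] initial_value_jet[OF YZ(1) q'] initial_value_jet[OF YZ(3) q']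
        by (simp add: YZ(2,4) aefun_plus)
    qed
  have scale: "initial_value q (scale_aefun c u) = c * initial_value q u" if q: "q \<in> I" and u: "u \<in> N" for q c u
    proof -
      obtain Y where Y: "jet a b p (n + r) Y" "u = aefun (Y 0)" using jets u by blast
      have q': "fst q < r" using q by (auto simp: I_def)
      show ?thesis
        using initial_value_jet[OF jet_bounded_linear[OF Y(1) bounded_linear_vector_scale[of c]] q'] initial_value_jet[OF Y(1) q']
        by (simp add: Y(2) aefun_scale)
    qed
  have total: "u = 0" if u: "u \<in> N" and 0: "\<And>q. q \<in> I \<Longrightarrow> initial_value q u = 0" for u
    proof -
      obtain Y where Y: "jet a b p (n + r) Y" "u = aefun (Y 0)" using jets u by blast
      have "Y k a = 0" if "k < r" for k
        using 0[of "(k, _)"] initial_value_jet[OF Y(1), of "(k, _)"] that by (simp add: vec_eq_iff I_def Y(2))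
      then show ?thesis using L_inj_with_initial_values[OF Y(1)] u by (auto simp: N_def Y(2))
    qed
  have finI: "finite I" by (simp add: I_def)
  note basis = dual_basis[OF vector_space_scale_aefun N finI e(1) add scale e(2) total]
  have card_I: "card I = CARD('m) * r" by (simp add: I_def mult.commute)
  show ?thesis by (rule that[OF basis(1,2) basis(3)[unfolded N_def] trans[OF basis(4) card_I]])
qed

lemma fredholm:
  fixes B :: "(complex^'m) aefun \<Rightarrow> complex^'l"
  assumes B: "bounded_clinear_op (sobolev_space a b p (n + r)) coord_space B"
  defines "T \<equiv> \<lambda>y. (L y, B y)"
  shows "fredholm_op (sobolev_space a b p (n + r)) (prod_space (sobolev_space a b p n) coord_space) T"
    and "fredholm_index (sobolev_space a b p (n + r)) (prod_space (sobolev_space a b p n) coord_space) T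
         = int (CARD('m) * r) - int CARD('l)"
proof -
  let ?X = "sobolev_space a b p (n + r) :: (complex^'m) aefun cnspace"
  let ?Y = "sobolev_space a b p n :: (complex^'m) aefun cnspace"
  let ?Z = "prod_space ?Y (coord_space :: (complex^'l) cnspace)"
  have eX: "elems ?X = sobolev a b p (n + r)" "cscale ?X = scale_aefun" "cnorm ?X = sobolev_norm a b p (n + r)"
    and eY: "elems ?Y = sobolev a b p n" "cscale ?Y = scale_aefun" "cnorm ?Y = sobolev_norm a b p n"
    by (simp_all add: sobolev_space_def)
  have eC: "cscale (coord_space :: (complex^'l) cnspace) = (*s)" "cnorm (coord_space :: (complex^'l) cnspace) = norm"
    by (simp_all add: coord_space_def)
  have eZ: "elems ?Z = sobolev a b p n \<times> UNIV" "\<And>c f z. cscale ?Z c (f, z) = (scale_aefun c f, c *s z)"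
    "\<And>f z. cnorm ?Z (f, z) = sobolev_norm a b p n f + norm z"
    by (simp_all add: prod_space_def coord_space_def sobolev_space_def)
  have B_add: "\<And>x y. \<lbrakk>x \<in> elems ?X; y \<in> elems ?X\<rbrakk> \<Longrightarrow> B (x + y) = B x + B y"
    and B_scale: "\<And>c x. x \<in> elems ?X \<Longrightarrow> B (cscale ?X c x) = c *s B x"
    using B by (auto simp: bounded_clinear_op_def eC)
  obtain K where K: "\<And>x. x \<in> elems ?X \<Longrightarrow> norm (B x) \<le> K * cnorm ?X x"
    using B[unfolded bounded_clinear_op_def eC] by blast
  obtain C where C: "\<And>u. u \<in> sobolev a b p (n + r) \<Longrightarrow>
    L u \<in> sobolev a b p n \<and> sobolev_norm a b p n (L u) \<le> C * sobolev_norm a b p (n + r) u"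
    using L_bounded by blast
  obtain E where E: "finite E" "\<not> module.dependent scale_aefun E"
    "module.span scale_aefun E = {u \<in> sobolev a b p (n + r). L u = 0}" "card E = CARD('m) * r"
    using kernel_basis by blast
  interpret v: vector_space "scale_aefun :: complex \<Rightarrow> (complex^'m) aefun \<Rightarrow> _" by (rule vector_space_scale_aefun)
  have "f \<in> L ` sobolev a b p (n + r)" if f: "f \<in> sobolev a b p n" for f
  proof -
    obtain Y where "jet a b p (n + r) Y" "L (aefun (Y 0)) = f"
      using L_surj_with_initial_values[OF f, of "\<lambda>k. 0"] by blast
    then show ?thesis by (intro image_eqI[of _ _ "aefun (Y 0)"]) (auto simp: sobolev_iff_jet)
  qed
  with C have L_image: "L ` elems ?X = elems ?Y" by (auto simp: eX eY)
  have X: "module.subspace (cscale ?X) (elems ?X)" and Y0: "0 \<in> elems ?Y"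
    unfolding eX eY by (rule subspace_sobolev v.subspace_0[OF subspace_sobolev])+
  have L_lin: "\<And>x y. \<lbrakk>x \<in> elems ?X; y \<in> elems ?X\<rbrakk> \<Longrightarrow> L (x + y) = L x + L y"
    "\<And>c x. x \<in> elems ?X \<Longrightarrow> L (cscale ?X c x) = cscale ?Y c (L x)"
    unfolding eX eY by (rule L_add L_scale; assumption)+
  note F = fredholm_from_surjective[OF vector_space_cscale(1) vector_space_cscale(1) X Y0 L_image L_lin B_add B_scale E(1)
      E(2,3)[folded eX], folded T_def]
  have bounded: "bounded_clinear_op ?X ?Z T"
    unfolding bounded_clinear_op_def
  proof (intro conjI ballI allI)
    show "T ` elems ?X \<subseteq> elems ?Z" using C by (auto simp: T_def eX eZ)
    show "T (x + y) = T x + T y" if "x \<in> elems ?X" "y \<in> elems ?X" for x y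
      using that B_add[OF that] L_add[of x y] by (simp add: T_def eX)
    show "T (cscale ?X c x) = cscale ?Z c (T x)" if "x \<in> elems ?X" for c x
      using that B_scale[OF that, of c] L_scale[of x c] by (simp add: T_def eX eZ)
    show "\<exists>K. \<forall>x\<in>elems ?X. cnorm ?Z (T x) \<le> K * cnorm ?X x"
    proof (intro exI ballI)
      fix x assume x: "x \<in> elems ?X"
      then show "cnorm ?Z (T x) \<le> (C + K) * cnorm ?X x"
        using K[OF x] C[of x] by (simp add: T_def eX eZ distrib_right)
    qed
  qed
  show "fredholm_op ?X ?Z T"
    unfolding fredholm_op_def using bounded F(1,2) by blast
  show "fredholm_index ?X ?Z T = int (CARD('m) * r) - int CARD('l)"
    using F(3) E(4) by simp
qed

end

theorem theorem1:
  fixes a b :: real and n r :: nat and p :: ennreal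
    and A :: "nat \<Rightarrow> (complex^'m^'m) aefun"
    and B :: "(complex^'m) aefun \<Rightarrow> complex^'l"
  assumes "a < b" and "1 \<le> r" and "1 \<le> p"
    and "\<And>k. k < r \<Longrightarrow> A k \<in> sobolev a b p n"
    and "bounded_clinear_op (sobolev_space a b p (n + r)) coord_space B"
  shows "fredholm_op (sobolev_space a b p (n + r))
           (prod_space (sobolev_space a b p n) coord_space)
           (\<lambda>y. (diff_op a b p n r A y, B y)) \<and>
         fredholm_index (sobolev_space a b p (n + r))
           (prod_space (sobolev_space a b p n) coord_space)
           (\<lambda>y. (diff_op a b p n r A y, B y))
         = int (CARD('m) * r) - int CARD('l)"
proof -
  interpret sobolev_diff_op a b p n r A by unfold_locales (use assms in auto)
  show ?thesis using fredholm[OF assms(5)] by blast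
qed

end
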